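(* Let $hCAT$ be the homotopy category of moderately small categories and let $A=Cat$ be the $1$-category of small categories. With the morphism $p:F\to Cat$, the unit $1_F$, the dependent sum functions $\sum^x$ (oplax colimits) and the flattening maps $f^\flat$ described in the context, $Cat$ is a commutative dependent adder in $hCAT$.
   Context: Fix strongly inaccessible cardinals $\kappa_0<\kappa_1$. A category is small if it is smaller than $\kappa_0$, moderately small if it is smaller than $\kappa_1$. $Cat$ and $CAT$ are the $1$-categories of small, respectively moderately small, categories. The category $hCAT$: for moderately small $I,J$ let $\mathrm{Hom}_{hCAT}(I,J)$ be a skeleton of the category of functors $I\to J$, so that for every functor $G:I\to J$ there is exactly one functor $\mathrm{Ho}(G)\in\mathrm{Hom}_{hCAT}(I,J)$ with $G\cong\mathrm{Ho}(G)$. Objects of $hCAT$ are the moderately small categories, morphisms are the elements of $\mathrm{Hom}_{hCAT}(I,J)$, and the composite of two morphisms is $\mathrm{Ho}$ of their composite in $CAT$. Thus a diagram of functors commuting up to natural isomorphism in $CAT$ gives a strictly commuting diagram in $hCAT$. $hCAT$ has finite limits; its pullbacks need not coincide with those of $CAT$ in general, but pullbacks in $CAT$ of Grothendieck fibrations or opfibrations are also pullbacks in $hCAT$. Oplax colimits: for a functor $f:I\to CAT$, $\mathrm{colim}^{oplax}_{i\in I}f(i)$ is the category with objects the pairs $(i,j)$, $i\in I$, $j\in f(i)$, and morphisms $(i,j)\to(i',j')$ the pairs $(\alpha,\beta)$ with $\alpha:i\to i'$ in $I$ and $\beta:f(\alpha)(j)\to j'$ in $f(i')$. The structure on $A=Cat$: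 the inclusion functor $Cat\to CAT$, $I\mapsto I$, corresponds to a Grothendieck opfibration $p^\heartsuit:F\to Cat$ whose fiber over $I$ is isomorphic to $I$; put $p=\mathrm{Ho}(p^\heartsuit)$. Let $1_F=\mathrm{Ho}(1_F^\heartsuit)$, where $1_F^\heartsuit:1\to F$ picks out the terminal category $1\in Cat$ together with its unique object. For $x:U\to Cat$ in $hCAT$, $\llbracket x\rrbracket$ denotes the pullback of $x$ and $p$ in $hCAT$, and there is an isomorphism $\llbracket x\rrbracket\cong\mathrm{colim}^{oplax}_{u\in U}x(u)$. For $f:\llbracket x\rrbracket\to Cat$ in $hCAT$ let $(\sum^x f)^\heartsuit:U\to Cat$ be the functor given on objects by $u\mapsto\mathrm{colim}^{oplax}_{i\in x(u)}f(u,i)$, and on a morphism $\alpha:u\to v$ by the functor induced, via the universal property of the oplax colimit, by the composites $f(u,i)\to f(v,x(\alpha)(i))\to\mathrm{colim}^{oplax}_{k\in x(v)}f(v,k)$ whose first functor is $f(\alpha,\mathrm{id}_{x(\alpha)(i)})$. Put $\sum^x f=\mathrm{Ho}((\sum^x f)^\heartsuit)$. The flattening map $f^\flat:\llbracket f\rrbracket\to\llbracket\sum^x f\rrbracket$ is $\mathrm{Ho}$ of the canonical isomorphism $$\mathrm{colim}^{oplax}_{(u,i)\in\mathrm{colim}^{oplax}_{u\in U}x(u)}f(u,i)\ \xrightarrow{\ \sim\ }\ \mathrm{colim}^{oplax}_{u\in U}\,\mathrm{colim}^{oplax}_{i\in x(u)}f(u,i).$$ Let $\mathscr{C}$ be a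 category with finite limits and terminal object $*$. A dependent adder in $\mathscr{C}$ consists of: (1) an object $A$; (2) a morphism $p:F\to A$; for $x:U\to A$ write $\llbracket x\rrbracket=U\times_A F$ for the pullback of $x$ and $p$, and $p_x:\llbracket x\rrbracket\to U$ for the projection; (3) a morphism $1_F:*\to F$; put $1_A=p\circ 1_F$; (4) for every $x:U\to A$ a function $\sum^{x}:\mathrm{Hom}_{\mathscr{C}}(\llbracket x\rrbracket,A)\to\mathrm{Hom}_{\mathscr{C}}(U,A)$, natural in the sense that for all $h:U\to U'$ and $y:U'\to A$ in $\mathscr{C}$ with $y\circ h=x$ in $\mathscr{C}$ one has $\sum^{x}(g\circ(h\times_A\mathrm{id}_F))=(\sum^{y}g)\circ h$ for all $g:\llbracket y\rrbracket\to A$; (5) for every $x:U\to A$ and $f:\llbracket x\rrbracket\to A$ a morphism $f^\flat:\llbracket f\rrbracket\to\llbracket\sum^{x}f\rrbracket$ with $p_{\sum^x f}\circ f^\flat=p_x\circ p_f$. The axioms are the following equalities in $\mathscr{C}$, for all $x:U\to A$, $f:\llbracket x\rrbracket\to A$, $g:\llbracket\sum^x f\rrbracket\to A$, with $const_{1_A}:\llbracket x\rrbracket\to *\to A$ the constant $1_A$ map: (Right Unit) $\sum^{x}const_{1_A}=x$; (Left Unit) $\sum^{const_{1_A}}(f\circ const_{1_A}^\flat)=f$; (Sum Associativity) $\sum^{\sum^x f}g=\sum^x\sum^f(g\circ f^\flat)$; (Flatten Associativity) $g^\flat\circ(f^\flat\times_A\mathrm{id}_F)=\big(\sum^f(g\circ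 f^\flat)\big)^\flat\circ(g\circ f^\flat)^\flat$ as morphisms $\llbracket g\circ f^\flat\rrbracket\to\llbracket\sum^x\sum^f(g\circ f^\flat)\rrbracket$. A dependent adder is commutative if for all $x,y:U\to A$ and $f:\llbracket x\circ p_y\rrbracket\to A$ one has $\sum^{y}\sum^{x\circ p_y}f=\sum^{x}\sum^{y\circ p_x}(f\circ switch)$, where $switch:\llbracket y\circ p_x\rrbracket\to\llbracket x\circ p_y\rrbracket$ is the canonical isomorphism.
   Formalization: hCAT lacks these pullbacks, so [[x]] is the oplax colimit, only a weak pullback; h x_A id_F and switch range over all values induced by natural isomorphisms; Left Unit and Flatten Associativity hold up to a reindexing by a natural automorphism; strict Flatten Associativity is false. *)

theory Defs
  imports Main "HOL-Library.FuncSet"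
begin

unbundle cardinal_syntax

section \<open>Categories, functors, oplax colimits\<close>

record ('o, 'm) cat =
  Ob  :: "'o set"
  Ar  :: "'m set"
  Dom :: "'m \<Rightarrow> 'o"
  Cod :: "'m \<Rightarrow> 'o"
  Idn :: "'o \<Rightarrow> 'm"
  Cmp :: "'m \<Rightarrow> 'm \<Rightarrow> 'm"  (infixl "\<cdot>\<index>" 70)

text \<open>All operations are \<open>undefined\<close> off their domains, so that equality of records is
  equality of categories.\<close>

definition category :: "('o, 'm) cat \<Rightarrow> bool" where
  "category C \<longleftrightarrow>
     (\<forall>f\<in>Ar C. Dom C f \<in> Ob C \<and> Cod C f \<in> Ob C) \<and>
     (\<forall>a\<in>Ob C. Idn C a \<in> Ar C \<and> Dom C (Idn C a) = a \<and> Cod C (Idn C a) = a) \<and>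
     (\<forall>f\<in>Ar C. \<forall>g\<in>Ar C. Dom C g = Cod C f \<longrightarrow>
        Cmp C g f \<in> Ar C \<and> Dom C (Cmp C g f) = Dom C f \<and> Cod C (Cmp C g f) = Cod C g) \<and>
     (\<forall>f\<in>Ar C. Cmp C f (Idn C (Dom C f)) = f \<and> Cmp C (Idn C (Cod C f)) f = f) \<and>
     (\<forall>f\<in>Ar C. \<forall>g\<in>Ar C. \<forall>h\<in>Ar C. Dom C g = Cod C f \<longrightarrow> Dom C h = Cod C g \<longrightarrow>
        Cmp C h (Cmp C g f) = Cmp C (Cmp C h g) f) \<and>
     Dom C \<in> extensional (Ar C) \<and> Cod C \<in> extensional (Ar C) \<and> Idn C \<in> extensional (Ob C) \<and>
     (\<forall>g f. \<not> (g \<in> Ar C \<and> f \<in> Ar C \<and> Dom C g = Cod C f) \<longrightarrow> Cmp C g f = undefined)"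

definition mk_cat ::
  "'o set \<Rightarrow> 'm set \<Rightarrow> ('m \<Rightarrow> 'o) \<Rightarrow> ('m \<Rightarrow> 'o) \<Rightarrow> ('o \<Rightarrow> 'm) \<Rightarrow> ('m \<Rightarrow> 'm \<Rightarrow> 'm) \<Rightarrow> ('o, 'm) cat" where
  "mk_cat obs ars d c i m =
     \<lparr>Ob = obs, Ar = ars, Dom = restrict d ars, Cod = restrict c ars, Idn = restrict i obs,
      Cmp = (\<lambda>g f. if g \<in> ars \<and> f \<in> ars \<and> d g = c f then m g f else undefined)\<rparr>"

definition hom :: "('o, 'm) cat \<Rightarrow> 'o \<Rightarrow> 'o \<Rightarrow> 'm set" where
  "hom C a b = {f \<in> Ar C. Dom C f = a \<and> Cod C f = b}"

definition iso_arrow :: "('o, 'm) cat \<Rightarrow> 'm \<Rightarrow> bool" where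
  "iso_arrow C f \<longleftrightarrow> f \<in> Ar C \<and>
     (\<exists>g\<in>hom C (Cod C f) (Dom C f). Cmp C g f = Idn C (Dom C f) \<and> Cmp C f g = Idn C (Cod C f))"

definition terminal :: "('o, 'm) cat \<Rightarrow> 'o \<Rightarrow> bool" where
  "terminal C t \<longleftrightarrow> t \<in> Ob C \<and> (\<forall>a\<in>Ob C. \<exists>!f. f \<in> hom C a t)"

definition cone_over :: "('o, 'm) cat \<Rightarrow> 'm \<Rightarrow> 'm \<Rightarrow> 'o \<Rightarrow> 'm \<Rightarrow> 'm \<Rightarrow> bool" where
  "cone_over C f g P a b \<longleftrightarrow> P \<in> Ob C \<and> a \<in> hom C P (Dom C f) \<and> b \<in> hom C P (Dom C g) \<and>
     Cmp C f a = Cmp C g b"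

definition pullback :: "('o, 'm) cat \<Rightarrow> 'm \<Rightarrow> 'm \<Rightarrow> 'o \<Rightarrow> 'm \<Rightarrow> 'm \<Rightarrow> bool" where
  "pullback C f g P a b \<longleftrightarrow> cone_over C f g P a b \<and>
     (\<forall>T c d. cone_over C f g T c d \<longrightarrow> (\<exists>!w. w \<in> hom C T P \<and> Cmp C a w = c \<and> Cmp C b w = d))"

definition weak_pullback :: "('o, 'm) cat \<Rightarrow> 'm \<Rightarrow> 'm \<Rightarrow> 'o \<Rightarrow> 'm \<Rightarrow> 'm \<Rightarrow> bool" where
  "weak_pullback C f g P a b \<longleftrightarrow> cone_over C f g P a b \<and>
     (\<forall>T c d. cone_over C f g T c d \<longrightarrow> (\<exists>w. w \<in> hom C T P \<and> Cmp C a w = c \<and> Cmp C b w = d))"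

record ('o, 'm, 'p, 'n) fct =
  Src :: "('o, 'm) cat"
  Tgt :: "('p, 'n) cat"
  FO  :: "'o \<Rightarrow> 'p"
  FM  :: "'m \<Rightarrow> 'n"

definition is_functor :: "('o, 'm, 'p, 'n) fct \<Rightarrow> bool" where
  "is_functor G \<longleftrightarrow> category (Src G) \<and> category (Tgt G) \<and>
     FO G \<in> extensional (Ob (Src G)) \<and> FM G \<in> extensional (Ar (Src G)) \<and>
     (\<forall>a\<in>Ob (Src G). FO G a \<in> Ob (Tgt G) \<and> FM G (Idn (Src G) a) = Idn (Tgt G) (FO G a)) \<and>
     (\<forall>f\<in>Ar (Src G). FM G f \<in> hom (Tgt G) (FO G (Dom (Src G) f)) (FO G (Cod (Src G) f))) \<and>
     (\<forall>f\<in>Ar (Src G). \<forall>g\<in>Ar (Src G). Dom (Src G) g = Cod (Src G) f \<longrightarrow>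
        FM G (Cmp (Src G) g f) = Cmp (Tgt G) (FM G g) (FM G f))"

definition mk_fct ::
  "('o, 'm) cat \<Rightarrow> ('p, 'n) cat \<Rightarrow> ('o \<Rightarrow> 'p) \<Rightarrow> ('m \<Rightarrow> 'n) \<Rightarrow> ('o, 'm, 'p, 'n) fct" where
  "mk_fct C D o' m' = \<lparr>Src = C, Tgt = D, FO = restrict o' (Ob C), FM = restrict m' (Ar C)\<rparr>"

definition id_fct :: "('o, 'm) cat \<Rightarrow> ('o, 'm, 'o, 'm) fct" where
  "id_fct C = mk_fct C C id id"

definition cmp_fct ::
  "('p, 'n, 'q, 'k) fct \<Rightarrow> ('o, 'm, 'p, 'n) fct \<Rightarrow> ('o, 'm, 'q, 'k) fct" (infixl "\<circ>\<^sub>F" 55) where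
  "G \<circ>\<^sub>F H = mk_fct (Src H) (Tgt G) (FO G \<circ> FO H) (FM G \<circ> FM H)"

definition nat_iso ::
  "('o, 'm, 'p, 'n) fct \<Rightarrow> ('o, 'm, 'p, 'n) fct \<Rightarrow> ('o \<Rightarrow> 'n) \<Rightarrow> bool" where
  "nat_iso G H \<eta> \<longleftrightarrow> is_functor G \<and> is_functor H \<and> Src G = Src H \<and> Tgt G = Tgt H \<and>
     (\<forall>a\<in>Ob (Src G). \<eta> a \<in> hom (Tgt G) (FO G a) (FO H a) \<and> iso_arrow (Tgt G) (\<eta> a)) \<and>
     (\<forall>f\<in>Ar (Src G). Cmp (Tgt G) (\<eta> (Cod (Src G) f)) (FM G f) =
                      Cmp (Tgt G) (FM H f) (\<eta> (Dom (Src G) f)))"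

definition iso_fct :: "('o, 'm, 'p, 'n) fct \<Rightarrow> ('o, 'm, 'p, 'n) fct \<Rightarrow> bool" (infix "\<cong>\<^sub>F" 50) where
  "G \<cong>\<^sub>F H \<longleftrightarrow> (\<exists>\<eta>. nat_iso G H \<eta>)"

definition one_cat :: "'a \<Rightarrow> ('a, 'a) cat" where
  "one_cat a = mk_cat {a} {a} id id id (\<lambda>_ _. a)"

definition recode :: "('o \<Rightarrow> 'p) \<Rightarrow> ('m \<Rightarrow> 'n) \<Rightarrow> ('o, 'm) cat \<Rightarrow> ('p, 'n) cat" where
  "recode e e' C = (let d = inv_into (Ob C) e; d' = inv_into (Ar C) e' in
     mk_cat (e ` Ob C) (e' ` Ar C) (\<lambda>f. e (Dom C (d' f))) (\<lambda>f. e (Cod C (d' f)))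
       (\<lambda>a. e' (Idn C (d a))) (\<lambda>g f. e' (Cmp C (d' g) (d' f))))"

text \<open>The oplax colimit of the functor on \<open>J\<close> with values \<open>c i\<close> and transition functors
  \<open>t \<alpha>\<close>. A morphism \<open>(\<alpha>, \<beta>)\<close> out of \<open>(i, j)\<close> is stored as \<open>(j, \<alpha>, \<beta>)\<close>: its
  source cannot be recovered from \<open>\<alpha>\<close> and \<open>\<beta>\<close> alone.\<close>

definition oplax_colim ::
  "('a, 'b) cat \<Rightarrow> ('a \<Rightarrow> ('c, 'd) cat) \<Rightarrow> ('b \<Rightarrow> ('c, 'd, 'c, 'd) fct)
     \<Rightarrow> ('a \<times> 'c, 'c \<times> 'b \<times> 'd) cat" where
  "oplax_colim J c t = mk_cat
     {(i, j). i \<in> Ob J \<and> j \<in> Ob (c i)}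
     {(j, \<alpha>, \<beta>). \<alpha> \<in> Ar J \<and> j \<in> Ob (c (Dom J \<alpha>)) \<and>
                 \<beta> \<in> Ar (c (Cod J \<alpha>)) \<and> Dom (c (Cod J \<alpha>)) \<beta> = FO (t \<alpha>) j}
     (\<lambda>(j, \<alpha>, \<beta>). (Dom J \<alpha>, j))
     (\<lambda>(j, \<alpha>, \<beta>). (Cod J \<alpha>, Cod (c (Cod J \<alpha>)) \<beta>))
     (\<lambda>(i, j). (j, Idn J i, Idn (c i) j))
     (\<lambda>(j', \<alpha>', \<beta>') (j, \<alpha>, \<beta>).
        (j, Cmp J \<alpha>' \<alpha>, Cmp (c (Cod J \<alpha>')) \<beta>' (FM (t \<alpha>') \<beta>)))"

section \<open>Small and moderately small categories\<close>

definition strongly_inaccessible :: "'a rel \<Rightarrow> bool" where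
  "strongly_inaccessible r \<longleftrightarrow> Card_order r \<and> natLeq <o r \<and> regularCard r \<and>
     (\<forall>X :: 'a set. |X| <o r \<longrightarrow> |Pow X| <o r)"

text \<open>The cardinals are \<open>\<kappa>\<^sub>0 = |UNIV :: 's set|\<close> and \<open>\<kappa>\<^sub>1 = |UNIV :: 'u set|\<close>. Small
  categories live on the type \<open>'s small\<close>, moderately small ones on \<open>('s, 'u) moderate\<close>;
  for infinite \<open>\<kappa>\<^sub>0 < \<kappa>\<^sub>1\<close> as below these types again have cardinality \<open>\<kappa>\<^sub>0\<close> and
  \<open>\<kappa>\<^sub>1\<close>, so every category of size \<open>< \<kappa>\<^sub>0\<close> (\<open>< \<kappa>\<^sub>1\<close>) has an isomorphic copy there.
  The constructors provide the ordered pairs, and the small categories and functors as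
  elements, that in set theory are available for free.\<close>

datatype 's small = SAtom 's | SPair "'s small" "'s small"

type_synonym 's scat = "('s small, 's small) cat"
type_synonym 's sfct = "('s small, 's small, 's small, 's small) fct"

datatype ('s, 'u) moderate =
    MAtom 'u
  | MElt "'s small"
  | MCat (the_cat: "'s scat")
  | MFct (the_fct: "'s sfct")
  | MPair "('s, 'u) moderate" "('s, 'u) moderate"

type_synonym ('s, 'u) mcat = "(('s, 'u) moderate, ('s, 'u) moderate) cat"
type_synonym ('s, 'u) mfct =
  "(('s, 'u) moderate, ('s, 'u) moderate, ('s, 'u) moderate, ('s, 'u) moderate) fct"

definition smaller_than :: "'a rel \<Rightarrow> ('o, 'm) cat \<Rightarrow> bool" where
  "smaller_than r C \<longleftrightarrow> |Ob C| <o r \<and> |Ar C| <o r"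

definition SmallCats :: "'s scat set" where
  "SmallCats = {C. category C \<and> smaller_than |UNIV :: 's set| C}"

definition ModCats :: "('s, 'u) mcat set" where
  "ModCats = {C. category C \<and> smaller_than |UNIV :: 'u set| C}"

definition ModFcts :: "('s, 'u) mfct set" where
  "ModFcts = {G. is_functor G \<and> Src G \<in> ModCats \<and> Tgt G \<in> ModCats}"

definition Cat :: "('s, 'u) mcat" where
  "Cat = mk_cat (MCat ` SmallCats)
     (MFct ` {G. is_functor G \<and> Src G \<in> SmallCats \<and> Tgt G \<in> SmallCats})
     (\<lambda>g. MCat (Src (the_fct g))) (\<lambda>g. MCat (Tgt (the_fct g)))
     (\<lambda>a. MFct (id_fct (the_cat a))) (\<lambda>g f. MFct (the_fct g \<circ>\<^sub>F the_fct f))"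

section \<open>The category hCAT\<close>

text \<open>\<open>Sk\<close> is the union of the chosen skeletons of all functor categories.\<close>

definition functor_skeleton :: "('s, 'u) mfct set \<Rightarrow> bool" where
  "functor_skeleton Sk \<longleftrightarrow> Sk \<subseteq> ModFcts \<and> (\<forall>G\<in>ModFcts. \<exists>!H. H \<in> Sk \<and> G \<cong>\<^sub>F H)"

definition Ho :: "('s, 'u) mfct set \<Rightarrow> ('s, 'u) mfct \<Rightarrow> ('s, 'u) mfct" where
  "Ho Sk G = (THE H. H \<in> Sk \<and> G \<cong>\<^sub>F H)"

definition hCAT :: "('s, 'u) mfct set \<Rightarrow> (('s, 'u) mcat, ('s, 'u) mfct) cat" where
  "hCAT Sk = mk_cat ModCats Sk Src Tgt (\<lambda>I. Ho Sk (id_fct I)) (\<lambda>g f. Ho Sk (g \<circ>\<^sub>F f))"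

section \<open>Dependent adders\<close>

definition const_mor :: "('o, 'm) cat \<Rightarrow> 'o \<Rightarrow> 'm \<Rightarrow> 'o \<Rightarrow> 'm" where
  "const_mor C one a X = Cmp C a (THE t. t \<in> hom C X one)"

text \<open>\<open>\<lbrakk>x\<rbrakk> = br x\<close> with projections \<open>pr x\<close>, \<open>q x\<close> is the pullback of \<open>x : U \<rightarrow> A\<close>
  and \<open>p : F \<rightarrow> A\<close>, and \<open>bc h y\<close> is the set of morphisms \<open>\<lbrakk>y \<circ> h\<rbrakk> \<rightarrow> \<lbrakk>y\<rbrakk>\<close> that may serve
  as \<open>h \<times>\<^sub>A id\<^sub>F\<close>.

  If the squares are pullbacks, \<open>bc h y\<close> consists of \<open>h \<times>\<^sub>A id\<^sub>F\<close> alone, every \<open>\<theta>\<close> below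
  is an identity and the axioms are literally those of a dependent adder (\<open>bc_unique\<close>,
  \<open>bc_Idn\<close>, \<open>left_unit_strict\<close>, \<open>flatten_assoc_strict\<close> below). In hCAT the square of an
  opfibration in CAT is in general only a weak pullback: the point \<open>1 \<rightarrow> Cat\<close> at the
  discrete category \<open>{0, 1}\<close> pulls \<open>F\<close> back to \<open>{0, 1}\<close>, whose two points become
  isomorphic in \<open>F\<close>. The morphism \<open>h \<times>\<^sub>A id\<^sub>F\<close> then depends on a natural isomorphism
  filling the triangle over \<open>A\<close>. Conditions on \<open>h \<times>\<^sub>A id\<^sub>F\<close> are required for every choice,
  and the identifications \<open>\<lbrakk>x\<rbrakk> = \<lbrakk>x'\<rbrakk>\<close> coming from an equality \<open>x = x'\<close> are made along
  some \<open>\<theta> \<in> bc id x\<close>.\<close>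

locale dependent_adder =
  fixes C :: "('o, 'm) cat" (structure)
    and A F :: 'o and p :: 'm
    and one :: 'o and oneF :: 'm
    and br :: "'m \<Rightarrow> 'o" and pr q :: "'m \<Rightarrow> 'm"
    and bc :: "'m \<Rightarrow> 'm \<Rightarrow> 'm set"
    and dsum :: "'m \<Rightarrow> 'm \<Rightarrow> 'm"
    and flat :: "'m \<Rightarrow> 'm \<Rightarrow> 'm"
  assumes category: "category C"
    and p_hom: "A \<in> Ob C" "F \<in> Ob C" "p \<in> hom C F A"
    and one: "terminal C one" "oneF \<in> hom C one F"
    and bracket: "x \<in> hom C U A \<Longrightarrow> weak_pullback C x p (br x) (pr x) (q x)"
    and base_change_ex: "h \<in> hom C U U' \<Longrightarrow> y \<in> hom C U' A \<Longrightarrow> bc h y \<noteq> {}"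
    and base_change: "h \<in> hom C U U' \<Longrightarrow> y \<in> hom C U' A \<Longrightarrow> w \<in> bc h y \<Longrightarrow>
          w \<in> hom C (br (y \<cdot> h)) (br y) \<and>
          pr y \<cdot> w = h \<cdot> pr (y \<cdot> h) \<and> q y \<cdot> w = q (y \<cdot> h)"
    and dsum_hom: "x \<in> hom C U A \<Longrightarrow> f \<in> hom C (br x) A \<Longrightarrow> dsum x f \<in> hom C U A"
    and dsum_natural: "h \<in> hom C U U' \<Longrightarrow> y \<in> hom C U' A \<Longrightarrow> w \<in> bc h y \<Longrightarrow>
          g \<in> hom C (br y) A \<Longrightarrow> dsum (y \<cdot> h) (g \<cdot> w) = dsum y g \<cdot> h"
    and flat_hom: "x \<in> hom C U A \<Longrightarrow> f \<in> hom C (br x) A \<Longrightarrow>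
          flat x f \<in> hom C (br f) (br (dsum x f)) \<and> pr (dsum x f) \<cdot> flat x f = pr x \<cdot> pr f"
    and right_unit: "x \<in> hom C U A \<Longrightarrow> dsum x (const_mor C one (p \<cdot> oneF) (br x)) = x"
    and left_unit: "x \<in> hom C U A \<Longrightarrow>
          \<exists>\<theta>\<in>bc (Idn C U) x. \<forall>f\<in>hom C (br x) A.
            dsum (const_mor C one (p \<cdot> oneF) (br x)) (f \<cdot> (\<theta> \<cdot> flat x (const_mor C one (p \<cdot> oneF) (br x)))) = f"
    and sum_assoc: "x \<in> hom C U A \<Longrightarrow> f \<in> hom C (br x) A \<Longrightarrow> g \<in> hom C (br (dsum x f)) A \<Longrightarrow>
          dsum (dsum x f) g = dsum x (dsum f (g \<cdot> flat x f))"
    and flatten_assoc: "x \<in> hom C U A \<Longrightarrow> f \<in> hom C (br x) A \<Longrightarrow> g \<in> hom C (br (dsum x f)) A \<Longrightarrow>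
          w \<in> bc (flat x f) g \<Longrightarrow>
          \<exists>\<theta>\<in>bc (Idn C U) (dsum (dsum x f) g).
            \<theta> \<cdot> (flat (dsum x f) g \<cdot> w) =
            flat x (dsum f (g \<cdot> flat x f)) \<cdot> flat f (g \<cdot> flat x f)"

context dependent_adder
begin

lemma comp_hom: "f \<in> hom C a b \<Longrightarrow> g \<in> hom C b c \<Longrightarrow> g \<cdot> f \<in> hom C a c"
  using category unfolding category_def hom_def by auto

lemma comp_assoc: "f \<in> hom C a b \<Longrightarrow> g \<in> hom C b c \<Longrightarrow> h \<in> hom C c d \<Longrightarrow> h \<cdot> (g \<cdot> f) = (h \<cdot> g) \<cdot> f"
  using category unfolding category_def hom_def by auto

lemma Idn_hom: "a \<in> Ob C \<Longrightarrow> Idn C a \<in> hom C a a"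
  using category unfolding category_def hom_def by auto

lemma Idn_left: "f \<in> hom C a b \<Longrightarrow> Idn C b \<cdot> f = f"
  using category unfolding category_def hom_def by auto

lemma Idn_right: "f \<in> hom C a b \<Longrightarrow> f \<cdot> Idn C a = f"
  using category unfolding category_def hom_def by auto

lemma hom_Ob: "f \<in> hom C a b \<Longrightarrow> a \<in> Ob C \<and> b \<in> Ob C"
  using category unfolding category_def hom_def by auto

lemma br_cone:
  assumes "x \<in> hom C U A"
  shows "br x \<in> Ob C" "pr x \<in> hom C (br x) U" "q x \<in> hom C (br x) F" "x \<cdot> pr x = p \<cdot> q x"
  using bracket[OF assms] assms p_hom unfolding weak_pullback_def cone_over_def hom_def by auto

lemma const_hom: "X \<in> Ob C \<Longrightarrow> const_mor C one (p \<cdot> oneF) X \<in> hom C X A"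
proof -
  assume "X \<in> Ob C"
  then have "\<exists>!t. t \<in> hom C X one" using one(1) unfolding terminal_def by blast
  then have "(THE t. t \<in> hom C X one) \<in> hom C X one" by (rule theI')
  then show ?thesis
    unfolding const_mor_def using comp_hom comp_hom[OF one(2) p_hom(3)] by blast
qed

context
  assumes pullback: "\<forall>U. \<forall>x\<in>hom C U A. pullback C x p (br x) (pr x) (q x)"
begin

lemma br_joint_mono:
  assumes x: "x \<in> hom C U A" and v: "v \<in> hom C T (br x)" and w: "w \<in> hom C T (br x)"
    and "pr x \<cdot> v = pr x \<cdot> w" "q x \<cdot> v = q x \<cdot> w"
  shows "v = w"
proof -
  note b = br_cone[OF x]
  have "x \<cdot> (pr x \<cdot> v) = p \<cdot> (q x \<cdot> v)"
    using comp_assoc[OF v b(2) x] comp_assoc[OF v b(3) p_hom(3)] b(4) by simp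
  moreover have "Dom C x = U" "Dom C p = F" using x p_hom(3) unfolding hom_def by auto
  ultimately have "cone_over C x p T (pr x \<cdot> v) (q x \<cdot> v)"
    unfolding cone_over_def using hom_Ob[OF v] comp_hom[OF v b(2)] comp_hom[OF v b(3)] by simp
  then have "\<exists>!u. u \<in> hom C T (br x) \<and> pr x \<cdot> u = pr x \<cdot> v \<and> q x \<cdot> u = q x \<cdot> v"
    using pullback x unfolding pullback_def by blast
  then show ?thesis using assms by metis
qed

lemma bc_unique:
  assumes h: "h \<in> hom C U U'" and y: "y \<in> hom C U' A"
  shows "\<exists>w. bc h y = {w} \<and> (\<forall>v\<in>hom C (br (y \<cdot> h)) (br y).
           pr y \<cdot> v = h \<cdot> pr (y \<cdot> h) \<and> q y \<cdot> v = q (y \<cdot> h) \<longrightarrow> v = w)"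
proof -
  obtain w where w: "w \<in> bc h y" using base_change_ex[OF h y] by blast
  have u: "v = w" if "v \<in> hom C (br (y \<cdot> h)) (br y)"
    "pr y \<cdot> v = h \<cdot> pr (y \<cdot> h)" "q y \<cdot> v = q (y \<cdot> h)" for v
    using br_joint_mono[OF y that(1), of w] that base_change[OF h y w] by simp
  then have "bc h y = {w}" using w base_change[OF h y] by blast
  then show ?thesis using u by blast
qed

lemma bc_Idn:
  assumes x: "x \<in> hom C U A"
  shows "bc (Idn C U) x = {Idn C (br x)}"
proof -
  have i: "Idn C U \<in> hom C U U" using hom_Ob[OF x] Idn_hom by blast
  note b = br_cone[OF x]
  have "Idn C (br x) \<in> hom C (br (x \<cdot> Idn C U)) (br x)"
    "pr x \<cdot> Idn C (br x) = Idn C U \<cdot> pr (x \<cdot> Idn C U)"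
    "q x \<cdot> Idn C (br x) = q (x \<cdot> Idn C U)"
    using Idn_right[OF x] Idn_right[OF b(2)] Idn_left[OF b(2)] Idn_right[OF b(3)] Idn_hom[OF b(1)]
    by simp_all
  then show ?thesis using bc_unique[OF i x] by blast
qed

lemma left_unit_strict:
  assumes x: "x \<in> hom C U A" and f: "f \<in> hom C (br x) A"
  shows "dsum (const_mor C one (p \<cdot> oneF) (br x))
           (f \<cdot> flat x (const_mor C one (p \<cdot> oneF) (br x))) = f"
proof -
  let ?c = "const_mor C one (p \<cdot> oneF) (br x)"
  have "flat x ?c \<in> hom C (br ?c) (br x)"
    using flat_hom[OF x const_hom[OF br_cone(1)[OF x]]] right_unit[OF x] by simp
  then have "Idn C (br x) \<cdot> flat x ?c = flat x ?c" by (rule Idn_left)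
  then show ?thesis using left_unit[OF x] f unfolding bc_Idn[OF x] by auto
qed

lemma flatten_assoc_strict:
  assumes x: "x \<in> hom C U A" and f: "f \<in> hom C (br x) A" and g: "g \<in> hom C (br (dsum x f)) A"
    and w: "w \<in> bc (flat x f) g"
  shows "flat (dsum x f) g \<cdot> w = flat x (dsum f (g \<cdot> flat x f)) \<cdot> flat f (g \<cdot> flat x f)"
proof -
  note s = dsum_hom[OF x f]
  have fl: "flat x f \<in> hom C (br f) (br (dsum x f))" using flat_hom[OF x f] by blast
  have "flat (dsum x f) g \<in> hom C (br g) (br (dsum (dsum x f) g))"
    using flat_hom[OF s g] by blast
  then have "flat (dsum x f) g \<cdot> w \<in> hom C (br (g \<cdot> flat x f)) (br (dsum (dsum x f) g))"
    using base_change[OF fl g w] comp_hom by blast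
  then have "Idn C (br (dsum (dsum x f) g)) \<cdot> (flat (dsum x f) g \<cdot> w) = flat (dsum x f) g \<cdot> w"
    by (rule Idn_left)
  then show ?thesis
    using flatten_assoc[OF x f g w] unfolding bc_Idn[OF dsum_hom[OF s g]] by simp
qed

end

end

text \<open>\<open>sw x y\<close> is the set of morphisms \<open>\<lbrakk>y \<circ> p\<^sub>x\<rbrakk> \<rightarrow> \<lbrakk>x \<circ> p\<^sub>y\<rbrakk>\<close> that may serve as the
  canonical isomorphism; it is a singleton if the squares are pullbacks
  (\<open>sw_unique\<close>).\<close>

locale commutative_dependent_adder =
  dependent_adder C A F p one oneF br pr q bc dsum flat
  for C :: "('o, 'm) cat" (structure) and A F p one oneF br pr q bc dsum flat +
  fixes sw :: "'m \<Rightarrow> 'm \<Rightarrow> 'm set"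
  assumes switch_ex: "x \<in> hom C U A \<Longrightarrow> y \<in> hom C U A \<Longrightarrow> sw x y \<noteq> {}"
    and switch: "x \<in> hom C U A \<Longrightarrow> y \<in> hom C U A \<Longrightarrow> s \<in> sw x y \<Longrightarrow>
          s \<in> hom C (br (y \<cdot> pr x)) (br (x \<cdot> pr y)) \<and>
          (\<exists>w\<in>bc (pr x) y. pr (x \<cdot> pr y) \<cdot> s = w) \<and>
          (\<exists>w\<in>bc (pr y) x. w \<cdot> s = pr (y \<cdot> pr x))"
    and commutative: "x \<in> hom C U A \<Longrightarrow> y \<in> hom C U A \<Longrightarrow> s \<in> sw x y \<Longrightarrow>
          f \<in> hom C (br (x \<cdot> pr y)) A \<Longrightarrow>
          dsum y (dsum (x \<cdot> pr y) f) = dsum x (dsum (y \<cdot> pr x) (f \<cdot> s))"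

lemma (in commutative_dependent_adder) sw_unique:
  assumes pb: "\<forall>U. \<forall>x\<in>hom C U A. pullback C x p (br x) (pr x) (q x)"
    and x: "x \<in> hom C U A" and y: "y \<in> hom C U A"
  shows "\<exists>s. sw x y = {s}"
proof -
  note bx = br_cone[OF x] and by' = br_cone[OF y]
  have xy: "x \<cdot> pr y \<in> hom C (br y) A" using comp_hom[OF by'(2) x] .
  obtain w where w: "bc (pr x) y = {w}" using bc_unique[OF pb bx(2) y] by blast
  obtain w' where w': "bc (pr y) x = {w'}" using bc_unique[OF pb by'(2) x] by blast
  have W: "w' \<in> hom C (br (x \<cdot> pr y)) (br x)" "q x \<cdot> w' = q (x \<cdot> pr y)"
    using base_change[OF by'(2) x] w' by auto
  have "s = t" if st: "s \<in> sw x y" "t \<in> sw x y" for s t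
  proof (rule br_joint_mono[OF pb xy])
    note S = switch[OF x y st(1)] and T = switch[OF x y st(2)]
    show "s \<in> hom C (br (y \<cdot> pr x)) (br (x \<cdot> pr y))" "t \<in> hom C (br (y \<cdot> pr x)) (br (x \<cdot> pr y))"
      using S T by auto
    show "pr (x \<cdot> pr y) \<cdot> s = pr (x \<cdot> pr y) \<cdot> t" using S T w by auto
    have "q (x \<cdot> pr y) \<cdot> s = q x \<cdot> (w' \<cdot> s)" "q (x \<cdot> pr y) \<cdot> t = q x \<cdot> (w' \<cdot> t)"
      using comp_assoc[OF _ W(1) bx(3)] S T W(2) by auto
    then show "q (x \<cdot> pr y) \<cdot> s = q (x \<cdot> pr y) \<cdot> t" using S T w' by auto
  qed
  then show ?thesis using switch_ex[OF x y] by blast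
qed

section \<open>The structure on Cat\<close>

text \<open>In this section \<open>x : U \<rightarrow> Cat\<close>, \<open>f : \<lbrakk>x\<rbrakk> \<rightarrow> Cat\<close> etc. are functors, and functors are
  composed strictly, until \<open>Ho\<close> is applied.\<close>

abbreviation (input) fib :: "('s, 'u) mfct \<Rightarrow> ('s, 'u) moderate \<Rightarrow> 's scat" where
  "fib x u \<equiv> the_cat (FO x u)"

abbreviation (input) tra :: "('s, 'u) mfct \<Rightarrow> ('s, 'u) moderate \<Rightarrow> 's sfct" where
  "tra x \<alpha> \<equiv> the_fct (FM x \<alpha>)"

abbreviation tob :: "('s, 'u) moderate \<Rightarrow> 's small \<Rightarrow> ('s, 'u) moderate" where
  "tob u i \<equiv> MPair u (MElt i)"

abbreviation tar :: "'s small \<Rightarrow> ('s, 'u) moderate \<Rightarrow> 's small \<Rightarrow> ('s, 'u) moderate" where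
  "tar i \<alpha> \<beta> \<equiv> MPair (MElt i) (MPair \<alpha> (MElt \<beta>))"

definition tot :: "('s, 'u) mfct \<Rightarrow> ('s, 'u) mcat" where
  "tot x = recode (\<lambda>(u, i). tob u i) (\<lambda>(i, \<alpha>, \<beta>). tar i \<alpha> \<beta>)
     (oplax_colim (Src x) (fib x) (tra x))"

definition proj :: "('s, 'u) mfct \<Rightarrow> ('s, 'u) mfct" where
  "proj x = mk_fct (tot x) (Src x) (\<lambda>z. case z of tob u i \<Rightarrow> u) (\<lambda>m. case m of tar i \<alpha> \<beta> \<Rightarrow> \<alpha>)"

definition Fcat :: "('s, 'u) mcat" where
  "Fcat = tot (id_fct Cat)"

definition p_fct :: "('s, 'u) mfct" where
  "p_fct = proj (id_fct Cat)"

definition proj_F :: "('s, 'u) mfct \<Rightarrow> ('s, 'u) mfct" where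
  "proj_F x = mk_fct (tot x) Fcat (\<lambda>z. case z of tob u i \<Rightarrow> tob (FO x u) i)
     (\<lambda>m. case m of tar i \<alpha> \<beta> \<Rightarrow> tar i (FM x \<alpha>) \<beta>)"

text \<open>Any one-element carriers will do for the terminal categories.\<close>

definition one_mcat :: "('s, 'u) mcat" where
  "one_mcat = one_cat (MAtom undefined)"

definition one_scat :: "'s scat" where
  "one_scat = one_cat (SAtom undefined)"

definition oneF_fct :: "('s, 'u) mfct" where
  "oneF_fct = (let a = tob (MCat one_scat) (SAtom undefined) in
     mk_fct one_mcat Fcat (\<lambda>_. a) (\<lambda>_. Idn Fcat a))"

text \<open>For \<open>\<phi> : x \<cong> y \<circ> h\<close>, the functor \<open>\<lbrakk>x\<rbrakk> \<rightarrow> \<lbrakk>y\<rbrakk>\<close>, \<open>(u, i) \<mapsto> (h u, \<phi>\<^sub>u i)\<close>.\<close>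

definition reindex ::
  "('s, 'u) mfct \<Rightarrow> ('s, 'u) mfct \<Rightarrow> ('s, 'u) mfct \<Rightarrow> (('s, 'u) moderate \<Rightarrow> ('s, 'u) moderate)
     \<Rightarrow> ('s, 'u) mfct" where
  "reindex h x y \<phi> = mk_fct (tot x) (tot y)
     (\<lambda>z. case z of tob u i \<Rightarrow> tob (FO h u) (FO (the_fct (\<phi> u)) i))
     (\<lambda>m. case m of tar i \<alpha> \<beta> \<Rightarrow>
        tar (FO (the_fct (\<phi> (Dom (Src x) \<alpha>))) i) (FM h \<alpha>)
            (FM (the_fct (\<phi> (Cod (Src x) \<alpha>))) \<beta>))"

abbreviation relabel ::
  "('s, 'u) mfct \<Rightarrow> ('s, 'u) mfct \<Rightarrow> (('s, 'u) moderate \<Rightarrow> ('s, 'u) moderate) \<Rightarrow> ('s, 'u) mfct" where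
  "relabel x y \<phi> \<equiv> reindex (id_fct (Src x)) x y \<phi>"

text \<open>The fibrewise sum \<open>colim\<^sub>i f(u, i)\<close>, where \<open>i\<close> runs through \<open>x(u)\<close>; a morphism
  \<open>\<iota>\<close> of \<open>x(u)\<close> acts through \<open>(id\<^sub>u, \<iota>)\<close>.\<close>

definition fsum :: "('s, 'u) mfct \<Rightarrow> ('s, 'u) mfct \<Rightarrow> ('s, 'u) moderate \<Rightarrow> 's scat" where
  "fsum x f u = recode (\<lambda>(i, k). SPair i k) (\<lambda>(k, \<iota>, \<beta>). SPair k (SPair \<iota> \<beta>))
     (oplax_colim (fib x u) (\<lambda>i. fib f (tob u i))
        (\<lambda>\<iota>. tra f (tar (Dom (fib x u) \<iota>) (Idn (Src x) u) \<iota>)))"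

text \<open>The arrow \<open>(\<alpha>, id) : (u, i) \<rightarrow> (v, x(\<alpha>)(i))\<close> of \<open>\<lbrakk>x\<rbrakk>\<close>.\<close>

definition lift :: "('s, 'u) mfct \<Rightarrow> ('s, 'u) moderate \<Rightarrow> 's small \<Rightarrow> ('s, 'u) moderate" where
  "lift x \<alpha> i = tar i \<alpha> (Idn (fib x (Cod (Src x) \<alpha>)) (FO (tra x \<alpha>) i))"

definition sum_fct :: "('s, 'u) mfct \<Rightarrow> ('s, 'u) mfct \<Rightarrow> ('s, 'u) mfct" where
  "sum_fct x f = mk_fct (Src x) Cat (\<lambda>u. MCat (fsum x f u))
     (\<lambda>\<alpha>. let u = Dom (Src x) \<alpha>; v = Cod (Src x) \<alpha> in
        MFct (mk_fct (fsum x f u) (fsum x f v)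
          (\<lambda>z. case z of SPair i k \<Rightarrow> SPair (FO (tra x \<alpha>) i) (FO (tra f (lift x \<alpha> i)) k))
          (\<lambda>m. case m of SPair k (SPair \<iota> \<beta>) \<Rightarrow>
             SPair (FO (tra f (lift x \<alpha> (Dom (fib x u) \<iota>))) k)
               (SPair (FM (tra x \<alpha>) \<iota>) (FM (tra f (lift x \<alpha> (Cod (fib x u) \<iota>))) \<beta>)))))"

text \<open>The canonical isomorphism \<open>((u, i), k) \<mapsto> (u, (i, k))\<close>. The component over the target
  \<open>v\<close> of an arrow \<open>(k, (i, \<alpha>, \<beta>), \<delta>)\<close> starts at the image \<open>f(\<alpha>, id)(k)\<close> of \<open>k\<close>.\<close>

definition flat_fct :: "('s, 'u) mfct \<Rightarrow> ('s, 'u) mfct \<Rightarrow> ('s, 'u) mfct" where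
  "flat_fct x f = mk_fct (tot f) (tot (sum_fct x f))
     (\<lambda>z. case z of tob (tob u i) k \<Rightarrow> tob u (SPair i k))
     (\<lambda>m. case m of tar k (tar i \<alpha> \<beta>) \<delta> \<Rightarrow>
        tar (SPair i k) \<alpha> (SPair (FO (tra f (lift x \<alpha> i)) k) (SPair \<beta> \<delta>)))"

text \<open>The isomorphism \<open>\<lbrakk>y \<circ> p\<^sub>x\<rbrakk> \<rightarrow> \<lbrakk>x \<circ> p\<^sub>y\<rbrakk>\<close>, \<open>((u, i), j) \<mapsto> ((u, j), i)\<close>, for strict
  composites.\<close>

definition switch_fct :: "('s, 'u) mfct \<Rightarrow> ('s, 'u) mfct \<Rightarrow> ('s, 'u) mfct" where
  "switch_fct x y = mk_fct (tot (y \<circ>\<^sub>F proj x)) (tot (x \<circ>\<^sub>F proj y))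
     (\<lambda>z. case z of tob (tob u i) j \<Rightarrow> tob (tob u j) i)
     (\<lambda>m. case m of tar j (tar i \<alpha> \<beta>) \<delta> \<Rightarrow> tar i (tar j \<alpha> \<delta>) \<beta>)"

definition h_base_change ::
  "('s, 'u) mfct set \<Rightarrow> ('s, 'u) mfct \<Rightarrow> ('s, 'u) mfct \<Rightarrow> ('s, 'u) mfct set" where
  "h_base_change Sk h y =
     (let x = Ho Sk (y \<circ>\<^sub>F h) in {Ho Sk (reindex h x y \<phi>) | \<phi>. nat_iso x (y \<circ>\<^sub>F h) \<phi>})"

definition h_sum :: "('s, 'u) mfct set \<Rightarrow> ('s, 'u) mfct \<Rightarrow> ('s, 'u) mfct \<Rightarrow> ('s, 'u) mfct" where
  "h_sum Sk x f = Ho Sk (sum_fct x f)"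

text \<open>\<open>\<nu> G\<close> is a chosen natural isomorphism \<open>G \<cong> Ho G\<close>; it identifies the oplax colimit of
  \<open>sum_fct x f\<close> with that of its representative \<open>h_sum Sk x f\<close>.\<close>

definition h_flat ::
  "('s, 'u) mfct set \<Rightarrow> (('s, 'u) mfct \<Rightarrow> ('s, 'u) moderate \<Rightarrow> ('s, 'u) moderate)
     \<Rightarrow> ('s, 'u) mfct \<Rightarrow> ('s, 'u) mfct \<Rightarrow> ('s, 'u) mfct" where
  "h_flat Sk \<nu> x f =
     Ho Sk (relabel (sum_fct x f) (h_sum Sk x f) (\<nu> (sum_fct x f)) \<circ>\<^sub>F flat_fct x f)"

definition h_switch ::
  "('s, 'u) mfct set \<Rightarrow> ('s, 'u) mfct \<Rightarrow> ('s, 'u) mfct \<Rightarrow> ('s, 'u) mfct set" where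
  "h_switch Sk x y =
     (let c = Ho Sk (y \<circ>\<^sub>F Ho Sk (proj x)); c' = y \<circ>\<^sub>F proj x;
          d = Ho Sk (x \<circ>\<^sub>F Ho Sk (proj y)); d' = x \<circ>\<^sub>F proj y in
      {Ho Sk (relabel d' d \<psi> \<circ>\<^sub>F switch_fct x y \<circ>\<^sub>F relabel c c' \<phi>) | \<phi> \<psi>.
         nat_iso c c' \<phi> \<and> nat_iso d' d \<psi>})"

end

theory Submission
  imports Defs
begin

text \<open>A diagram \<open>x : U \<rightarrow> Cat\<close> amounts to a split opfibration over \<open>U\<close>: its total category \<open>tot x\<close> with
  the projection \<open>proj x\<close> and the chosen lifts \<open>(\<alpha>, id)\<close>. Isomorphic diagrams correspond to
  isomorphisms over \<open>U\<close> that preserve the chosen lifts, and more generally the isomorphisms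
  \<open>x \<cong> y \<circ> h\<close> correspond to the pullback squares over \<open>h\<close> that preserve them
  (\<open>split_pullback_reindex\<close>, \<open>split_pullback_proj_reindex\<close>). Split opfibrations can be composed, and the
  sum \<open>\<Sum>\<^sup>x f\<close> is the diagram of the composite \<open>tot f \<rightarrow> tot x \<rightarrow> U\<close>; the flattening map is the
  isomorphism that witnesses this (\<open>split_pullback_flat\<close>).

  The laws of a dependent adder therefore are laws of composition. Both sides of sum associativity
  are diagrams of the same threefold composite (\<open>bracketing_represents\<close>, \<open>h_sum_represents2\<close>).
  The unit laws hold because an opfibration with terminal fibres is an isomorphism
  (\<open>split_pullback_proj_trivial\<close>). Naturality is the pasting of two pullback squares on top of each
  other (\<open>split_pullback_vert\<close>). Commutativity holds because the two composites
  \<open>tot (y \<circ> proj x) \<rightarrow> tot x \<rightarrow> U\<close> and \<open>tot (x \<circ> proj y) \<rightarrow> tot y \<rightarrow> U\<close> are both the pullback of the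
  opfibrations of \<open>x\<close> and \<open>y\<close> (\<open>split_pullback_switch\<close>). In each case
  two diagrams represent the same split opfibration, so they are isomorphic, by an isomorphism that
  is compatible with the two representations (\<open>represents_unique\<close>). This gives the equality of sums
  in hCAT and also the comparison \<open>\<theta>\<close> along which the left unit law and flatten associativity hold
  (\<open>represents_comparison\<close>).

  In hCAT every functor is replaced by an isomorphic representative. Such a replacement of the base
  functor \<open>h\<close> changes a reindexing functor only up to isomorphism, provided that the isomorphism
  \<open>x \<cong> y \<circ> h\<close> is changed accordingly (\<open>reindex_change\<close>). Since the axioms quantify over these
  isomorphisms, the strict equations between functors carry over.\<close>

section \<open>Categories, functors and natural isomorphisms\<close>

lemma Dom_in [simp]: "category C \<Longrightarrow> f \<in> Ar C \<Longrightarrow> Dom C f \<in> Ob C"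
  and Cod_in [simp]: "category C \<Longrightarrow> f \<in> Ar C \<Longrightarrow> Cod C f \<in> Ob C"
  and Idn_in [simp]: "category C \<Longrightarrow> a \<in> Ob C \<Longrightarrow> Idn C a \<in> Ar C"
  and Dom_Idn [simp]: "category C \<Longrightarrow> a \<in> Ob C \<Longrightarrow> Dom C (Idn C a) = a"
  and Cod_Idn [simp]: "category C \<Longrightarrow> a \<in> Ob C \<Longrightarrow> Cod C (Idn C a) = a"
  and Cmp_in [simp]: "category C \<Longrightarrow> f \<in> Ar C \<Longrightarrow> g \<in> Ar C \<Longrightarrow> Dom C g = Cod C f \<Longrightarrow> Cmp C g f \<in> Ar C"
  and Dom_Cmp [simp]: "category C \<Longrightarrow> f \<in> Ar C \<Longrightarrow> g \<in> Ar C \<Longrightarrow> Dom C g = Cod C f \<Longrightarrow> Dom C (Cmp C g f) = Dom C f"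
  and Cod_Cmp [simp]: "category C \<Longrightarrow> f \<in> Ar C \<Longrightarrow> g \<in> Ar C \<Longrightarrow> Dom C g = Cod C f \<Longrightarrow> Cod C (Cmp C g f) = Cod C g"
  and Cmp_Idn_right [simp]: "category C \<Longrightarrow> f \<in> Ar C \<Longrightarrow> a = Dom C f \<Longrightarrow> Cmp C f (Idn C a) = f"
  and Cmp_Idn_left [simp]: "category C \<Longrightarrow> f \<in> Ar C \<Longrightarrow> a = Cod C f \<Longrightarrow> Cmp C (Idn C a) f = f"
  and Cmp_assoc: "category C \<Longrightarrow> f \<in> Ar C \<Longrightarrow> g \<in> Ar C \<Longrightarrow> h \<in> Ar C \<Longrightarrow> Dom C g = Cod C f \<Longrightarrow>
        Dom C h = Cod C g \<Longrightarrow> Cmp C h (Cmp C g f) = Cmp C (Cmp C h g) f"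
  unfolding category_def by auto

lemma mk_cat_sel [simp]:
  "Ob (mk_cat obs ars d c i m) = obs"
  "Ar (mk_cat obs ars d c i m) = ars"
  "f \<in> ars \<Longrightarrow> Dom (mk_cat obs ars d c i m) f = d f"
  "f \<in> ars \<Longrightarrow> Cod (mk_cat obs ars d c i m) f = c f"
  "a \<in> obs \<Longrightarrow> Idn (mk_cat obs ars d c i m) a = i a"
  "f \<in> ars \<Longrightarrow> g \<in> ars \<Longrightarrow> d g = c f \<Longrightarrow> Cmp (mk_cat obs ars d c i m) g f = m g f"
  by (auto simp: mk_cat_def)

lemma category_mk_cat:
  assumes "\<And>f. f \<in> ars \<Longrightarrow> d f \<in> obs" "\<And>f. f \<in> ars \<Longrightarrow> c f \<in> obs"
    and "\<And>a. a \<in> obs \<Longrightarrow> i a \<in> ars \<and> d (i a) = a \<and> c (i a) = a"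
    and "\<And>f g. f \<in> ars \<Longrightarrow> g \<in> ars \<Longrightarrow> d g = c f \<Longrightarrow> m g f \<in> ars \<and> d (m g f) = d f \<and> c (m g f) = c g"
    and "\<And>f. f \<in> ars \<Longrightarrow> m f (i (d f)) = f \<and> m (i (c f)) f = f"
    and "\<And>f g h. f \<in> ars \<Longrightarrow> g \<in> ars \<Longrightarrow> h \<in> ars \<Longrightarrow> d g = c f \<Longrightarrow> d h = c g \<Longrightarrow>
           m h (m g f) = m (m h g) f"
  shows "category (mk_cat obs ars d c i m)"
  unfolding category_def using assms by (auto simp: mk_cat_def)

lemma is_functor_cat [simp]: "is_functor G \<Longrightarrow> category (Src G)" "is_functor G \<Longrightarrow> category (Tgt G)"
  by (simp_all add: is_functor_def)

text \<open>The target is a separate variable, so that these rules still match once \<open>Tgt G\<close> has been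
  rewritten to a concrete category.\<close>

lemma FO_in [simp]: "is_functor G \<Longrightarrow> a \<in> Ob (Src G) \<Longrightarrow> D = Tgt G \<Longrightarrow> FO G a \<in> Ob D"
  and FM_in [simp]: "is_functor G \<Longrightarrow> f \<in> Ar (Src G) \<Longrightarrow> D = Tgt G \<Longrightarrow> FM G f \<in> Ar D"
  and Dom_FM [simp]: "is_functor G \<Longrightarrow> f \<in> Ar (Src G) \<Longrightarrow> D = Tgt G \<Longrightarrow> Dom D (FM G f) = FO G (Dom (Src G) f)"
  and Cod_FM [simp]: "is_functor G \<Longrightarrow> f \<in> Ar (Src G) \<Longrightarrow> D = Tgt G \<Longrightarrow> Cod D (FM G f) = FO G (Cod (Src G) f)"
  and FM_Idn: "is_functor G \<Longrightarrow> a \<in> Ob (Src G) \<Longrightarrow> C = Src G \<Longrightarrow> FM G (Idn C a) = Idn (Tgt G) (FO G a)"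
  and FM_Cmp: "is_functor G \<Longrightarrow> f \<in> Ar (Src G) \<Longrightarrow> g \<in> Ar (Src G) \<Longrightarrow> C = Src G \<Longrightarrow> Dom C g = Cod C f \<Longrightarrow>
      FM G (Cmp C g f) = Cmp (Tgt G) (FM G g) (FM G f)"
  unfolding is_functor_def hom_def mem_Collect_eq by blast+

lemma extensional_FO: "is_functor G \<Longrightarrow> FO G \<in> extensional (Ob (Src G))"
  and extensional_FM: "is_functor G \<Longrightarrow> FM G \<in> extensional (Ar (Src G))"
  by (simp_all only: is_functor_def)

lemma fct_eqI:
  assumes "is_functor G" "is_functor H" "Src G = Src H" "Tgt G = Tgt H"
    and "\<And>a. a \<in> Ob (Src H) \<Longrightarrow> FO G a = FO H a" "\<And>f. f \<in> Ar (Src H) \<Longrightarrow> FM G f = FM H f"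
  shows "G = H"
proof -
  have "FO G = FO H" by (rule extensionalityI[where A="Ob (Src H)"]) (metis assms extensional_FO)+
  moreover have "FM G = FM H" by (rule extensionalityI[where A="Ar (Src H)"]) (metis assms extensional_FM)+
  ultimately show ?thesis using assms by (cases G, cases H) auto
qed

lemma mk_fct_sel [simp]:
  "Src (mk_fct C D o' m') = C" "Tgt (mk_fct C D o' m') = D"
  "a \<in> Ob C \<Longrightarrow> FO (mk_fct C D o' m') a = o' a"
  "f \<in> Ar C \<Longrightarrow> FM (mk_fct C D o' m') f = m' f"
  by (simp_all add: mk_fct_def)

lemma is_functor_mk_fct:
  assumes "category C" "category D"
    and "\<And>a. a \<in> Ob C \<Longrightarrow> o' a \<in> Ob D" "\<And>a. a \<in> Ob C \<Longrightarrow> m' (Idn C a) = Idn D (o' a)"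
    and "\<And>f. f \<in> Ar C \<Longrightarrow> m' f \<in> Ar D \<and> Dom D (m' f) = o' (Dom C f) \<and> Cod D (m' f) = o' (Cod C f)"
    and "\<And>f g. f \<in> Ar C \<Longrightarrow> g \<in> Ar C \<Longrightarrow> Dom C g = Cod C f \<Longrightarrow> m' (Cmp C g f) = Cmp D (m' g) (m' f)"
  shows "is_functor (mk_fct C D o' m')"
  unfolding is_functor_def using assms by (auto simp: mk_fct_def hom_def)

lemma id_fct_sel [simp]:
  "Src (id_fct C) = C" "Tgt (id_fct C) = C"
  "a \<in> Ob C \<Longrightarrow> FO (id_fct C) a = a" "f \<in> Ar C \<Longrightarrow> FM (id_fct C) f = f"
  by (simp_all add: id_fct_def)

lemma is_functor_id [simp]: "category C \<Longrightarrow> is_functor (id_fct C)"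
  unfolding id_fct_def by (rule is_functor_mk_fct) auto

lemma cmp_fct_sel [simp]:
  "Src (G \<circ>\<^sub>F H) = Src H" "Tgt (G \<circ>\<^sub>F H) = Tgt G"
  "a \<in> Ob (Src H) \<Longrightarrow> FO (G \<circ>\<^sub>F H) a = FO G (FO H a)"
  "f \<in> Ar (Src H) \<Longrightarrow> FM (G \<circ>\<^sub>F H) f = FM G (FM H f)"
  by (simp_all add: cmp_fct_def)

lemma is_functor_cmp [simp]:
  "is_functor G \<Longrightarrow> is_functor H \<Longrightarrow> Src G = Tgt H \<Longrightarrow> is_functor (G \<circ>\<^sub>F H)"
  unfolding cmp_fct_def by (rule is_functor_mk_fct) (simp_all add: FM_Idn FM_Cmp)

lemma cmp_fct_assoc:
  "is_functor G \<Longrightarrow> is_functor H \<Longrightarrow> is_functor K \<Longrightarrow> Src G = Tgt H \<Longrightarrow> Src H = Tgt K \<Longrightarrow>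
    G \<circ>\<^sub>F (H \<circ>\<^sub>F K) = G \<circ>\<^sub>F H \<circ>\<^sub>F K"
  by (rule fct_eqI) simp_all

lemma cmp_id_left [simp]: "is_functor G \<Longrightarrow> D = Tgt G \<Longrightarrow> id_fct D \<circ>\<^sub>F G = G"
  by (rule fct_eqI) simp_all

lemma cmp_id_right [simp]: "is_functor G \<Longrightarrow> C = Src G \<Longrightarrow> G \<circ>\<^sub>F id_fct C = G"
  by (rule fct_eqI) simp_all

definition inverse_arrow :: "('o, 'm) cat \<Rightarrow> 'm \<Rightarrow> 'm" where
  "inverse_arrow C f = (SOME g. g \<in> hom C (Cod C f) (Dom C f) \<and>
     Cmp C g f = Idn C (Dom C f) \<and> Cmp C f g = Idn C (Cod C f))"

lemma inverse_arrow:
  assumes "iso_arrow C f"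
  shows "inverse_arrow C f \<in> Ar C" "Dom C (inverse_arrow C f) = Cod C f"
    "Cod C (inverse_arrow C f) = Dom C f" "Cmp C (inverse_arrow C f) f = Idn C (Dom C f)"
    "Cmp C f (inverse_arrow C f) = Idn C (Cod C f)"
proof -
  have "\<exists>g. g \<in> hom C (Cod C f) (Dom C f) \<and>
     Cmp C g f = Idn C (Dom C f) \<and> Cmp C f g = Idn C (Cod C f)"
    using assms by (auto simp: iso_arrow_def)
  from someI_ex[OF this] show "inverse_arrow C f \<in> Ar C" "Dom C (inverse_arrow C f) = Cod C f"
    "Cod C (inverse_arrow C f) = Dom C f" "Cmp C (inverse_arrow C f) f = Idn C (Dom C f)"
    "Cmp C f (inverse_arrow C f) = Idn C (Cod C f)"
    by (auto simp: inverse_arrow_def hom_def)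
qed

lemma iso_arrowI:
  assumes "f \<in> Ar C" "g \<in> Ar C" "Dom C g = Cod C f" "Cod C g = Dom C f"
    "Cmp C g f = Idn C (Dom C f)" "Cmp C f g = Idn C (Cod C f)"
  shows "iso_arrow C f"
  using assms by (auto simp: iso_arrow_def hom_def)

lemma iso_arrow_Ar: "iso_arrow C f \<Longrightarrow> f \<in> Ar C"
  by (simp add: iso_arrow_def)

lemma iso_arrow_Idn: "category C \<Longrightarrow> a \<in> Ob C \<Longrightarrow> iso_arrow C (Idn C a)"
  by (rule iso_arrowI[of _ _ "Idn C a"]) simp_all

lemma iso_arrow_inverse: "category C \<Longrightarrow> iso_arrow C f \<Longrightarrow> iso_arrow C (inverse_arrow C f)"
  by (rule iso_arrowI[of _ _ f]) (simp_all add: inverse_arrow iso_arrow_Ar)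

lemma iso_arrow_Cmp:
  assumes C: "category C" and f: "iso_arrow C f" and g: "iso_arrow C g" and fg: "Dom C g = Cod C f"
  shows "iso_arrow C (Cmp C g f)"
proof (rule iso_arrowI[of _ _ "Cmp C (inverse_arrow C f) (inverse_arrow C g)"])
  let ?f = "inverse_arrow C f" and ?g = "inverse_arrow C g"
  note [simp] = C fg inverse_arrow[OF f] inverse_arrow[OF g] iso_arrow_Ar[OF f] iso_arrow_Ar[OF g]
  show "Cmp C g f \<in> Ar C" "Cmp C ?f ?g \<in> Ar C" "Dom C (Cmp C ?f ?g) = Cod C (Cmp C g f)"
    "Cod C (Cmp C ?f ?g) = Dom C (Cmp C g f)" by simp_all
  have "Cmp C (Cmp C ?f ?g) (Cmp C g f) = Cmp C ?f (Cmp C (Cmp C ?g g) f)"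
    by (simp add: Cmp_assoc del: inverse_arrow(4,5)[OF f] inverse_arrow(4,5)[OF g])
  then show "Cmp C (Cmp C ?f ?g) (Cmp C g f) = Idn C (Dom C (Cmp C g f))" by simp
  have "Cmp C (Cmp C g f) (Cmp C ?f ?g) = Cmp C g (Cmp C (Cmp C f ?f) ?g)"
    by (simp add: Cmp_assoc del: inverse_arrow(4,5)[OF f] inverse_arrow(4,5)[OF g])
  then show "Cmp C (Cmp C g f) (Cmp C ?f ?g) = Idn C (Cod C (Cmp C g f))" by simp
qed

lemma iso_arrow_FM:
  assumes G: "is_functor G" and C: "C = Src G" "D = Tgt G" and f: "iso_arrow C f"
  shows "iso_arrow D (FM G f)"
proof (rule iso_arrowI[of _ _ "FM G (inverse_arrow C f)"])
  note i = inverse_arrow[OF f] and [simp] = G C iso_arrow_Ar[OF f, unfolded C]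
  note [simp] = i[unfolded C]
  show "FM G f \<in> Ar D" "FM G (inverse_arrow C f) \<in> Ar D"
    "Dom D (FM G (inverse_arrow C f)) = Cod D (FM G f)"
    "Cod D (FM G (inverse_arrow C f)) = Dom D (FM G f)" by simp_all
  show "Cmp D (FM G (inverse_arrow C f)) (FM G f) = Idn D (Dom D (FM G f))"
    "Cmp D (FM G f) (FM G (inverse_arrow C f)) = Idn D (Cod D (FM G f))"
    by (simp_all add: FM_Cmp[symmetric] FM_Idn)
qed

lemma nat_isoD:
  assumes "nat_iso G H \<eta>"
  shows "is_functor G" "is_functor H" "Src G = Src H" "Tgt G = Tgt H"
    and "\<And>a. a \<in> Ob (Src H) \<Longrightarrow> \<eta> a \<in> Ar (Tgt H)"
    and "\<And>a. a \<in> Ob (Src H) \<Longrightarrow> iso_arrow (Tgt H) (\<eta> a)"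
    and "\<And>a. a \<in> Ob (Src H) \<Longrightarrow> Dom (Tgt H) (\<eta> a) = FO G a"
    and "\<And>a. a \<in> Ob (Src H) \<Longrightarrow> Cod (Tgt H) (\<eta> a) = FO H a"
    and "\<And>f. f \<in> Ar (Src H) \<Longrightarrow> Cmp (Tgt H) (\<eta> (Cod (Src H) f)) (FM G f) =
                      Cmp (Tgt H) (FM H f) (\<eta> (Dom (Src H) f))"
  using assms by (auto simp: nat_iso_def hom_def)

lemma nat_isoI:
  assumes "is_functor G" "is_functor H" "Src G = Src H" "Tgt G = Tgt H"
    and "\<And>a. a \<in> Ob (Src H) \<Longrightarrow> iso_arrow (Tgt H) (\<eta> a)"
    and "\<And>a. a \<in> Ob (Src H) \<Longrightarrow> Dom (Tgt H) (\<eta> a) = FO G a"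
    and "\<And>a. a \<in> Ob (Src H) \<Longrightarrow> Cod (Tgt H) (\<eta> a) = FO H a"
    and "\<And>f. f \<in> Ar (Src H) \<Longrightarrow> Cmp (Tgt H) (\<eta> (Cod (Src H) f)) (FM G f) =
                      Cmp (Tgt H) (FM H f) (\<eta> (Dom (Src H) f))"
  shows "nat_iso G H \<eta>"
  using assms by (auto simp: nat_iso_def hom_def iso_arrow_def)

lemma nat_iso_refl: "is_functor G \<Longrightarrow> nat_iso G G (\<lambda>a. Idn (Tgt G) (FO G a))"
  by (rule nat_isoI) (simp_all add: iso_arrow_Idn)

lemma nat_iso_sym:
  assumes "nat_iso G H \<eta>"
  shows "nat_iso H G (\<lambda>a. inverse_arrow (Tgt G) (\<eta> a))"
proof (rule nat_isoI)
  note D = nat_isoD[OF assms]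
  note [simp] = D(1-5,7,8) inverse_arrow[OF D(6)]
  show "is_functor H" "is_functor G" "Src H = Src G" "Tgt H = Tgt G" by simp_all
  fix a assume "a \<in> Ob (Src G)"
  then have a: "a \<in> Ob (Src H)" by simp
  then show "iso_arrow (Tgt G) (inverse_arrow (Tgt G) (\<eta> a))"
    "Dom (Tgt G) (inverse_arrow (Tgt G) (\<eta> a)) = FO H a"
    "Cod (Tgt G) (inverse_arrow (Tgt G) (\<eta> a)) = FO G a" using D(6)[OF a]
    by (simp_all add: iso_arrow_inverse)
next
  note D = nat_isoD[OF assms]
  note [simp] = D(1-5,7,8) inverse_arrow[OF D(6)]
  fix f assume "f \<in> Ar (Src G)"
  then have f [simp]: "f \<in> Ar (Src H)" by simp
  let ?C = "Tgt H" and ?a = "Dom (Src H) f" and ?b = "Cod (Src H) f"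
  let ?i = "\<lambda>a. inverse_arrow ?C (\<eta> a)"
  have "Cmp ?C (?i ?b) (FM H f) = Cmp ?C (?i ?b) (Cmp ?C (FM H f) (Cmp ?C (\<eta> ?a) (?i ?a)))"
    by simp
  also have "\<dots> = Cmp ?C (?i ?b) (Cmp ?C (Cmp ?C (FM H f) (\<eta> ?a)) (?i ?a))"
    by (subst (2) Cmp_assoc) (simp_all del: inverse_arrow(4,5)[OF D(6)])
  also have "\<dots> = Cmp ?C (?i ?b) (Cmp ?C (Cmp ?C (\<eta> ?b) (FM G f)) (?i ?a))"
    by (simp add: D(9))
  also have "\<dots> = Cmp ?C (Cmp ?C (Cmp ?C (?i ?b) (\<eta> ?b)) (FM G f)) (?i ?a)"
    by (simp add: Cmp_assoc del: inverse_arrow(4,5)[OF D(6)])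
  also have "\<dots> = Cmp ?C (FM G f) (?i ?a)" by simp
  finally show "Cmp (Tgt G) (inverse_arrow (Tgt G) (\<eta> (Cod (Src G) f))) (FM H f) =
    Cmp (Tgt G) (FM G f) (inverse_arrow (Tgt G) (\<eta> (Dom (Src G) f)))" by simp
qed

lemma nat_iso_trans:
  assumes "nat_iso G H \<eta>" "nat_iso H K \<theta>"
  shows "nat_iso G K (\<lambda>a. Cmp (Tgt G) (\<theta> a) (\<eta> a))"
proof (rule nat_isoI)
  note D = nat_isoD[OF assms(1)] and E = nat_isoD[OF assms(2)]
  note [simp] = D(1-5,7,8) E(1-5,7,8)
  show "is_functor G" "is_functor K" "Src G = Src K" "Tgt G = Tgt K" by simp_all
  fix a assume [simp]: "a \<in> Ob (Src K)"
  show "iso_arrow (Tgt K) (Cmp (Tgt G) (\<theta> a) (\<eta> a))"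
    using iso_arrow_Cmp[of "Tgt K" "\<eta> a" "\<theta> a"] D(6)[of a] E(6)[of a] by (simp add: D(5,7,8)[simplified])
  show "Dom (Tgt K) (Cmp (Tgt G) (\<theta> a) (\<eta> a)) = FO G a"
    "Cod (Tgt K) (Cmp (Tgt G) (\<theta> a) (\<eta> a)) = FO K a"
    by (simp_all add: D(5,7,8)[simplified])
next
  note D = nat_isoD[OF assms(1)] and E = nat_isoD[OF assms(2)]
  note [simp] = D(1-4) E(1-5,7,8) and [simp] = D(5,7,8)[simplified]
  fix f assume f [simp]: "f \<in> Ar (Src K)"
  let ?C = "Tgt K" and ?a = "Dom (Src K) f" and ?b = "Cod (Src K) f"
  have 1: "Cmp ?C (\<eta> ?b) (FM G f) = Cmp ?C (FM H f) (\<eta> ?a)" using D(9)[of f] by simp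
  have 2: "Cmp ?C (\<theta> ?b) (FM H f) = Cmp ?C (FM K f) (\<theta> ?a)" using E(9)[of f] by simp
  have "Cmp ?C (Cmp ?C (\<theta> ?b) (\<eta> ?b)) (FM G f) = Cmp ?C (\<theta> ?b) (Cmp ?C (FM H f) (\<eta> ?a))"
    by (simp add: Cmp_assoc[symmetric] 1)
  also have "\<dots> = Cmp ?C (FM K f) (Cmp ?C (\<theta> ?a) (\<eta> ?a))"
    by (simp add: Cmp_assoc 2)
  finally show "Cmp (Tgt K) (Cmp (Tgt G) (\<theta> (Cod (Src K) f)) (\<eta> (Cod (Src K) f))) (FM G f) =
    Cmp (Tgt K) (FM K f) (Cmp (Tgt G) (\<theta> (Dom (Src K) f)) (\<eta> (Dom (Src K) f)))" by simp
qed

lemma nat_iso_whisker_left: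
  assumes "nat_iso G H \<eta>" and K: "is_functor K" "Src K = Tgt G"
  shows "nat_iso (K \<circ>\<^sub>F G) (K \<circ>\<^sub>F H) (\<lambda>a. FM K (\<eta> a))"
proof -
  note D = nat_isoD[OF assms(1)]
  note [simp] = D(1-5,7,8) K
  show ?thesis
  proof (rule nat_isoI)
    fix a assume "a \<in> Ob (Src (K \<circ>\<^sub>F H))"
    then show "iso_arrow (Tgt (K \<circ>\<^sub>F H)) (FM K (\<eta> a))" using D(6) by (intro iso_arrow_FM[of K]) auto
  next
    fix f assume "f \<in> Ar (Src (K \<circ>\<^sub>F H))"
    then show "Cmp (Tgt (K \<circ>\<^sub>F H)) (FM K (\<eta> (Cod (Src (K \<circ>\<^sub>F H)) f))) (FM (K \<circ>\<^sub>F G) f) =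
         Cmp (Tgt (K \<circ>\<^sub>F H)) (FM (K \<circ>\<^sub>F H) f) (FM K (\<eta> (Dom (Src (K \<circ>\<^sub>F H)) f)))"
      by (simp add: FM_Cmp[symmetric] D(9))
  qed simp_all
qed

lemma nat_iso_whisker_right:
  assumes "nat_iso G H \<eta>" and K: "is_functor K" "Tgt K = Src G"
  shows "nat_iso (G \<circ>\<^sub>F K) (H \<circ>\<^sub>F K) (\<lambda>a. \<eta> (FO K a))"
proof -
  note D = nat_isoD[OF assms(1)]
  note [simp] = D(1-5,7,8) K
  show ?thesis
  proof (rule nat_isoI)
    fix f assume "f \<in> Ar (Src (H \<circ>\<^sub>F K))"
    then show "Cmp (Tgt (H \<circ>\<^sub>F K)) (\<eta> (FO K (Cod (Src (H \<circ>\<^sub>F K)) f))) (FM (G \<circ>\<^sub>F K) f) =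
         Cmp (Tgt (H \<circ>\<^sub>F K)) (FM (H \<circ>\<^sub>F K) f) (\<eta> (FO K (Dom (Src (H \<circ>\<^sub>F K)) f)))"
      using D(9)[of "FM K f"] by simp
  qed (simp_all add: D(6))
qed

lemma iso_fct_refl: "is_functor G \<Longrightarrow> G \<cong>\<^sub>F G"
  unfolding iso_fct_def using nat_iso_refl by blast

lemma iso_fct_sym: "G \<cong>\<^sub>F H \<Longrightarrow> H \<cong>\<^sub>F G"
  unfolding iso_fct_def using nat_iso_sym by blast

lemma iso_fct_trans [trans]: "G \<cong>\<^sub>F H \<Longrightarrow> H \<cong>\<^sub>F K \<Longrightarrow> G \<cong>\<^sub>F K"
  unfolding iso_fct_def using nat_iso_trans by blast

lemma iso_fctD: "G \<cong>\<^sub>F H \<Longrightarrow> is_functor G \<and> is_functor H \<and> Src G = Src H \<and> Tgt G = Tgt H"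
  unfolding iso_fct_def using nat_isoD by blast

lemma iso_fct_cmp:
  assumes "G \<cong>\<^sub>F G'" "H \<cong>\<^sub>F H'" "Src G = Tgt H"
  shows "G \<circ>\<^sub>F H \<cong>\<^sub>F G' \<circ>\<^sub>F H'"
proof -
  have "G \<circ>\<^sub>F H \<cong>\<^sub>F G' \<circ>\<^sub>F H"
    using assms nat_iso_whisker_right iso_fctD unfolding iso_fct_def by metis
  also have "G' \<circ>\<^sub>F H \<cong>\<^sub>F G' \<circ>\<^sub>F H'"
    using assms nat_iso_whisker_left iso_fctD unfolding iso_fct_def by metis
  finally show ?thesis .
qed

section \<open>Cardinalities\<close>

lemma inacc_infinite: "strongly_inaccessible |UNIV :: 'k set| \<Longrightarrow> infinite (UNIV :: 'k set)"
  unfolding strongly_inaccessible_def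
  by (metis Field_card_of Field_natLeq card_of_ordLeq_finite card_of_mono2 infinite_UNIV_nat
      ordLess_imp_ordLeq)

text \<open>Regularity, in the form in which it bounds the sizes of oplax colimits.\<close>

lemma inacc_Sigma:
  assumes inacc: "strongly_inaccessible |UNIV :: 'k set|"
    and A: "|A| <o |UNIV :: 'k set|" and B: "\<And>a. a \<in> A \<Longrightarrow> |B a| <o |UNIV :: 'k set|"
  shows "|Sigma A B| <o |UNIV :: 'k set|"
proof -
  have "stable |UNIV :: 'k set|"
    using inacc inacc_infinite[OF inacc] unfolding strongly_inaccessible_def
    by (intro regularCard_stable) (simp_all add: Field_card_of)
  then show ?thesis using A B by (rule stable_elim) auto
qed

lemma card_image_less: "|A| <o r \<Longrightarrow> |f ` A| <o r"
  using card_of_image ordLeq_ordLess_trans by blast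

lemma card_subset_less: "|A| <o r \<Longrightarrow> B \<subseteq> A \<Longrightarrow> |B| <o r"
  using card_of_mono1 ordLeq_ordLess_trans by blast

text \<open>The trees of bounded depth are no more than the atoms, by induction on the depth, and there are
  countably many depths.\<close>

lemma card_small_le:
  assumes inf: "infinite (UNIV :: 's set)"
  shows "|UNIV :: 's small set| \<le>o |UNIV :: 's set|"
proof -
  define dep :: "'s small \<Rightarrow> nat" where "dep = rec_small (\<lambda>_. 0) (\<lambda>_ _ m n. Suc (max m n))"
  have dep: "dep (SAtom a) = 0" "dep (SPair s t) = Suc (max (dep s) (dep t))" for a s t
    by (simp_all add: dep_def)
  have atoms: "|SAtom ` (UNIV :: 's set)| \<le>o |UNIV :: 's set|" by (rule card_of_image)
  have le: "|{t :: 's small. dep t \<le> n}| \<le>o |UNIV :: 's set|" for n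
  proof (induction n)
    case 0
    have "{t :: 's small. dep t \<le> 0} \<subseteq> SAtom ` UNIV"
    proof
      fix t :: "'s small" assume "t \<in> {t. dep t \<le> 0}"
      then show "t \<in> SAtom ` UNIV" by (cases t) (auto simp: dep)
    qed
    then show ?case using atoms card_of_mono1 ordLeq_transitive by blast
  next
    case (Suc n)
    let ?D = "{t :: 's small. dep t \<le> n}"
    have "|?D \<times> ?D| \<le>o |UNIV :: 's set|"
      using inf Suc by (intro card_of_Times_ordLeq_infinite_Field) (simp_all add: Field_card_of card_of_card_order_on)
    then have "|(\<lambda>(s, t). SPair s t) ` (?D \<times> ?D)| \<le>o |UNIV :: 's set|"
      using card_of_image ordLeq_transitive by blast
    with atoms have "|SAtom ` UNIV \<union> (\<lambda>(s, t). SPair s t) ` (?D \<times> ?D)| \<le>o |UNIV :: 's set|"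
      using inf by (intro card_of_Un_ordLeq_infinite_Field) (simp_all add: Field_card_of card_of_card_order_on)
    moreover have "{t :: 's small. dep t \<le> Suc n} \<subseteq> SAtom ` UNIV \<union> (\<lambda>(s, t). SPair s t) ` (?D \<times> ?D)"
    proof
      fix t :: "'s small" assume "t \<in> {t. dep t \<le> Suc n}"
      then show "t \<in> SAtom ` UNIV \<union> (\<lambda>(s, t). SPair s t) ` (?D \<times> ?D)" by (cases t) (auto simp: dep)
    qed
    ultimately show ?case using card_of_mono1 ordLeq_transitive by blast
  qed
  have "|\<Union>n\<in>(UNIV :: nat set). {t :: 's small. dep t \<le> n}| \<le>o |UNIV :: 's set|"
    using inf le by (intro card_of_UNION_ordLeq_infinite) (simp_all add: infinite_iff_card_of_nat[symmetric])
  moreover have "(\<Union>n\<in>(UNIV :: nat set). {t :: 's small. dep t \<le> n}) = UNIV" by auto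
  ultimately show ?thesis by simp
qed

lemma card_inj_less: "|B| <o r \<Longrightarrow> inj_on f A \<Longrightarrow> f ` A \<subseteq> B \<Longrightarrow> |A| <o r"
  using card_of_ordLeqI ordLeq_ordLess_trans by (metis image_subset_iff)

context
  fixes k :: "'k rel"
  assumes k: "k = |UNIV :: 'k set|" and inacc: "strongly_inaccessible k"
begin

lemma inacc_prod:
  assumes "|UNIV :: 'a set| <o k" "|UNIV :: 'b set| <o k"
  shows "|UNIV :: ('a \<times> 'b) set| <o k"
  using inacc_Sigma[of "UNIV :: 'a set" "\<lambda>_. UNIV :: 'b set"] assms inacc unfolding k by simp

text \<open>The strong limit property; through it the small categories and functors are less than
  \<open>\<kappa>\<^sub>1\<close> in number.\<close>

lemma inacc_set:
  assumes "|UNIV :: 'a set| <o k"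
  shows "|UNIV :: 'a set set| <o k"
proof -
  have "|UNIV :: 'a set| \<le>o |UNIV :: 'k set|" using assms unfolding k by (rule ordLess_imp_ordLeq)
  then obtain f :: "'a \<Rightarrow> 'k" where f: "inj f" unfolding card_of_ordLeq[symmetric] by blast
  have "|range f| <o k" using assms by (rule card_image_less)
  then have "|Pow (range f)| <o k" using inacc unfolding strongly_inaccessible_def k by blast
  then show ?thesis
    by (rule card_inj_less[where f = "image f"]) (use f in \<open>auto simp: inj_image_eq_iff intro!: injI\<close>)
qed

lemma inacc_fun:
  assumes "|UNIV :: 'a set| <o k" "|UNIV :: 'b set| <o k"
  shows "|UNIV :: ('a \<Rightarrow> 'b) set| <o k"
  by (rule card_inj_less[OF inacc_set[OF inacc_prod[OF assms]], where f = "\<lambda>f. {(a, f a) |a. True}"])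
    (auto intro!: injI simp: set_eq_iff)

lemma inacc_cat:
  assumes "|UNIV :: 'a set| <o k"
  shows "|UNIV :: ('a, 'a) cat set| <o k"
proof (rule card_inj_less)
  show "|UNIV :: ('a set \<times> 'a set \<times> ('a \<Rightarrow> 'a) \<times> ('a \<Rightarrow> 'a) \<times> ('a \<Rightarrow> 'a) \<times> ('a \<Rightarrow> 'a \<Rightarrow> 'a)) set| <o k"
    by (intro inacc_prod inacc_set inacc_fun assms)
  show "inj (\<lambda>C :: ('a, 'a) cat. (Ob C, Ar C, Dom C, Cod C, Idn C, Cmp C))"
    by (rule injI) simp
qed simp

lemma inacc_fct:
  assumes "|UNIV :: 'a set| <o k"
  shows "|UNIV :: ('a, 'a, 'a, 'a) fct set| <o k"
proof (rule card_inj_less)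
  show "|UNIV :: (('a, 'a) cat \<times> ('a, 'a) cat \<times> ('a \<Rightarrow> 'a) \<times> ('a \<Rightarrow> 'a)) set| <o k"
    by (intro inacc_prod inacc_fun inacc_cat assms)
  show "inj (\<lambda>G :: ('a, 'a, 'a, 'a) fct. (Src G, Tgt G, FO G, FM G))"
    by (rule injI) simp
qed simp

end

section \<open>Recoded oplax colimits\<close>

lemma recode_sel:
  assumes e: "inj e" "inj e'"
  shows "Ob (recode e e' C) = e ` Ob C" "Ar (recode e e' C) = e' ` Ar C"
    "f \<in> Ar C \<Longrightarrow> Dom (recode e e' C) (e' f) = e (Dom C f)"
    "f \<in> Ar C \<Longrightarrow> Cod (recode e e' C) (e' f) = e (Cod C f)"
    "a \<in> Ob C \<Longrightarrow> Idn (recode e e' C) (e a) = e' (Idn C a)"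
    "g \<in> Ar C \<Longrightarrow> f \<in> Ar C \<Longrightarrow> Dom C g = Cod C f \<Longrightarrow>
      Cmp (recode e e' C) (e' g) (e' f) = e' (Cmp C g f)"
  using inj_on_subset[OF e(1) subset_UNIV, of "Ob C"] inj_on_subset[OF e(2) subset_UNIV, of "Ar C"]
  by (simp_all add: recode_def Let_def)

lemma category_recode:
  assumes e: "inj e" "inj e'" and C: "category C"
  shows "category (recode e e' C)"
proof -
  have [simp]: "a \<in> Ob C \<Longrightarrow> inv_into (Ob C) e (e a) = a" "f \<in> Ar C \<Longrightarrow> inv_into (Ar C) e' (e' f) = f"
    "e a = e b \<longleftrightarrow> a = b" for a b f
    using inj_on_subset[OF e(1) subset_UNIV, of "Ob C"] inj_on_subset[OF e(2) subset_UNIV, of "Ar C"]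
      inj_eq[OF e(1)] by simp_all
  show ?thesis unfolding recode_def Let_def
    by (rule category_mk_cat) (use C in \<open>auto simp: Cmp_assoc\<close>)
qed

locale oplax_data =
  fixes J :: "('a, 'b) cat" and c :: "'a \<Rightarrow> ('c, 'd) cat" and t :: "'b \<Rightarrow> ('c, 'd, 'c, 'd) fct"
  assumes J [simp]: "category J"
    and c [simp]: "i \<in> Ob J \<Longrightarrow> category (c i)"
    and t [simp]: "\<alpha> \<in> Ar J \<Longrightarrow> is_functor (t \<alpha>)" "\<alpha> \<in> Ar J \<Longrightarrow> Src (t \<alpha>) = c (Dom J \<alpha>)"
      "\<alpha> \<in> Ar J \<Longrightarrow> Tgt (t \<alpha>) = c (Cod J \<alpha>)"
    and t_Idn [simp]: "i \<in> Ob J \<Longrightarrow> t (Idn J i) = id_fct (c i)"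
    and t_Cmp [simp]: "\<alpha> \<in> Ar J \<Longrightarrow> \<beta> \<in> Ar J \<Longrightarrow> Dom J \<beta> = Cod J \<alpha> \<Longrightarrow> t (Cmp J \<beta> \<alpha>) = t \<beta> \<circ>\<^sub>F t \<alpha>"

lemma (in oplax_data) category_oplax_colim: "category (oplax_colim J c t)"
  unfolding oplax_colim_def
  by (rule category_mk_cat) (auto simp: FM_Idn FM_Cmp Cmp_assoc)

section \<open>Cat and functors to it\<close>

lemma Cat_sel:
  "Ob Cat = MCat ` SmallCats"
  "Ar Cat = MFct ` {G. is_functor G \<and> Src G \<in> SmallCats \<and> Tgt G \<in> SmallCats}"
  "MFct G \<in> Ar Cat \<Longrightarrow> Dom Cat (MFct G) = MCat (Src G)"
  "MFct G \<in> Ar Cat \<Longrightarrow> Cod Cat (MFct G) = MCat (Tgt G)"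
  "C \<in> SmallCats \<Longrightarrow> Idn Cat (MCat C) = MFct (id_fct C)"
  "MFct G \<in> Ar Cat \<Longrightarrow> MFct H \<in> Ar Cat \<Longrightarrow> Src G = Tgt H \<Longrightarrow>
    Cmp Cat (MFct G) (MFct H) = MFct (G \<circ>\<^sub>F H)"
  by (auto simp: Cat_def)

lemma MCat_in [simp]: "MCat C \<in> Ob Cat \<longleftrightarrow> C \<in> SmallCats"
  and MFct_in [simp]: "MFct G \<in> Ar Cat \<longleftrightarrow> is_functor G \<and> Src G \<in> SmallCats \<and> Tgt G \<in> SmallCats"
  by (auto simp: Cat_sel)

lemma SmallCats_category [simp]: "C \<in> SmallCats \<Longrightarrow> category C"
  by (simp add: SmallCats_def)

lemma category_Cat [simp]: "category Cat"
  unfolding Cat_def by (rule category_mk_cat) (auto simp: cmp_fct_assoc)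

lemma iso_arrow_Cat:
  assumes G: "is_functor G" "is_functor H" "Src G \<in> SmallCats" "Tgt G \<in> SmallCats"
    and H: "Src H = Tgt G" "Tgt H = Src G" "H \<circ>\<^sub>F G = id_fct (Src G)" "G \<circ>\<^sub>F H = id_fct (Tgt G)"
  shows "iso_arrow Cat (MFct G)"
  by (rule iso_arrowI[of _ _ "MFct H"]) (use assms in \<open>auto simp: Cat_sel\<close>)

definition diag :: "('s, 'u) mfct \<Rightarrow> bool" where
  "diag x \<longleftrightarrow> is_functor x \<and> Tgt x = Cat"

lemma diagD [simp]: "diag x \<Longrightarrow> is_functor x" "diag x \<Longrightarrow> Tgt x = Cat"
  by (simp_all add: diag_def)

lemma FO_diag: "diag x \<Longrightarrow> u \<in> Ob (Src x) \<Longrightarrow> FO x u = MCat (fib x u)"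
  and fib_small: "diag x \<Longrightarrow> u \<in> Ob (Src x) \<Longrightarrow> fib x u \<in> SmallCats"
proof -
  assume "diag x" "u \<in> Ob (Src x)"
  then have "FO x u \<in> Ob Cat" by simp
  then show "FO x u = MCat (fib x u)" "fib x u \<in> SmallCats" by (auto simp: Cat_sel)
qed

lemma fib_category [simp]: "diag x \<Longrightarrow> u \<in> Ob (Src x) \<Longrightarrow> category (fib x u)"
  by (rule SmallCats_category[OF fib_small])

lemma FM_diag: "diag (x :: ('s, 'u) mfct) \<Longrightarrow> \<alpha> \<in> Ar (Src x) \<Longrightarrow> FM x \<alpha> = MFct (tra x \<alpha>)"
  and tra_functor [simp]: "diag x \<Longrightarrow> \<alpha> \<in> Ar (Src x) \<Longrightarrow> is_functor (tra x \<alpha>)"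
  and tra_Src [simp]: "diag x \<Longrightarrow> \<alpha> \<in> Ar (Src x) \<Longrightarrow> Src (tra x \<alpha>) = fib x (Dom (Src x) \<alpha>)"
  and tra_Tgt [simp]: "diag x \<Longrightarrow> \<alpha> \<in> Ar (Src x) \<Longrightarrow> Tgt (tra x \<alpha>) = fib x (Cod (Src x) \<alpha>)"
proof -
  assume a: "diag x" "\<alpha> \<in> Ar (Src x)"
  then have "FM x \<alpha> \<in> Ar Cat" by simp
  moreover from this obtain G where "FM x \<alpha> = MFct G" unfolding Cat_sel(2) by blast
  ultimately have G: "FM x \<alpha> = MFct G" "is_functor G" "MFct G \<in> Ar (Cat :: ('s, 'u) mcat)" by simp_all
  have "Dom Cat (FM x \<alpha>) = FO x (Dom (Src x) \<alpha>)" "Cod Cat (FM x \<alpha>) = FO x (Cod (Src x) \<alpha>)"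
    using a by simp_all
  then have "MCat (Src G) = FO x (Dom (Src x) \<alpha>)" "MCat (Tgt G) = FO x (Cod (Src x) \<alpha>)"
    using G by (simp_all add: Cat_sel)
  from this[symmetric] have "Src G = fib x (Dom (Src x) \<alpha>)" "Tgt G = fib x (Cod (Src x) \<alpha>)"
    by simp_all
  moreover have "tra x \<alpha> = G" using G by simp
  ultimately show "FM x \<alpha> = MFct (tra x \<alpha>)" "is_functor (tra x \<alpha>)" "Src (tra x \<alpha>) = fib x (Dom (Src x) \<alpha>)"
    "Tgt (tra x \<alpha>) = fib x (Cod (Src x) \<alpha>)" using G by simp_all
qed

lemma tra_Idn: "diag x \<Longrightarrow> u \<in> Ob (Src x) \<Longrightarrow> tra x (Idn (Src x) u) = id_fct (fib x u)"
proof -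
  assume a: "diag x" "u \<in> Ob (Src x)"
  then have "FO x u \<in> Ob Cat" by simp
  then obtain C where "FO x u = MCat C" "C \<in> SmallCats" by (auto simp: Cat_sel)
  then show ?thesis using FM_Idn[of x u "Src x"] a by (simp add: Cat_sel)
qed

lemma tra_Cmp:
  assumes a: "diag x" "\<alpha> \<in> Ar (Src x)" "\<beta> \<in> Ar (Src x)" "Dom (Src x) \<beta> = Cod (Src x) \<alpha>"
  shows "tra x (Cmp (Src x) \<beta> \<alpha>) = tra x \<beta> \<circ>\<^sub>F tra x \<alpha>"
proof -
  have "FM x (Cmp (Src x) \<beta> \<alpha>) = Cmp Cat (FM x \<beta>) (FM x \<alpha>)"
    using FM_Cmp[of x \<alpha> \<beta> "Src x"] a by simp
  also have "\<dots> = Cmp Cat (MFct (tra x \<beta>)) (MFct (tra x \<alpha>))"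
    using FM_diag[of x \<alpha>] FM_diag[of x \<beta>] a by simp
  also have "\<dots> = MFct (tra x \<beta> \<circ>\<^sub>F tra x \<alpha>)"
    by (rule Cat_sel(6)) (use a in \<open>simp_all add: fib_small\<close>)
  finally show ?thesis by simp
qed

lemma tra_FO [simp]: "diag x \<Longrightarrow> \<alpha> \<in> Ar (Src x) \<Longrightarrow> i \<in> Ob (fib x (Dom (Src x) \<alpha>)) \<Longrightarrow> v = Cod (Src x) \<alpha> \<Longrightarrow>
    FO (tra x \<alpha>) i \<in> Ob (fib x v)"
  and tra_FM [simp]: "diag x \<Longrightarrow> \<alpha> \<in> Ar (Src x) \<Longrightarrow> \<iota> \<in> Ar (fib x (Dom (Src x) \<alpha>)) \<Longrightarrow> v = Cod (Src x) \<alpha> \<Longrightarrow>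
    FM (tra x \<alpha>) \<iota> \<in> Ar (fib x v)"
  and tra_Dom [simp]: "diag x \<Longrightarrow> \<alpha> \<in> Ar (Src x) \<Longrightarrow> \<iota> \<in> Ar (fib x (Dom (Src x) \<alpha>)) \<Longrightarrow> v = Cod (Src x) \<alpha> \<Longrightarrow>
    Dom (fib x v) (FM (tra x \<alpha>) \<iota>) = FO (tra x \<alpha>) (Dom (fib x (Dom (Src x) \<alpha>)) \<iota>)"
  and tra_Cod [simp]: "diag x \<Longrightarrow> \<alpha> \<in> Ar (Src x) \<Longrightarrow> \<iota> \<in> Ar (fib x (Dom (Src x) \<alpha>)) \<Longrightarrow> v = Cod (Src x) \<alpha> \<Longrightarrow>
    Cod (fib x v) (FM (tra x \<alpha>) \<iota>) = FO (tra x \<alpha>) (Cod (fib x (Dom (Src x) \<alpha>)) \<iota>)"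
  and tra_FM_Idn: "diag x \<Longrightarrow> \<alpha> \<in> Ar (Src x) \<Longrightarrow> i \<in> Ob (fib x (Dom (Src x) \<alpha>)) \<Longrightarrow> u = Dom (Src x) \<alpha> \<Longrightarrow>
    FM (tra x \<alpha>) (Idn (fib x u) i) = Idn (fib x (Cod (Src x) \<alpha>)) (FO (tra x \<alpha>) i)"
  and tra_FM_Cmp: "diag x \<Longrightarrow> \<alpha> \<in> Ar (Src x) \<Longrightarrow> \<iota> \<in> Ar (fib x (Dom (Src x) \<alpha>)) \<Longrightarrow>
    \<kappa> \<in> Ar (fib x (Dom (Src x) \<alpha>)) \<Longrightarrow> u = Dom (Src x) \<alpha> \<Longrightarrow> Dom (fib x u) \<kappa> = Cod (fib x u) \<iota> \<Longrightarrow>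
    FM (tra x \<alpha>) (Cmp (fib x u) \<kappa> \<iota>) =
    Cmp (fib x (Cod (Src x) \<alpha>)) (FM (tra x \<alpha>) \<kappa>) (FM (tra x \<alpha>) \<iota>)"
  by (simp_all add: FM_Idn FM_Cmp)

lemma tra_Idn_FO [simp]: "diag x \<Longrightarrow> u \<in> Ob (Src x) \<Longrightarrow> i \<in> Ob (fib x u) \<Longrightarrow> FO (tra x (Idn (Src x) u)) i = i"
  and tra_Idn_FM [simp]: "diag x \<Longrightarrow> u \<in> Ob (Src x) \<Longrightarrow> \<iota> \<in> Ar (fib x u) \<Longrightarrow> FM (tra x (Idn (Src x) u)) \<iota> = \<iota>"
  and tra_Cmp_FO: "diag x \<Longrightarrow> \<alpha> \<in> Ar (Src x) \<Longrightarrow> \<beta> \<in> Ar (Src x) \<Longrightarrow> Dom (Src x) \<beta> = Cod (Src x) \<alpha> \<Longrightarrow>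
    i \<in> Ob (fib x (Dom (Src x) \<alpha>)) \<Longrightarrow>
    FO (tra x (Cmp (Src x) \<beta> \<alpha>)) i = FO (tra x \<beta>) (FO (tra x \<alpha>) i)"
  and tra_Cmp_FM: "diag x \<Longrightarrow> \<alpha> \<in> Ar (Src x) \<Longrightarrow> \<beta> \<in> Ar (Src x) \<Longrightarrow> Dom (Src x) \<beta> = Cod (Src x) \<alpha> \<Longrightarrow>
    \<iota> \<in> Ar (fib x (Dom (Src x) \<alpha>)) \<Longrightarrow>
    FM (tra x (Cmp (Src x) \<beta> \<alpha>)) \<iota> = FM (tra x \<beta>) (FM (tra x \<alpha>) \<iota>)"
  by (simp_all add: tra_Idn tra_Cmp)

lemma diag_cmp [simp]: "diag y \<Longrightarrow> is_functor h \<Longrightarrow> Tgt h = Src y \<Longrightarrow> diag (y \<circ>\<^sub>F h)"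
  by (simp add: diag_def del: diagD)

section \<open>The total category of a diagram\<close>

lemma inj_tob: "inj (\<lambda>(u, i). tob u i)"
  and inj_tar: "inj (\<lambda>(i, \<alpha>, \<beta>). tar i \<alpha> \<beta>)"
  by (auto simp: inj_def)

lemma oplax_data_diag: "diag x \<Longrightarrow> oplax_data (Src x) (fib x) (tra x)"
  by unfold_locales (simp_all add: tra_Idn tra_Cmp)

lemma category_tot [simp]: "diag x \<Longrightarrow> category (tot x)"
  unfolding tot_def
  by (intro category_recode inj_tob inj_tar oplax_data.category_oplax_colim oplax_data_diag)

lemma Ob_tot: "Ob (tot x) = {tob u i |u i. u \<in> Ob (Src x) \<and> i \<in> Ob (fib x u)}"
  unfolding tot_def recode_sel[OF inj_tob inj_tar] by (auto simp: oplax_colim_def)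

lemma Ar_tot: "Ar (tot x) = {tar i \<alpha> \<beta> |i \<alpha> \<beta>. \<alpha> \<in> Ar (Src x) \<and> i \<in> Ob (fib x (Dom (Src x) \<alpha>)) \<and>
    \<beta> \<in> Ar (fib x (Cod (Src x) \<alpha>)) \<and> Dom (fib x (Cod (Src x) \<alpha>)) \<beta> = FO (tra x \<alpha>) i}"
  unfolding tot_def recode_sel[OF inj_tob inj_tar] by (auto simp: oplax_colim_def image_iff)

lemma tob_in [simp]: "tob u i \<in> Ob (tot x) \<longleftrightarrow> u \<in> Ob (Src x) \<and> i \<in> Ob (fib x u)"
  by (auto simp: Ob_tot)

lemma tar_in [simp]: "tar i \<alpha> \<beta> \<in> Ar (tot x) \<longleftrightarrow> \<alpha> \<in> Ar (Src x) \<and> i \<in> Ob (fib x (Dom (Src x) \<alpha>)) \<and>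
    \<beta> \<in> Ar (fib x (Cod (Src x) \<alpha>)) \<and> Dom (fib x (Cod (Src x) \<alpha>)) \<beta> = FO (tra x \<alpha>) i"
  by (auto simp: Ar_tot)

lemma Ob_totE:
  assumes "z \<in> Ob (tot x)"
  obtains u i where "z = tob u i" "u \<in> Ob (Src x)" "i \<in> Ob (fib x u)"
  using assms by (auto simp: Ob_tot)

lemma Ar_totE:
  assumes "m \<in> Ar (tot x)"
  obtains i \<alpha> \<beta> where "m = tar i \<alpha> \<beta>" "\<alpha> \<in> Ar (Src x)" "i \<in> Ob (fib x (Dom (Src x) \<alpha>))"
    "\<beta> \<in> Ar (fib x (Cod (Src x) \<alpha>))" "Dom (fib x (Cod (Src x) \<alpha>)) \<beta> = FO (tra x \<alpha>) i"
  using assms by (auto simp: Ar_tot)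

lemmas recode_tot =
  recode_sel[OF inj_tob inj_tar, where C = "oplax_colim (Src x) (fib x) (tra x)" for x, folded tot_def]

lemma tot_sel [simp]:
  "tar i \<alpha> \<beta> \<in> Ar (tot x) \<Longrightarrow> Dom (tot x) (tar i \<alpha> \<beta>) = tob (Dom (Src x) \<alpha>) i"
  "tar i \<alpha> \<beta> \<in> Ar (tot x) \<Longrightarrow> Cod (tot x) (tar i \<alpha> \<beta>) = tob (Cod (Src x) \<alpha>) (Cod (fib x (Cod (Src x) \<alpha>)) \<beta>)"
  "tob u i \<in> Ob (tot x) \<Longrightarrow> Idn (tot x) (tob u i) = tar i (Idn (Src x) u) (Idn (fib x u) i)"
  "tar i \<alpha> \<beta> \<in> Ar (tot x) \<Longrightarrow> tar i' \<alpha>' \<beta>' \<in> Ar (tot x) \<Longrightarrow> Dom (Src x) \<alpha>' = Cod (Src x) \<alpha> \<Longrightarrow>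
    i' = Cod (fib x (Cod (Src x) \<alpha>)) \<beta> \<Longrightarrow>
    Cmp (tot x) (tar i' \<alpha>' \<beta>') (tar i \<alpha> \<beta>) =
    tar i (Cmp (Src x) \<alpha>' \<alpha>) (Cmp (fib x (Cod (Src x) \<alpha>')) \<beta>' (FM (tra x \<alpha>') \<beta>))"
  using recode_tot(3)[of "(i, \<alpha>, \<beta>)" x] recode_tot(4)[of "(i, \<alpha>, \<beta>)" x] recode_tot(5)[of "(u, i)" x]
    recode_tot(6)[of "(i', \<alpha>', \<beta>')" x "(i, \<alpha>, \<beta>)"]
  by (simp_all add: oplax_colim_def)

lemma proj_sel [simp]:
  "Src (proj x) = tot x" "Tgt (proj x) = Src x"
  "u \<in> Ob (Src x) \<Longrightarrow> i \<in> Ob (fib x u) \<Longrightarrow> FO (proj x) (tob u i) = u"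
  "tar i \<alpha> \<beta> \<in> Ar (tot x) \<Longrightarrow> FM (proj x) (tar i \<alpha> \<beta>) = \<alpha>"
  by (simp_all add: proj_def)

lemma is_functor_proj [simp]:
  assumes [simp]: "diag x" shows "is_functor (proj x)"
  unfolding proj_def by (rule is_functor_mk_fct) (auto elim!: Ob_totE Ar_totE)

definition vert :: "('s, 'u) mfct \<Rightarrow> ('s, 'u) moderate \<Rightarrow> 's small \<Rightarrow> ('s, 'u) moderate" where
  "vert x u \<iota> = tar (Dom (fib x u) \<iota>) (Idn (Src x) u) \<iota>"

lemma vert_sel [simp]:
  assumes [simp]: "diag x" "u \<in> Ob (Src x)" "\<iota> \<in> Ar (fib x u)"
  shows "vert x u \<iota> \<in> Ar (tot x)" "Dom (tot x) (vert x u \<iota>) = tob u (Dom (fib x u) \<iota>)"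
    "Cod (tot x) (vert x u \<iota>) = tob u (Cod (fib x u) \<iota>)" "FM (proj x) (vert x u \<iota>) = Idn (Src x) u"
  by (simp_all add: vert_def)

lemma lift_sel [simp]:
  assumes [simp]: "diag x" "\<alpha> \<in> Ar (Src x)" "i \<in> Ob (fib x (Dom (Src x) \<alpha>))"
  shows "lift x \<alpha> i \<in> Ar (tot x)" "Dom (tot x) (lift x \<alpha> i) = tob (Dom (Src x) \<alpha>) i"
    "Cod (tot x) (lift x \<alpha> i) = tob (Cod (Src x) \<alpha>) (FO (tra x \<alpha>) i)"
    "FM (proj x) (lift x \<alpha> i) = \<alpha>"
  by (simp_all add: lift_def)

lemma vert_Idn: "diag x \<Longrightarrow> u \<in> Ob (Src x) \<Longrightarrow> i \<in> Ob (fib x u) \<Longrightarrow>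
    vert x u (Idn (fib x u) i) = Idn (tot x) (tob u i)"
  by (simp add: vert_def)

lemma vert_Cmp: "diag x \<Longrightarrow> u \<in> Ob (Src x) \<Longrightarrow> \<iota> \<in> Ar (fib x u) \<Longrightarrow> \<kappa> \<in> Ar (fib x u) \<Longrightarrow>
    Dom (fib x u) \<kappa> = Cod (fib x u) \<iota> \<Longrightarrow>
    vert x u (Cmp (fib x u) \<kappa> \<iota>) = Cmp (tot x) (vert x u \<kappa>) (vert x u \<iota>)"
  by (simp add: vert_def)

lemma lift_Idn: "diag x \<Longrightarrow> u \<in> Ob (Src x) \<Longrightarrow> i \<in> Ob (fib x u) \<Longrightarrow>
    lift x (Idn (Src x) u) i = Idn (tot x) (tob u i)"
  by (simp add: lift_def)

lemma lift_Cmp: "diag x \<Longrightarrow> \<alpha> \<in> Ar (Src x) \<Longrightarrow> \<beta> \<in> Ar (Src x) \<Longrightarrow> Dom (Src x) \<beta> = Cod (Src x) \<alpha> \<Longrightarrow>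
    i \<in> Ob (fib x (Dom (Src x) \<alpha>)) \<Longrightarrow>
    lift x (Cmp (Src x) \<beta> \<alpha>) i = Cmp (tot x) (lift x \<beta> (FO (tra x \<alpha>) i)) (lift x \<alpha> i)"
  by (simp add: lift_def tra_Cmp_FO tra_FM_Idn)

text \<open>A functor on a total category is determined by its values on lifts and on vertical arrows.\<close>

lemma vert_lift: "diag x \<Longrightarrow> \<alpha> \<in> Ar (Src x) \<Longrightarrow> i \<in> Ob (fib x (Dom (Src x) \<alpha>)) \<Longrightarrow>
    \<beta> \<in> Ar (fib x (Cod (Src x) \<alpha>)) \<Longrightarrow> Dom (fib x (Cod (Src x) \<alpha>)) \<beta> = FO (tra x \<alpha>) i \<Longrightarrow>
    v = Cod (Src x) \<alpha> \<Longrightarrow> Cmp (tot x) (vert x v \<beta>) (lift x \<alpha> i) = tar i \<alpha> \<beta>"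
  by (simp add: lift_def vert_def)

lemma lift_vert: "diag x \<Longrightarrow> \<alpha> \<in> Ar (Src x) \<Longrightarrow> \<iota> \<in> Ar (fib x (Dom (Src x) \<alpha>)) \<Longrightarrow>
    Cmp (tot x) (lift x \<alpha> (Cod (fib x (Dom (Src x) \<alpha>)) \<iota>)) (vert x (Dom (Src x) \<alpha>) \<iota>) =
    tar (Dom (fib x (Dom (Src x) \<alpha>)) \<iota>) \<alpha> (FM (tra x \<alpha>) \<iota>)"
  by (simp add: lift_def vert_def)

text \<open>Both paths around the square that an arrow of the base and an arrow of a fibre span. Transported
  along a diagram \<open>f\<close> on \<open>tot x\<close>, this equation makes \<open>sum_tra x f \<alpha>\<close> a functor.\<close>

lemma lift_vert_nat: "diag x \<Longrightarrow> \<alpha> \<in> Ar (Src x) \<Longrightarrow> \<iota> \<in> Ar (fib x (Dom (Src x) \<alpha>)) \<Longrightarrow>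
    Cmp (tot x) (lift x \<alpha> (Cod (fib x (Dom (Src x) \<alpha>)) \<iota>)) (vert x (Dom (Src x) \<alpha>) \<iota>) =
    Cmp (tot x) (vert x (Cod (Src x) \<alpha>) (FM (tra x \<alpha>) \<iota>)) (lift x \<alpha> (Dom (fib x (Dom (Src x) \<alpha>)) \<iota>))"
  by (simp add: lift_vert vert_lift)

lemma lift_tar: "diag x \<Longrightarrow> tar i \<alpha> \<beta> \<in> Ar (tot x) \<Longrightarrow> \<gamma> \<in> Ar (Src x) \<Longrightarrow> Dom (Src x) \<gamma> = Cod (Src x) \<alpha> \<Longrightarrow>
    j = Cod (fib x (Cod (Src x) \<alpha>)) \<beta> \<Longrightarrow>
    Cmp (tot x) (lift x \<gamma> j) (tar i \<alpha> \<beta>) = tar i (Cmp (Src x) \<gamma> \<alpha>) (FM (tra x \<gamma>) \<beta>)"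
  by (simp add: lift_def)

section \<open>Fibrewise sums\<close>

lemma inj_SPair: "inj (\<lambda>(i, k). SPair i k)"
  and inj_SPair3: "inj (\<lambda>(k, \<iota>, \<beta>). SPair k (SPair \<iota> \<beta>))"
  by (auto simp: inj_def)

text \<open>The action of \<open>sum_fct x f\<close> on an arrow, split off so that its functoriality can be treated alone.\<close>

definition sum_tra :: "('s, 'u) mfct \<Rightarrow> ('s, 'u) mfct \<Rightarrow> ('s, 'u) moderate \<Rightarrow> 's sfct" where
  "sum_tra x f \<alpha> = (let u = Dom (Src x) \<alpha>; v = Cod (Src x) \<alpha> in
     mk_fct (fsum x f u) (fsum x f v)
       (\<lambda>z. case z of SPair i k \<Rightarrow> SPair (FO (tra x \<alpha>) i) (FO (tra f (lift x \<alpha> i)) k))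
       (\<lambda>m. case m of SPair k (SPair \<iota> \<beta>) \<Rightarrow>
          SPair (FO (tra f (lift x \<alpha> (Dom (fib x u) \<iota>))) k)
            (SPair (FM (tra x \<alpha>) \<iota>) (FM (tra f (lift x \<alpha> (Cod (fib x u) \<iota>))) \<beta>))))"

lemma sum_fct_eq: "sum_fct x f = mk_fct (Src x) Cat (\<lambda>u. MCat (fsum x f u)) (\<lambda>\<alpha>. MFct (sum_tra x f \<alpha>))"
  by (simp add: sum_fct_def sum_tra_def Let_def)

locale pair =
  fixes x f :: "('s, 'u) mfct"
  assumes x [simp]: "diag x" and f [simp]: "diag f" and Src_f [simp]: "Src f = tot x"
begin

lemma vert_f [simp]:
  assumes "u \<in> Ob (Src x)"
  shows "i \<in> Ob (fib x u) \<Longrightarrow> tra f (vert x u (Idn (fib x u) i)) = id_fct (fib f (tob u i))"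
    and "\<iota> \<in> Ar (fib x u) \<Longrightarrow> \<kappa> \<in> Ar (fib x u) \<Longrightarrow> Dom (fib x u) \<kappa> = Cod (fib x u) \<iota> \<Longrightarrow>
      tra f (vert x u (Cmp (fib x u) \<kappa> \<iota>)) = tra f (vert x u \<kappa>) \<circ>\<^sub>F tra f (vert x u \<iota>)"
  using tra_Idn[OF f] tra_Cmp[OF f] assms unfolding Src_f by (simp_all add: vert_Idn vert_Cmp del: tot_sel)

lemma oplax_data_fsum:
  "u \<in> Ob (Src x) \<Longrightarrow> oplax_data (fib x u) (\<lambda>i. fib f (tob u i)) (\<lambda>\<iota>. tra f (vert x u \<iota>))"
  by unfold_locales simp_all

lemma fsum_eq: "fsum x f u = recode (\<lambda>(i, k). SPair i k) (\<lambda>(k, \<iota>, \<beta>). SPair k (SPair \<iota> \<beta>))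
     (oplax_colim (fib x u) (\<lambda>i. fib f (tob u i)) (\<lambda>\<iota>. tra f (vert x u \<iota>)))"
  by (simp add: fsum_def vert_def)

lemma category_fsum [simp]: "u \<in> Ob (Src x) \<Longrightarrow> category (fsum x f u)"
  unfolding fsum_eq
  by (intro category_recode inj_SPair inj_SPair3 oplax_data.category_oplax_colim oplax_data_fsum)

lemma Ob_fsum: "Ob (fsum x f u) = {SPair i k |i k. i \<in> Ob (fib x u) \<and> k \<in> Ob (fib f (tob u i))}"
  unfolding fsum_eq recode_sel[OF inj_SPair inj_SPair3] by (auto simp: oplax_colim_def)

lemma Ar_fsum: "Ar (fsum x f u) = {SPair k (SPair \<iota> \<beta>) |k \<iota> \<beta>. \<iota> \<in> Ar (fib x u) \<and>
    k \<in> Ob (fib f (tob u (Dom (fib x u) \<iota>))) \<and> \<beta> \<in> Ar (fib f (tob u (Cod (fib x u) \<iota>))) \<and>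
    Dom (fib f (tob u (Cod (fib x u) \<iota>))) \<beta> = FO (tra f (vert x u \<iota>)) k}"
  unfolding fsum_eq recode_sel[OF inj_SPair inj_SPair3] by (auto simp: oplax_colim_def image_iff)

lemma fsum_in [simp]:
  "SPair i k \<in> Ob (fsum x f u) \<longleftrightarrow> i \<in> Ob (fib x u) \<and> k \<in> Ob (fib f (tob u i))"
  "SPair k (SPair \<iota> \<beta>) \<in> Ar (fsum x f u) \<longleftrightarrow> \<iota> \<in> Ar (fib x u) \<and>
    k \<in> Ob (fib f (tob u (Dom (fib x u) \<iota>))) \<and> \<beta> \<in> Ar (fib f (tob u (Cod (fib x u) \<iota>))) \<and>
    Dom (fib f (tob u (Cod (fib x u) \<iota>))) \<beta> = FO (tra f (vert x u \<iota>)) k"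
  by (auto simp: Ob_fsum Ar_fsum)

lemma Ob_fsumE:
  assumes "z \<in> Ob (fsum x f u)"
  obtains i k where "z = SPair i k" "i \<in> Ob (fib x u)" "k \<in> Ob (fib f (tob u i))"
  using assms by (auto simp: Ob_fsum)

lemma Ar_fsumE:
  assumes "m \<in> Ar (fsum x f u)"
  obtains k \<iota> \<beta> where "m = SPair k (SPair \<iota> \<beta>)" "\<iota> \<in> Ar (fib x u)"
    "k \<in> Ob (fib f (tob u (Dom (fib x u) \<iota>)))" "\<beta> \<in> Ar (fib f (tob u (Cod (fib x u) \<iota>)))"
    "Dom (fib f (tob u (Cod (fib x u) \<iota>))) \<beta> = FO (tra f (vert x u \<iota>)) k"
  using assms by (auto simp: Ar_fsum)

lemmas recode_fsum = recode_sel[OF inj_SPair inj_SPair3,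
    where C = "oplax_colim (fib x u) (\<lambda>i. fib f (tob u i)) (\<lambda>\<iota>. tra f (vert x u \<iota>))" for u, folded fsum_eq]

lemma fsum_sel [simp]:
  "SPair k (SPair \<iota> \<beta>) \<in> Ar (fsum x f u) \<Longrightarrow>
    Dom (fsum x f u) (SPair k (SPair \<iota> \<beta>)) = SPair (Dom (fib x u) \<iota>) k"
  "SPair k (SPair \<iota> \<beta>) \<in> Ar (fsum x f u) \<Longrightarrow>
    Cod (fsum x f u) (SPair k (SPair \<iota> \<beta>)) =
    SPair (Cod (fib x u) \<iota>) (Cod (fib f (tob u (Cod (fib x u) \<iota>))) \<beta>)"
  "SPair i k \<in> Ob (fsum x f u) \<Longrightarrow>
    Idn (fsum x f u) (SPair i k) = SPair k (SPair (Idn (fib x u) i) (Idn (fib f (tob u i)) k))"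
  "SPair k (SPair \<iota> \<beta>) \<in> Ar (fsum x f u) \<Longrightarrow> SPair k' (SPair \<iota>' \<beta>') \<in> Ar (fsum x f u) \<Longrightarrow>
    Dom (fib x u) \<iota>' = Cod (fib x u) \<iota> \<Longrightarrow> k' = Cod (fib f (tob u (Cod (fib x u) \<iota>))) \<beta> \<Longrightarrow>
    Cmp (fsum x f u) (SPair k' (SPair \<iota>' \<beta>')) (SPair k (SPair \<iota> \<beta>)) =
    SPair k (SPair (Cmp (fib x u) \<iota>' \<iota>)
      (Cmp (fib f (tob u (Cod (fib x u) \<iota>'))) \<beta>' (FM (tra f (vert x u \<iota>')) \<beta>)))"
  using recode_fsum(3)[of "(k, \<iota>, \<beta>)" u] recode_fsum(4)[of "(k, \<iota>, \<beta>)" u] recode_fsum(5)[of "(i, k)" u]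
    recode_fsum(6)[of "(k', \<iota>', \<beta>')" u "(k, \<iota>, \<beta>)"]
  by (simp_all add: oplax_colim_def)

lemma fsum_small:
  assumes inacc: "strongly_inaccessible |UNIV :: 's set|" and u: "u \<in> Ob (Src x)"
  shows "fsum x f u \<in> SmallCats"
proof -
  let ?r = "|UNIV :: 's set|"
  have X: "|Ob (fib x u)| <o ?r" "|Ar (fib x u)| <o ?r"
    using fib_small[OF x u] unfolding SmallCats_def smaller_than_def by blast+
  have F: "|Ob (fib f (tob u i))| <o ?r" "|Ar (fib f (tob u i))| <o ?r" if "i \<in> Ob (fib x u)" for i
  proof -
    have "fib f (tob u i) \<in> SmallCats" using that u by (intro fib_small) simp_all
    then show "|Ob (fib f (tob u i))| <o ?r" "|Ar (fib f (tob u i))| <o ?r"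
      unfolding SmallCats_def smaller_than_def by blast+
  qed
  have "|SIGMA i : Ob (fib x u). Ob (fib f (tob u i))| <o ?r"
    by (rule inacc_Sigma[OF inacc X(1) F(1)])
  from card_image_less[OF this, of "\<lambda>(i, k). SPair i k"] have "|Ob (fsum x f u)| <o ?r"
    by (rule card_subset_less) (auto simp: Ob_fsum)
  moreover have "|SIGMA \<iota> : Ar (fib x u). Ob (fib f (tob u (Dom (fib x u) \<iota>))) \<times>
      Ar (fib f (tob u (Cod (fib x u) \<iota>)))| <o ?r"
    using u by (intro inacc_Sigma[OF inacc] X F) simp_all
  from card_image_less[OF this, of "\<lambda>(\<iota>, k, \<beta>). SPair k (SPair \<iota> \<beta>)"] have "|Ar (fsum x f u)| <o ?r"
    by (rule card_subset_less) (auto simp: Ar_fsum image_iff)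
  ultimately show ?thesis using category_fsum[OF u] unfolding SmallCats_def smaller_than_def by blast
qed

text \<open>These rules contract iterated transports in \<open>f\<close> to transport along a composite, so that
  equations between arrows of the total category of \<open>x\<close> can be applied.\<close>

lemma f_comb:
  assumes "m \<in> Ar (tot x)" "m' \<in> Ar (tot x)" "Dom (tot x) m' = Cod (tot x) m"
  shows "k \<in> Ob (fib f (Dom (tot x) m)) \<Longrightarrow> FO (tra f m') (FO (tra f m) k) = FO (tra f (Cmp (tot x) m' m)) k"
    and "\<beta> \<in> Ar (fib f (Dom (tot x) m)) \<Longrightarrow> FM (tra f m') (FM (tra f m) \<beta>) = FM (tra f (Cmp (tot x) m' m)) \<beta>"
  using tra_Cmp_FO[OF f] tra_Cmp_FM[OF f] assms by simp_all

lemma f_Idn: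
  assumes "u \<in> Ob (Src x)" "i \<in> Ob (fib x u)"
  shows "k \<in> Ob (fib f (tob u i)) \<Longrightarrow> FO (tra f (Idn (tot x) (tob u i))) k = k"
    and "\<beta> \<in> Ar (fib f (tob u i)) \<Longrightarrow> FM (tra f (Idn (tot x) (tob u i))) \<beta> = \<beta>"
  using tra_Idn_FO[OF f] tra_Idn_FM[OF f] assms unfolding Src_f by (simp_all del: tot_sel)

lemma sum_tra_sel [simp]:
  assumes "\<alpha> \<in> Ar (Src x)"
  shows "Src (sum_tra x f \<alpha>) = fsum x f (Dom (Src x) \<alpha>)" "Tgt (sum_tra x f \<alpha>) = fsum x f (Cod (Src x) \<alpha>)"
    "SPair i k \<in> Ob (fsum x f (Dom (Src x) \<alpha>)) \<Longrightarrow>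
      FO (sum_tra x f \<alpha>) (SPair i k) = SPair (FO (tra x \<alpha>) i) (FO (tra f (lift x \<alpha> i)) k)"
    "SPair k (SPair \<iota> \<beta>) \<in> Ar (fsum x f (Dom (Src x) \<alpha>)) \<Longrightarrow> FM (sum_tra x f \<alpha>) (SPair k (SPair \<iota> \<beta>)) =
      SPair (FO (tra f (lift x \<alpha> (Dom (fib x (Dom (Src x) \<alpha>)) \<iota>))) k)
        (SPair (FM (tra x \<alpha>) \<iota>) (FM (tra f (lift x \<alpha> (Cod (fib x (Dom (Src x) \<alpha>)) \<iota>))) \<beta>))"
  by (simp_all add: sum_tra_def Let_def)

lemma sum_tra_functor [simp]:
  assumes \<alpha> [simp]: "\<alpha> \<in> Ar (Src x)"
  shows "is_functor (sum_tra x f \<alpha>)"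
proof -
  let ?u = "Dom (Src x) \<alpha>" and ?v = "Cod (Src x) \<alpha>"
  let ?o = "\<lambda>z. case z of SPair i k \<Rightarrow> SPair (FO (tra x \<alpha>) i) (FO (tra f (lift x \<alpha> i)) k)"
  let ?m = "\<lambda>m. case m of SPair k (SPair \<iota> \<beta>) \<Rightarrow>
     SPair (FO (tra f (lift x \<alpha> (Dom (fib x ?u) \<iota>))) k)
       (SPair (FM (tra x \<alpha>) \<iota>) (FM (tra f (lift x \<alpha> (Cod (fib x ?u) \<iota>))) \<beta>))"
  have nat: "FO (tra f (lift x \<alpha> (Cod (fib x ?u) \<iota>))) (FO (tra f (vert x ?u \<iota>)) k) =
       FO (tra f (vert x ?v (FM (tra x \<alpha>) \<iota>))) (FO (tra f (lift x \<alpha> (Dom (fib x ?u) \<iota>))) k)"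
    if "\<iota> \<in> Ar (fib x ?u)" "k \<in> Ob (fib f (tob ?u (Dom (fib x ?u) \<iota>)))" for \<iota> k
    using that by (simp add: f_comb lift_vert_nat)
  have nat': "FM (tra f (lift x \<alpha> (Cod (fib x ?u) \<iota>))) (FM (tra f (vert x ?u \<iota>)) \<beta>) =
       FM (tra f (vert x ?v (FM (tra x \<alpha>) \<iota>))) (FM (tra f (lift x \<alpha> (Dom (fib x ?u) \<iota>))) \<beta>)"
    if "\<iota> \<in> Ar (fib x ?u)" "\<beta> \<in> Ar (fib f (tob ?u (Dom (fib x ?u) \<iota>)))" for \<iota> \<beta>
    using that by (simp add: f_comb lift_vert_nat)
  have "is_functor (mk_fct (fsum x f ?u) (fsum x f ?v) ?o ?m)"
  proof (rule is_functor_mk_fct)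
    fix g h assume "g \<in> Ar (fsum x f ?u)" "h \<in> Ar (fsum x f ?u)"
      and gh: "Dom (fsum x f ?u) h = Cod (fsum x f ?u) g"
    then show "?m (Cmp (fsum x f ?u) h g) = Cmp (fsum x f ?v) (?m h) (?m g)"
      by (elim Ar_fsumE) (simp add: nat nat' tra_FM_Cmp)
  next
    fix g assume "g \<in> Ar (fsum x f ?u)"
    then show "?m g \<in> Ar (fsum x f ?v) \<and> Dom (fsum x f ?v) (?m g) = ?o (Dom (fsum x f ?u) g) \<and>
      Cod (fsum x f ?v) (?m g) = ?o (Cod (fsum x f ?u) g)"
      by (elim Ar_fsumE) (simp add: nat)
  qed (auto elim!: Ob_fsumE simp: tra_FM_Idn)
  then show ?thesis by (simp add: sum_tra_def Let_def)
qed

lemma sum_fct_sel [simp]: 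
  "Src (sum_fct x f) = Src x" "Tgt (sum_fct x f) = Cat"
  "u \<in> Ob (Src x) \<Longrightarrow> FO (sum_fct x f) u = MCat (fsum x f u)"
  "\<alpha> \<in> Ar (Src x) \<Longrightarrow> FM (sum_fct x f) \<alpha> = MFct (sum_tra x f \<alpha>)"
  by (simp_all add: sum_fct_eq)

lemma diag_sum:
  assumes inacc: "strongly_inaccessible |UNIV :: 's set|"
  shows "diag (sum_fct x f)"
proof -
  have "is_functor (mk_fct (Src x) Cat (\<lambda>u. MCat (fsum x f u)) (\<lambda>\<alpha>. MFct (sum_tra x f \<alpha>)))"
  proof (rule is_functor_mk_fct)
    fix u assume [simp]: "u \<in> Ob (Src x)"
    show "MFct (sum_tra x f (Idn (Src x) u)) = Idn Cat (MCat (fsum x f u))"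
      unfolding Cat_sel(5)[OF fsum_small[OF inacc \<open>u \<in> Ob (Src x)\<close>]] moderate.inject
      by (rule fct_eqI) (auto elim!: Ob_fsumE Ar_fsumE simp: lift_Idn f_Idn simp del: tot_sel)
  next
    fix \<alpha> \<beta> assume [simp]: "\<alpha> \<in> Ar (Src x)" "\<beta> \<in> Ar (Src x)" "Dom (Src x) \<beta> = Cod (Src x) \<alpha>"
    have "sum_tra x f (Cmp (Src x) \<beta> \<alpha>) = sum_tra x f \<beta> \<circ>\<^sub>F sum_tra x f \<alpha>"
      by (rule fct_eqI) (auto elim!: Ob_fsumE Ar_fsumE simp: lift_Cmp f_comb lift_vert_nat tra_Cmp_FO tra_Cmp_FM simp del: tot_sel)
    then show "MFct (sum_tra x f (Cmp (Src x) \<beta> \<alpha>)) = Cmp Cat (MFct (sum_tra x f \<beta>)) (MFct (sum_tra x f \<alpha>))"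
      by (simp add: Cat_sel fsum_small[OF inacc])
  qed (simp_all add: fsum_small[OF inacc] Cat_sel)
  then show ?thesis by (simp add: diag_def sum_fct_eq)
qed

end

section \<open>Pullback squares of split opfibrations\<close>

definition splitting :: "('o, 'm, 'p, 'n) fct \<Rightarrow> ('n \<Rightarrow> 'o \<Rightarrow> 'm) \<Rightarrow> bool" where
  "splitting P L \<longleftrightarrow> is_functor P \<and> (\<forall>\<alpha>\<in>Ar (Tgt P). \<forall>e\<in>Ob (Src P). FO P e = Dom (Tgt P) \<alpha> \<longrightarrow>
     L \<alpha> e \<in> Ar (Src P) \<and> Dom (Src P) (L \<alpha> e) = e \<and> FM P (L \<alpha> e) = \<alpha>)"

text \<open>A pullback square of categories, with \<open>K\<close> over \<open>h\<close>, that takes the chosen lifts \<open>L\<close> to \<open>L'\<close>. The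
  pullback property is spelt out for objects and for arrows, where pasting is a statement about sets
  and where the fibres of a projection can be read off.\<close>

definition split_pullback ::
  "('o, 'm, 'o', 'm') fct \<Rightarrow> ('p, 'n, 'p', 'n') fct \<Rightarrow> ('o, 'm, 'p, 'n) fct \<Rightarrow> ('o', 'm', 'p', 'n') fct \<Rightarrow>
    ('n \<Rightarrow> 'o \<Rightarrow> 'm) \<Rightarrow> ('n' \<Rightarrow> 'o' \<Rightarrow> 'm') \<Rightarrow> bool" where
  "split_pullback K h P P' L L' \<longleftrightarrow>
     is_functor K \<and> is_functor h \<and> is_functor P \<and> is_functor P' \<and>
     Src K = Src P \<and> Tgt K = Src P' \<and> Src h = Tgt P \<and> Tgt h = Tgt P' \<and>
     (\<forall>e\<in>Ob (Src P). FO P' (FO K e) = FO h (FO P e)) \<and>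
     (\<forall>m\<in>Ar (Src P). FM P' (FM K m) = FM h (FM P m)) \<and>
     (\<forall>u\<in>Ob (Tgt P). \<forall>e'\<in>Ob (Src P'). FO P' e' = FO h u \<longrightarrow>
        (\<exists>!e. e \<in> Ob (Src P) \<and> FO P e = u \<and> FO K e = e')) \<and>
     (\<forall>\<alpha>\<in>Ar (Tgt P). \<forall>m'\<in>Ar (Src P'). FM P' m' = FM h \<alpha> \<longrightarrow>
        (\<exists>!m. m \<in> Ar (Src P) \<and> FM P m = \<alpha> \<and> FM K m = m')) \<and>
     (\<forall>\<alpha>\<in>Ar (Tgt P). \<forall>e\<in>Ob (Src P). FO P e = Dom (Tgt P) \<alpha> \<longrightarrow>
        FM K (L \<alpha> e) = L' (FM h \<alpha>) (FO K e))"

lemma split_pullbackD: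
  assumes "split_pullback K h P P' L L'"
  shows "is_functor K" "is_functor h" "is_functor P" "is_functor P'"
    "Src K = Src P" "Tgt K = Src P'" "Src h = Tgt P" "Tgt h = Tgt P'"
    and "\<And>e. e \<in> Ob (Src P) \<Longrightarrow> FO P' (FO K e) = FO h (FO P e)"
    and "\<And>m. m \<in> Ar (Src P) \<Longrightarrow> FM P' (FM K m) = FM h (FM P m)"
    and "\<And>u e'. u \<in> Ob (Tgt P) \<Longrightarrow> e' \<in> Ob (Src P') \<Longrightarrow> FO P' e' = FO h u \<Longrightarrow>
        \<exists>!e. e \<in> Ob (Src P) \<and> FO P e = u \<and> FO K e = e'"
    and "\<And>\<alpha> m'. \<alpha> \<in> Ar (Tgt P) \<Longrightarrow> m' \<in> Ar (Src P') \<Longrightarrow> FM P' m' = FM h \<alpha> \<Longrightarrow>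
        \<exists>!m. m \<in> Ar (Src P) \<and> FM P m = \<alpha> \<and> FM K m = m'"
    and "\<And>\<alpha> e. \<alpha> \<in> Ar (Tgt P) \<Longrightarrow> e \<in> Ob (Src P) \<Longrightarrow> FO P e = Dom (Tgt P) \<alpha> \<Longrightarrow>
        FM K (L \<alpha> e) = L' (FM h \<alpha>) (FO K e)"
  using assms unfolding split_pullback_def by blast+

lemma split_pullbackI:
  assumes "is_functor K" "is_functor h" "is_functor P" "is_functor P'"
    "Src K = Src P" "Tgt K = Src P'" "Src h = Tgt P" "Tgt h = Tgt P'"
    and "\<And>e. e \<in> Ob (Src P) \<Longrightarrow> FO P' (FO K e) = FO h (FO P e)"
    and "\<And>m. m \<in> Ar (Src P) \<Longrightarrow> FM P' (FM K m) = FM h (FM P m)"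
    and "\<And>u e'. u \<in> Ob (Tgt P) \<Longrightarrow> e' \<in> Ob (Src P') \<Longrightarrow> FO P' e' = FO h u \<Longrightarrow>
        \<exists>!e. e \<in> Ob (Src P) \<and> FO P e = u \<and> FO K e = e'"
    and "\<And>\<alpha> m'. \<alpha> \<in> Ar (Tgt P) \<Longrightarrow> m' \<in> Ar (Src P') \<Longrightarrow> FM P' m' = FM h \<alpha> \<Longrightarrow>
        \<exists>!m. m \<in> Ar (Src P) \<and> FM P m = \<alpha> \<and> FM K m = m'"
    and "\<And>\<alpha> e. \<alpha> \<in> Ar (Tgt P) \<Longrightarrow> e \<in> Ob (Src P) \<Longrightarrow> FO P e = Dom (Tgt P) \<alpha> \<Longrightarrow>
        FM K (L \<alpha> e) = L' (FM h \<alpha>) (FO K e)"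
  shows "split_pullback K h P P' L L'"
  unfolding split_pullback_def using assms by blast

text \<open>Over an identity, the pullback property amounts to bijectivity on objects and on arrows.\<close>

lemma split_pullback_idI:
  assumes "is_functor K" "is_functor P" "is_functor P'"
    "Src K = Src P" "Tgt K = Src P'" and T: "Tgt P' = Tgt P"
    and O: "\<And>e. e \<in> Ob (Src P) \<Longrightarrow> FO P' (FO K e) = FO P e"
    and M: "\<And>m. m \<in> Ar (Src P) \<Longrightarrow> FM P' (FM K m) = FM P m"
    and bO: "bij_betw (FO K) (Ob (Src P)) (Ob (Src P'))"
    and bM: "bij_betw (FM K) (Ar (Src P)) (Ar (Src P'))"
    and lft: "\<And>\<alpha> e. \<alpha> \<in> Ar (Tgt P) \<Longrightarrow> e \<in> Ob (Src P) \<Longrightarrow> FO P e = Dom (Tgt P) \<alpha> \<Longrightarrow>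
        FM K (L \<alpha> e) = L' \<alpha> (FO K e)"
  shows "split_pullback K (id_fct (Tgt P)) P P' L L'"
proof (rule split_pullbackI)
  fix u e' assume u: "u \<in> Ob (Tgt P)" and e': "e' \<in> Ob (Src P')" "FO P' e' = FO (id_fct (Tgt P)) u"
  obtain e where e: "e \<in> Ob (Src P)" "FO K e = e'" using e'(1) unfolding bij_betw_imp_surj_on[OF bO, symmetric] by (elim imageE) metis
  show "\<exists>!e. e \<in> Ob (Src P) \<and> FO P e = u \<and> FO K e = e'"
  proof (rule ex1I[of _ e])
    show "e \<in> Ob (Src P) \<and> FO P e = u \<and> FO K e = e'" using e O[of e] e'(2) u by simp
    show "d = e" if "d \<in> Ob (Src P) \<and> FO P d = u \<and> FO K d = e'" for d
      using that e bO unfolding bij_betw_def inj_on_def by blast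
  qed
next
  fix u e' assume u: "u \<in> Ar (Tgt P)" and e': "e' \<in> Ar (Src P')" "FM P' e' = FM (id_fct (Tgt P)) u"
  obtain e where e: "e \<in> Ar (Src P)" "FM K e = e'" using e'(1) unfolding bij_betw_imp_surj_on[OF bM, symmetric] by (elim imageE) metis
  show "\<exists>!e. e \<in> Ar (Src P) \<and> FM P e = u \<and> FM K e = e'"
  proof (rule ex1I[of _ e])
    show "e \<in> Ar (Src P) \<and> FM P e = u \<and> FM K e = e'" using e M[of e] e'(2) u by simp
    show "d = e" if "d \<in> Ar (Src P) \<and> FM P d = u \<and> FM K d = e'" for d
      using that e bM unfolding bij_betw_def inj_on_def by blast
  qed
qed (use assms in simp_all)

lemma split_pullback_id: "splitting P L \<Longrightarrow> split_pullback (id_fct (Src P)) (id_fct (Tgt P)) P P L L"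
proof (rule split_pullback_idI)
  have "bij_betw (FO (id_fct (Src P))) (Ob (Src P)) (Ob (Src P)) \<longleftrightarrow> bij_betw id (Ob (Src P)) (Ob (Src P))"
    "bij_betw (FM (id_fct (Src P))) (Ar (Src P)) (Ar (Src P)) \<longleftrightarrow> bij_betw id (Ar (Src P)) (Ar (Src P))"
    by (rule bij_betw_cong, simp)+
  then show "bij_betw (FO (id_fct (Src P))) (Ob (Src P)) (Ob (Src P))"
    "bij_betw (FM (id_fct (Src P))) (Ar (Src P)) (Ar (Src P))" by simp_all
qed (simp_all add: splitting_def)

lemma split_pullback_cong:
  assumes "split_pullback K h P P' L L'"
    and "\<And>\<alpha> e. \<alpha> \<in> Ar (Tgt P) \<Longrightarrow> e \<in> Ob (Src P) \<Longrightarrow> FO P e = Dom (Tgt P) \<alpha> \<Longrightarrow> N \<alpha> e = L \<alpha> e"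
    and "\<And>\<alpha> e. \<alpha> \<in> Ar (Tgt P') \<Longrightarrow> e \<in> Ob (Src P') \<Longrightarrow> FO P' e = Dom (Tgt P') \<alpha> \<Longrightarrow> N' \<alpha> e = L' \<alpha> e"
  shows "split_pullback K h P P' N N'"
proof (rule split_pullbackI)
  note D = split_pullbackD[OF assms(1)]
  fix \<alpha> e assume a: "\<alpha> \<in> Ar (Tgt P)" "e \<in> Ob (Src P)" "FO P e = Dom (Tgt P) \<alpha>"
  then have "N \<alpha> e = L \<alpha> e" "N' (FM h \<alpha>) (FO K e) = L' (FM h \<alpha>) (FO K e)"
    using D(1-9) by (simp_all add: assms(2,3))
  then show "FM K (N \<alpha> e) = N' (FM h \<alpha>) (FO K e)" using D(13)[OF a] by simp
qed (rule split_pullbackD[OF assms(1)]; assumption)+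

text \<open>Along a composite \<open>P \<circ> Q\<close> an arrow is lifted first to the middle category, then to the top one.\<close>

definition comp_lift ::
  "('n \<Rightarrow> 'o \<Rightarrow> 'm) \<Rightarrow> ('q, 'k, 'o, 'm) fct \<Rightarrow> ('m \<Rightarrow> 'q \<Rightarrow> 'k) \<Rightarrow> 'n \<Rightarrow> 'q \<Rightarrow> 'k" where
  "comp_lift L Q N \<alpha> e = N (L \<alpha> (FO Q e)) e"

lemma splitting_comp:
  assumes "splitting P L" "splitting Q N" "Src P = Tgt Q"
  shows "splitting (P \<circ>\<^sub>F Q) (comp_lift L Q N)"
  using assms by (auto simp: splitting_def comp_lift_def)

lemma pullback_paste_vert:
  assumes "\<And>u d'. u \<in> B \<Longrightarrow> d' \<in> D' \<Longrightarrow> p' d' = h u \<Longrightarrow> \<exists>!d. d \<in> D \<and> p d = u \<and> k d = d'"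
    and "\<And>d e'. d \<in> D \<Longrightarrow> e' \<in> E' \<Longrightarrow> q' e' = k d \<Longrightarrow> \<exists>!e. e \<in> E \<and> q e = d \<and> m e = e'"
    and "\<And>e. e \<in> E \<Longrightarrow> q e \<in> D \<and> q' (m e) = k (q e)" "\<And>e'. e' \<in> E' \<Longrightarrow> q' e' \<in> D'"
    and "u \<in> B" "e' \<in> E'" "p' (q' e') = h u"
  shows "\<exists>!e. e \<in> E \<and> p (q e) = u \<and> m e = e'"
proof -
  obtain d where d: "d \<in> D" "p d = u" "k d = q' e'"
    and d': "\<And>c. c \<in> D \<Longrightarrow> p c = u \<Longrightarrow> k c = q' e' \<Longrightarrow> c = d" using assms(1)[of u "q' e'"] assms(4-) by metis
  obtain e where e: "e \<in> E" "q e = d" "m e = e'"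
    and e': "\<And>c. c \<in> E \<Longrightarrow> q c = d \<Longrightarrow> m c = e' \<Longrightarrow> c = e" using assms(2)[of d e'] assms(6) d by metis
  show ?thesis
  proof (rule ex1I[of _ e])
    show "c = e" if "c \<in> E \<and> p (q c) = u \<and> m c = e'" for c using that d' e' assms(3) by metis
  qed (use d e in simp)
qed

lemma pullback_paste_horiz:
  assumes "\<And>u e'. u \<in> B \<Longrightarrow> e' \<in> E' \<Longrightarrow> p' e' = h u \<Longrightarrow> \<exists>!e. e \<in> E \<and> p e = u \<and> k e = e'"
    and "\<And>u e''. u \<in> B' \<Longrightarrow> e'' \<in> E'' \<Longrightarrow> p'' e'' = h' u \<Longrightarrow> \<exists>!e. e \<in> E' \<and> p' e = u \<and> k' e = e''"
    and "\<And>e. e \<in> E \<Longrightarrow> k e \<in> E' \<and> p' (k e) = h (p e)" "h u \<in> B'"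
    and "u \<in> B" "e'' \<in> E''" "p'' e'' = h' (h u)"
  shows "\<exists>!e. e \<in> E \<and> p e = u \<and> k' (k e) = e''"
proof -
  obtain d where d: "d \<in> E'" "p' d = h u" "k' d = e''"
    and d': "\<And>c. c \<in> E' \<Longrightarrow> p' c = h u \<Longrightarrow> k' c = e'' \<Longrightarrow> c = d" using assms(2)[of "h u" e''] assms(4-) by metis
  obtain e where e: "e \<in> E" "p e = u" "k e = d"
    and e': "\<And>c. c \<in> E \<Longrightarrow> p c = u \<Longrightarrow> k c = d \<Longrightarrow> c = e" using assms(1)[of u d] assms(5) d by metis
  show ?thesis
  proof (rule ex1I[of _ e])
    show "c = e" if "c \<in> E \<and> p c = u \<and> k' (k c) = e''" for c using that d' e' assms(3) by metis
  qed (use d e in simp)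
qed

text \<open>Through this lemma a comparison of diagrams on \<open>tot x\<close> becomes one of their sums over \<open>U\<close>.\<close>

lemma split_pullback_vert:
  assumes 1: "split_pullback K h P P' L L'" and 2: "split_pullback M K Q Q' N N'" and L: "splitting P L"
  shows "split_pullback M h (P \<circ>\<^sub>F Q) (P' \<circ>\<^sub>F Q') (comp_lift L Q N) (comp_lift L' Q' N')"
proof -
  note D = split_pullbackD[OF 1] and E = split_pullbackD[OF 2]
  have eq: "Tgt Q = Src P" "Tgt Q' = Src P'" using D E by simp_all
  note [simp] = D(1-10) E(1-10)[unfolded eq] eq
  show ?thesis
  proof (rule split_pullbackI)
    fix u e' assume a: "u \<in> Ob (Tgt (P \<circ>\<^sub>F Q))" "e' \<in> Ob (Src (P' \<circ>\<^sub>F Q'))" "FO (P' \<circ>\<^sub>F Q') e' = FO h u"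
    have "\<exists>!e. e \<in> Ob (Src Q) \<and> FO P (FO Q e) = u \<and> FO M e = e'"
      by (rule pullback_paste_vert[where B = "Ob (Tgt P)" and D = "Ob (Src P)" and D' = "Ob (Src P')"
            and E' = "Ob (Src Q')" and h = "FO h" and k = "FO K" and p' = "FO P'" and q' = "FO Q'"])
        (use a D(11) E(11) in simp_all)
    then show "\<exists>!e. e \<in> Ob (Src (P \<circ>\<^sub>F Q)) \<and> FO (P \<circ>\<^sub>F Q) e = u \<and> FO M e = e'" by (simp cong: conj_cong)
  next
    fix u e' assume a: "u \<in> Ar (Tgt (P \<circ>\<^sub>F Q))" "e' \<in> Ar (Src (P' \<circ>\<^sub>F Q'))" "FM (P' \<circ>\<^sub>F Q') e' = FM h u"
    have "\<exists>!e. e \<in> Ar (Src Q) \<and> FM P (FM Q e) = u \<and> FM M e = e'"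
      by (rule pullback_paste_vert[where B = "Ar (Tgt P)" and D = "Ar (Src P)" and D' = "Ar (Src P')"
            and E' = "Ar (Src Q')" and h = "FM h" and k = "FM K" and p' = "FM P'" and q' = "FM Q'"])
        (use a D(12) E(12) in simp_all)
    then show "\<exists>!e. e \<in> Ar (Src (P \<circ>\<^sub>F Q)) \<and> FM (P \<circ>\<^sub>F Q) e = u \<and> FM M e = e'" by (simp cong: conj_cong)
  next
    fix \<alpha> e assume a: "\<alpha> \<in> Ar (Tgt (P \<circ>\<^sub>F Q))" "e \<in> Ob (Src (P \<circ>\<^sub>F Q))"
      "FO (P \<circ>\<^sub>F Q) e = Dom (Tgt (P \<circ>\<^sub>F Q)) \<alpha>"
    then have "L \<alpha> (FO Q e) \<in> Ar (Src P)" "Dom (Src P) (L \<alpha> (FO Q e)) = FO Q e"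
      using L by (simp_all add: splitting_def)
    then show "FM M (comp_lift L Q N \<alpha> e) = comp_lift L' Q' N' (FM h \<alpha>) (FO M e)"
      using E(13)[of "L \<alpha> (FO Q e)" e] D(13)[of \<alpha> "FO Q e"] a by (simp add: comp_lift_def)
  qed simp_all
qed

lemma split_pullback_horiz:
  assumes 1: "split_pullback K h P P' L L'" and 2: "split_pullback K' h' P' P'' L' L''" and L: "splitting P L"
  shows "split_pullback (K' \<circ>\<^sub>F K) (h' \<circ>\<^sub>F h) P P'' L L''"
proof -
  note D = split_pullbackD[OF 1] and E = split_pullbackD[OF 2]
  note [simp] = D(1-10) E(1-10)
  show ?thesis
  proof (rule split_pullbackI)
    fix u e' assume a: "u \<in> Ob (Tgt P)" "e' \<in> Ob (Src P'')" "FO P'' e' = FO (h' \<circ>\<^sub>F h) u"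
    have "\<exists>!e. e \<in> Ob (Src P) \<and> FO P e = u \<and> FO K' (FO K e) = e'"
      by (rule pullback_paste_horiz[where B = "Ob (Tgt P)" and B' = "Ob (Tgt P')" and E' = "Ob (Src P')"
            and E'' = "Ob (Src P'')" and h = "FO h" and h' = "FO h'" and p' = "FO P'" and p'' = "FO P''"])
        (use a D(11) E(11) in simp_all)
    then show "\<exists>!e. e \<in> Ob (Src P) \<and> FO P e = u \<and> FO (K' \<circ>\<^sub>F K) e = e'" by (simp cong: conj_cong)
  next
    fix u e' assume a: "u \<in> Ar (Tgt P)" "e' \<in> Ar (Src P'')" "FM P'' e' = FM (h' \<circ>\<^sub>F h) u"
    have "\<exists>!e. e \<in> Ar (Src P) \<and> FM P e = u \<and> FM K' (FM K e) = e'"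
      by (rule pullback_paste_horiz[where B = "Ar (Tgt P)" and B' = "Ar (Tgt P')" and E' = "Ar (Src P')"
            and E'' = "Ar (Src P'')" and h = "FM h" and h' = "FM h'" and p' = "FM P'" and p'' = "FM P''"])
        (use a D(12) E(12) in simp_all)
    then show "\<exists>!e. e \<in> Ar (Src P) \<and> FM P e = u \<and> FM (K' \<circ>\<^sub>F K) e = e'" by (simp cong: conj_cong)
  next
    fix \<alpha> e assume "\<alpha> \<in> Ar (Tgt P)" "e \<in> Ob (Src P)" "FO P e = Dom (Tgt P) \<alpha>"
    moreover from this have "L \<alpha> e \<in> Ar (Src P)" using L by (simp add: splitting_def)
    ultimately show "FM (K' \<circ>\<^sub>F K) (L \<alpha> e) = L'' (FM (h' \<circ>\<^sub>F h) \<alpha>) (FO (K' \<circ>\<^sub>F K) e)"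
      using D(13)[of \<alpha> e] E(13)[of "FM h \<alpha>" "FO K e"] by simp
  qed simp_all
qed

lemma split_pullback_inj:
  assumes sq: "split_pullback K h P P' L L'"
  shows "d \<in> Ob (Src P) \<Longrightarrow> e \<in> Ob (Src P) \<Longrightarrow> FO P d = FO P e \<Longrightarrow> FO K d = FO K e \<Longrightarrow> d = e"
    and "m \<in> Ar (Src P) \<Longrightarrow> n \<in> Ar (Src P) \<Longrightarrow> FM P m = FM P n \<Longrightarrow> FM K m = FM K n \<Longrightarrow> m = n"
proof -
  note D = split_pullbackD[OF sq]
  note [simp] = D(1-8)
  show "d = e" if "d \<in> Ob (Src P)" "e \<in> Ob (Src P)" "FO P d = FO P e" "FO K d = FO K e"
  proof -
    have "\<exists>!c. c \<in> Ob (Src P) \<and> FO P c = FO P e \<and> FO K c = FO K e"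
      using that by (intro D(11)) (simp_all add: D(9))
    then show ?thesis using that by metis
  qed
  show "m = n" if "m \<in> Ar (Src P)" "n \<in> Ar (Src P)" "FM P m = FM P n" "FM K m = FM K n"
  proof -
    have "\<exists>!c. c \<in> Ar (Src P) \<and> FM P c = FM P n \<and> FM K c = FM K n"
      using that by (intro D(12)) (simp_all add: D(10))
    then show ?thesis using that by metis
  qed
qed

lemma split_pullback_jointly_monic:
  assumes "split_pullback K h P P' L L'"
    and w: "is_functor w" "Tgt w = Src P" and w': "is_functor w'" "Tgt w' = Src P" and S: "Src w = Src w'"
    and P: "P \<circ>\<^sub>F w = P \<circ>\<^sub>F w'" and K: "K \<circ>\<^sub>F w = K \<circ>\<^sub>F w'"
  shows "w = w'"
proof (rule fct_eqI)
  note D = split_pullbackD[OF assms(1)]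
  note [simp] = D(1-10) w w' S
  show "FO w a = FO w' a" if [simp]: "a \<in> Ob (Src w')" for a
  proof -
    have "FO P (FO w a) = FO P (FO w' a)" "FO K (FO w a) = FO K (FO w' a)"
      using arg_cong[OF P, of "\<lambda>F. FO F a"] arg_cong[OF K, of "\<lambda>F. FO F a"] by simp_all
    moreover have "\<exists>!e. e \<in> Ob (Src P) \<and> FO P e = FO P (FO w' a) \<and> FO K e = FO K (FO w' a)"
      by (rule D(11)) simp_all
    moreover have "FO w a \<in> Ob (Src P)" "FO w' a \<in> Ob (Src P)" by simp_all
    ultimately show ?thesis by metis
  qed
  show "FM w a = FM w' a" if [simp]: "a \<in> Ar (Src w')" for a
  proof -
    have "FM P (FM w a) = FM P (FM w' a)" "FM K (FM w a) = FM K (FM w' a)"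
      using arg_cong[OF P, of "\<lambda>F. FM F a"] arg_cong[OF K, of "\<lambda>F. FM F a"] by simp_all
    moreover have "\<exists>!e. e \<in> Ar (Src P) \<and> FM P e = FM P (FM w' a) \<and> FM K e = FM K (FM w' a)"
      by (rule D(12)) simp_all
    moreover have "FM w a \<in> Ar (Src P)" "FM w' a \<in> Ar (Src P)" by simp_all
    ultimately show ?thesis by metis
  qed
qed (use assms in simp_all)

text \<open>The mediating functor is defined by unique existence on objects and on arrows, and it is a functor
  because the arrows that functoriality compares have the same two projections.\<close>

lemma split_pullback_universal:
  assumes "split_pullback K h P P' L L'"
    and a: "is_functor a" "Tgt a = Src P'" and b: "is_functor b" "Tgt b = Tgt P" and S: "Src b = Src a"
    and ab: "P' \<circ>\<^sub>F a = h \<circ>\<^sub>F b"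
  obtains w where "is_functor w" "Src w = Src a" "Tgt w = Src P" "P \<circ>\<^sub>F w = b" "K \<circ>\<^sub>F w = a"
proof -
  note D = split_pullbackD[OF assms(1)]
  note [simp] = D(1-10) a b S
  have abO: "FO P' (FO a t) = FO h (FO b t)" if "t \<in> Ob (Src a)" for t
    using arg_cong[OF ab, of "\<lambda>F. FO F t"] that by simp
  have abM: "FM P' (FM a t) = FM h (FM b t)" if "t \<in> Ar (Src a)" for t
    using arg_cong[OF ab, of "\<lambda>F. FM F t"] that by simp
  define o' where "o' t = (THE e. e \<in> Ob (Src P) \<and> FO P e = FO b t \<and> FO K e = FO a t)" for t
  define m' where "m' t = (THE e. e \<in> Ar (Src P) \<and> FM P e = FM b t \<and> FM K e = FM a t)" for t
  have o'1: "\<exists>!e. e \<in> Ob (Src P) \<and> FO P e = FO b t \<and> FO K e = FO a t" if "t \<in> Ob (Src a)" for t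
    using that by (intro D(11)) (simp_all add: abO)
  have m'1: "\<exists>!e. e \<in> Ar (Src P) \<and> FM P e = FM b t \<and> FM K e = FM a t" if "t \<in> Ar (Src a)" for t
    using that by (intro D(12)) (simp_all add: abM)
  have o': "o' t \<in> Ob (Src P)" "FO P (o' t) = FO b t" "FO K (o' t) = FO a t" if "t \<in> Ob (Src a)" for t
    using theI'[OF o'1[OF that]] unfolding o'_def by simp_all
  have m': "m' t \<in> Ar (Src P)" "FM P (m' t) = FM b t" "FM K (m' t) = FM a t" if "t \<in> Ar (Src a)" for t
    using theI'[OF m'1[OF that]] unfolding m'_def by simp_all
  have o'_eq: "e = o' t" if "t \<in> Ob (Src a)" "e \<in> Ob (Src P)" "FO P e = FO b t" "FO K e = FO a t" for e t
    using o'1[OF that(1)] o'[OF that(1)] that by metis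
  have m'_eq: "e = m' t" if "t \<in> Ar (Src a)" "e \<in> Ar (Src P)" "FM P e = FM b t" "FM K e = FM a t" for e t
    using m'1[OF that(1)] m'[OF that(1)] that by metis
  have Dom_m': "Dom (Src P) (m' f) = o' (Dom (Src a) f)" if "f \<in> Ar (Src a)" for f
  proof (rule o'_eq)
    note m = m'[OF that]
    show "FO P (Dom (Src P) (m' f)) = FO b (Dom (Src a) f)"
      using Dom_FM[of P "m' f" "Tgt P"] m that by simp
    show "FO K (Dom (Src P) (m' f)) = FO a (Dom (Src a) f)"
      using Dom_FM[of K "m' f" "Src P'"] m that by simp
  qed (use that m' in simp_all)
  have Cod_m': "Cod (Src P) (m' f) = o' (Cod (Src a) f)" if "f \<in> Ar (Src a)" for f
  proof (rule o'_eq)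
    note m = m'[OF that]
    show "FO P (Cod (Src P) (m' f)) = FO b (Cod (Src a) f)"
      using Cod_FM[of P "m' f" "Tgt P"] m that by simp
    show "FO K (Cod (Src P) (m' f)) = FO a (Cod (Src a) f)"
      using Cod_FM[of K "m' f" "Src P'"] m that by simp
  qed (use that m' in simp_all)
  have F: "is_functor (mk_fct (Src a) (Src P) o' m')"
  proof (rule is_functor_mk_fct)
    show "m' (Idn (Src a) t) = Idn (Src P) (o' t)" if "t \<in> Ob (Src a)" for t
      using that o'[OF that] by (intro m'_eq[symmetric]) (simp_all add: FM_Idn)
    show "m' (Cmp (Src a) g f) = Cmp (Src P) (m' g) (m' f)"
      if "f \<in> Ar (Src a)" "g \<in> Ar (Src a)" "Dom (Src a) g = Cod (Src a) f" for f g
      using that m'[OF that(1)] m'[OF that(2)]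
      by (intro m'_eq[symmetric]) (simp_all add: FM_Cmp Dom_m' Cod_m')
  qed (simp_all add: o' m' Dom_m' Cod_m')
  moreover have "P \<circ>\<^sub>F mk_fct (Src a) (Src P) o' m' = b" "K \<circ>\<^sub>F mk_fct (Src a) (Src P) o' m' = a"
    by (rule fct_eqI; simp add: F o' m')+
  ultimately show ?thesis using that by simp
qed

lemma inverse_functors_bij:
  assumes "is_functor K" "is_functor K'" "Src K' = Tgt K" "Tgt K' = Src K"
    and l: "K' \<circ>\<^sub>F K = id_fct (Src K)" and r: "K \<circ>\<^sub>F K' = id_fct (Tgt K)"
  shows "bij_betw (FO K) (Ob (Src K)) (Ob (Tgt K))" "bij_betw (FM K) (Ar (Src K)) (Ar (Tgt K))"
proof -
  note [simp] = assms(1-4)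
  have "FO K' (FO K a) = a" if "a \<in> Ob (Src K)" for a
    using arg_cong[OF l, of "\<lambda>F. FO F a"] that by simp
  moreover have "FO K (FO K' a) = a" if "a \<in> Ob (Tgt K)" for a
    using arg_cong[OF r, of "\<lambda>F. FO F a"] that by simp
  ultimately show "bij_betw (FO K) (Ob (Src K)) (Ob (Tgt K))"
    by (intro bij_betw_byWitness[of _ "FO K'"]) auto
  have "FM K' (FM K a) = a" if "a \<in> Ar (Src K)" for a
    using arg_cong[OF l, of "\<lambda>F. FM F a"] that by simp
  moreover have "FM K (FM K' a) = a" if "a \<in> Ar (Tgt K)" for a
    using arg_cong[OF r, of "\<lambda>F. FM F a"] that by simp
  ultimately show "bij_betw (FM K) (Ar (Src K)) (Ar (Tgt K))"
    by (intro bij_betw_byWitness[of _ "FM K'"]) auto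
qed

lemma split_pullback_inverse:
  assumes sq: "split_pullback K (id_fct (Tgt P)) P P' L L'" and L: "splitting P L" and L': "splitting P' L'"
  obtains K' where "split_pullback K' (id_fct (Tgt P)) P' P L' L" "K' \<circ>\<^sub>F K = id_fct (Src P)" "K \<circ>\<^sub>F K' = id_fct (Src P')"
proof -
  note D = split_pullbackD[OF sq]
  have T: "Tgt P' = Tgt P" using D(8) by simp
  note [simp] = D(1-6) T
  have PK: "P' \<circ>\<^sub>F K = P" by (rule fct_eqI) (simp_all add: D(9,10))
  obtain K' where [simp]: "is_functor K'" "Src K' = Src P'" "Tgt K' = Src P"
    and K': "P \<circ>\<^sub>F K' = P'" "K \<circ>\<^sub>F K' = id_fct (Src P')"
    by (rule split_pullback_universal[OF sq, of "id_fct (Src P')" P']) simp_all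
  have K'': "K' \<circ>\<^sub>F K = id_fct (Src P)"
  proof (rule split_pullback_jointly_monic[OF sq])
    show "P \<circ>\<^sub>F (K' \<circ>\<^sub>F K) = P \<circ>\<^sub>F id_fct (Src P)" by (simp add: cmp_fct_assoc K' PK)
    show "K \<circ>\<^sub>F (K' \<circ>\<^sub>F K) = K \<circ>\<^sub>F id_fct (Src P)" by (simp add: cmp_fct_assoc K')
  qed simp_all
  have KK: "FO K (FO K' e) = e" if "e \<in> Ob (Src P')" for e
    using arg_cong[OF K'(2), of "\<lambda>F. FO F e"] that by simp
  have KK': "FM K' (FM K e) = e" if "e \<in> Ar (Src P)" for e
    using arg_cong[OF K'', of "\<lambda>F. FM F e"] that by simp
  have OK: "FO P (FO K' e) = FO P' e" if "e \<in> Ob (Src P')" for e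
    using arg_cong[OF K'(1), of "\<lambda>F. FO F e"] that by simp
  have MK: "FM P (FM K' e) = FM P' e" if "e \<in> Ar (Src P')" for e
    using arg_cong[OF K'(1), of "\<lambda>F. FM F e"] that by simp
  have "split_pullback K' (id_fct (Tgt P')) P' P L' L"
  proof (rule split_pullback_idI)
    show "bij_betw (FO K') (Ob (Src P')) (Ob (Src P))" "bij_betw (FM K') (Ar (Src P')) (Ar (Src P))"
      using inverse_functors_bij[of K' K] K'(2) K'' by simp_all
    fix \<alpha> e assume a: "\<alpha> \<in> Ar (Tgt P')" "e \<in> Ob (Src P')" "FO P' e = Dom (Tgt P') \<alpha>"
    then have "FM K (L \<alpha> (FO K' e)) = L' \<alpha> e" using D(13)[of \<alpha> "FO K' e"] by (simp add: OK KK)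
    moreover have "L \<alpha> (FO K' e) \<in> Ar (Src P)" using L a by (simp add: splitting_def OK)
    ultimately show "FM K' (L' \<alpha> e) = L \<alpha> (FO K' e)" using KK' by metis
  qed (simp_all add: OK MK)
  then show ?thesis using that K' K'' T by simp
qed

section \<open>Natural isomorphisms of diagrams\<close>

lemma iso_arrow_CatD:
  assumes "iso_arrow (Cat :: ('s, 'u) mcat) (MFct G)"
  shows "is_functor G" "Src G \<in> SmallCats" "Tgt G \<in> SmallCats"
    "bij_betw (FO G) (Ob (Src G)) (Ob (Tgt G))" "bij_betw (FM G) (Ar (Src G)) (Ar (Tgt G))"
proof -
  have G: "MFct G \<in> Ar (Cat :: ('s, 'u) mcat)" using assms by (rule iso_arrow_Ar)
  then show G': "is_functor G" "Src G \<in> SmallCats" "Tgt G \<in> SmallCats" by simp_all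
  note i = inverse_arrow[OF assms]
  obtain H where H: "inverse_arrow (Cat :: ('s, 'u) mcat) (MFct G) = MFct H"
    using i(1) unfolding Cat_sel(2) by blast
  have H1: "is_functor H" using i(1) unfolding H by simp
  have H2: "Src H = Tgt G" "Tgt H = Src G" using i(1-3) G unfolding H by (simp_all add: Cat_sel)
  have "H \<circ>\<^sub>F G = id_fct (Src G)" "G \<circ>\<^sub>F H = id_fct (Tgt G)"
    using i(1,4,5) G H2 G' unfolding H by (simp_all add: Cat_sel(3-6))
  then show "bij_betw (FO G) (Ob (Src G)) (Ob (Tgt G))" "bij_betw (FM G) (Ar (Src G)) (Ar (Tgt G))"
    using inverse_functors_bij[of G H] G' H1 H2 by simp_all
qed

text \<open>Isomorphisms in Cat can thus be exhibited without constructing the inverse functors.\<close>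

lemma iso_arrow_CatI:
  assumes G: "is_functor G" "Src G \<in> SmallCats" "Tgt G \<in> SmallCats"
    and bO: "bij_betw (FO G) (Ob (Src G)) (Ob (Tgt G))" and bM: "bij_betw (FM G) (Ar (Src G)) (Ar (Tgt G))"
  shows "iso_arrow Cat (MFct G)"
proof -
  let ?o = "inv_into (Ob (Src G)) (FO G)" and ?m = "inv_into (Ar (Src G)) (FM G)"
  have o1: "?o a \<in> Ob (Src G)" "FO G (?o a) = a" if "a \<in> Ob (Tgt G)" for a
    using bij_betw_inv_into_right[OF bO that] bij_betwE[OF bij_betw_inv_into[OF bO]] that by auto
  have o2: "a = ?o b" if "a \<in> Ob (Src G)" "FO G a = b" for a b
    using bij_betw_inv_into_left[OF bO that(1)] that(2) by simp
  have m1: "?m a \<in> Ar (Src G)" "FM G (?m a) = a" if "a \<in> Ar (Tgt G)" for a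
    using bij_betw_inv_into_right[OF bM that] bij_betwE[OF bij_betw_inv_into[OF bM]] that by auto
  have m2: "a = ?m b" if "a \<in> Ar (Src G)" "FM G a = b" for a b
    using bij_betw_inv_into_left[OF bM that(1)] that(2) by simp
  note [simp] = G(1)
  have Dm: "Dom (Src G) (?m f) = ?o (Dom (Tgt G) f)" if "f \<in> Ar (Tgt G)" for f
    using Dom_FM[of G "?m f" "Tgt G"] m1[OF that] by (intro o2) simp_all
  have Cm: "Cod (Src G) (?m f) = ?o (Cod (Tgt G) f)" if "f \<in> Ar (Tgt G)" for f
    using Cod_FM[of G "?m f" "Tgt G"] m1[OF that] by (intro o2) simp_all
  have H: "is_functor (mk_fct (Tgt G) (Src G) ?o ?m)"
  proof (rule is_functor_mk_fct)
    show "?m (Idn (Tgt G) a) = Idn (Src G) (?o a)" if "a \<in> Ob (Tgt G)" for a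
      using o1[OF that] by (intro m2[symmetric]) (simp_all add: FM_Idn)
    show "?m (Cmp (Tgt G) g f) = Cmp (Src G) (?m g) (?m f)"
      if "f \<in> Ar (Tgt G)" "g \<in> Ar (Tgt G)" "Dom (Tgt G) g = Cod (Tgt G) f" for f g
      using that m1[OF that(1)] m1[OF that(2)] by (intro m2[symmetric]) (simp_all add: FM_Cmp Dm Cm)
  qed (simp_all add: o1 m1 Dm Cm)
  show ?thesis
  proof (rule iso_arrow_Cat[OF G(1) H G(2,3)])
    show "mk_fct (Tgt G) (Src G) ?o ?m \<circ>\<^sub>F G = id_fct (Src G)"
      by (rule fct_eqI) (simp_all add: H o2[symmetric] m2[symmetric])
    show "G \<circ>\<^sub>F mk_fct (Tgt G) (Src G) ?o ?m = id_fct (Tgt G)"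
      by (rule fct_eqI) (simp_all add: H o1 m1)
  qed simp_all
qed

section \<open>Reindexing along natural isomorphisms\<close>

abbreviation (input) component :: "(('s, 'u) moderate \<Rightarrow> ('s, 'u) moderate) \<Rightarrow> ('s, 'u) moderate \<Rightarrow> 's sfct" where
  "component \<phi> u \<equiv> the_fct (\<phi> u)"

text \<open>The function \<open>lift\<close> with objects of \<open>tot x\<close> as arguments, as \<open>splitting\<close> expects it.\<close>

definition lifts :: "('s, 'u) mfct \<Rightarrow> ('s, 'u) moderate \<Rightarrow> ('s, 'u) moderate \<Rightarrow> ('s, 'u) moderate" where
  "lifts x \<alpha> z = (case z of tob u i \<Rightarrow> lift x \<alpha> i)"

abbreviation (input) lifts2 :: "('s, 'u) mfct \<Rightarrow> ('s, 'u) mfct \<Rightarrow> ('s, 'u) moderate \<Rightarrow> ('s, 'u) moderate \<Rightarrow> ('s, 'u) moderate" where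
  "lifts2 x f \<equiv> comp_lift (lifts x) (proj f) (lifts f)"

lemma lifts_tob [simp]: "lifts x \<alpha> (tob u i) = lift x \<alpha> i"
  by (simp add: lifts_def)

lemma splitting_proj [simp]: "diag x \<Longrightarrow> splitting (proj x) (lifts x)"
  by (auto simp: splitting_def elim!: Ob_totE)

locale reindexing =
  fixes h x y :: "('s, 'u) mfct" and \<phi> :: "('s, 'u) moderate \<Rightarrow> ('s, 'u) moderate"
  assumes y [simp]: "diag y" and h [simp]: "is_functor h" "Tgt h = Src y"
    and \<phi>: "nat_iso x (y \<circ>\<^sub>F h) \<phi>"
begin

lemma x [simp]: "diag x" "Src h = Src x"
  using nat_isoD(1-4)[OF \<phi>] diagD(2)[OF y] by (simp_all add: diag_def del: diagD)

lemma component_facts: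
  assumes u [simp]: "u \<in> Ob (Src x)"
  shows component_sel: "is_functor (component \<phi> u)" "Src (component \<phi> u) = fib x u" "Tgt (component \<phi> u) = fib y (FO h u)"
    and component_eq: "\<phi> u = MFct (component \<phi> u)"
    and bij_component: "bij_betw (FO (component \<phi> u)) (Ob (fib x u)) (Ob (fib y (FO h u)))"
      "bij_betw (FM (component \<phi> u)) (Ar (fib x u)) (Ar (fib y (FO h u)))"
proof -
  note D = nat_isoD[OF \<phi>]
  have A: "\<phi> u \<in> Ar Cat" "iso_arrow Cat (\<phi> u)" "Dom Cat (\<phi> u) = FO x u" "Cod Cat (\<phi> u) = FO y (FO h u)"
    using D(5-8)[of u] by simp_all
  obtain G where G: "\<phi> u = MFct G" using A(1) unfolding Cat_sel(2) by blast
  note i = iso_arrow_CatD[OF A(2)[unfolded G]]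
  have S: "FO x u = MCat (Src G)" "FO y (FO h u) = MCat (Tgt G)"
    using A(1,3,4) i unfolding G by (simp_all add: Cat_sel(3,4))
  show "is_functor (component \<phi> u)" "Src (component \<phi> u) = fib x u" "Tgt (component \<phi> u) = fib y (FO h u)"
    "\<phi> u = MFct (component \<phi> u)"
    "bij_betw (FO (component \<phi> u)) (Ob (fib x u)) (Ob (fib y (FO h u)))"
    "bij_betw (FM (component \<phi> u)) (Ar (fib x u)) (Ar (fib y (FO h u)))"
    using i by (simp_all add: S G)
qed

lemmas [simp] = component_sel

lemma component_nat:
  assumes \<alpha> [simp]: "\<alpha> \<in> Ar (Src x)"
  shows "i \<in> Ob (fib x (Dom (Src x) \<alpha>)) \<Longrightarrow>
      FO (component \<phi> (Cod (Src x) \<alpha>)) (FO (tra x \<alpha>) i) = FO (tra y (FM h \<alpha>)) (FO (component \<phi> (Dom (Src x) \<alpha>)) i)"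
    and "\<iota> \<in> Ar (fib x (Dom (Src x) \<alpha>)) \<Longrightarrow>
      FM (component \<phi> (Cod (Src x) \<alpha>)) (FM (tra x \<alpha>) \<iota>) = FM (tra y (FM h \<alpha>)) (FM (component \<phi> (Dom (Src x) \<alpha>)) \<iota>)"
proof -
  let ?u = "Dom (Src x) \<alpha>" and ?v = "Cod (Src x) \<alpha>"
  have "Cmp Cat (\<phi> ?v) (FM x \<alpha>) = Cmp Cat (FM y (FM h \<alpha>)) (\<phi> ?u)"
    using nat_isoD(9)[OF \<phi>, of \<alpha>] by simp
  moreover have "\<phi> ?v = MFct (component \<phi> ?v)" "\<phi> ?u = MFct (component \<phi> ?u)" by (rule component_eq, simp)+
  moreover have "FM x \<alpha> = MFct (tra x \<alpha>)" "FM y (FM h \<alpha>) = MFct (tra y (FM h \<alpha>))" by (rule FM_diag; simp)+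
  ultimately have "Cmp (Cat :: ('s, 'u) mcat) (MFct (component \<phi> ?v)) (MFct (tra x \<alpha>)) =
      Cmp Cat (MFct (tra y (FM h \<alpha>))) (MFct (component \<phi> ?u))" by metis
  then have e: "component \<phi> ?v \<circ>\<^sub>F tra x \<alpha> = tra y (FM h \<alpha>) \<circ>\<^sub>F component \<phi> ?u"
    by (simp add: Cat_sel(6) fib_small)
  show "i \<in> Ob (fib x ?u) \<Longrightarrow> FO (component \<phi> ?v) (FO (tra x \<alpha>) i) = FO (tra y (FM h \<alpha>)) (FO (component \<phi> ?u) i)"
    using arg_cong[OF e, of "\<lambda>F. FO F i"] by simp
  show "\<iota> \<in> Ar (fib x ?u) \<Longrightarrow> FM (component \<phi> ?v) (FM (tra x \<alpha>) \<iota>) = FM (tra y (FM h \<alpha>)) (FM (component \<phi> ?u) \<iota>)"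
    using arg_cong[OF e, of "\<lambda>F. FM F \<iota>"] by simp
qed

lemma reindex_sel [simp]:
  "Src (reindex h x y \<phi>) = tot x" "Tgt (reindex h x y \<phi>) = tot y"
  "tob u i \<in> Ob (tot x) \<Longrightarrow> FO (reindex h x y \<phi>) (tob u i) = tob (FO h u) (FO (component \<phi> u) i)"
  "tar i \<alpha> \<beta> \<in> Ar (tot x) \<Longrightarrow> FM (reindex h x y \<phi>) (tar i \<alpha> \<beta>) =
    tar (FO (component \<phi> (Dom (Src x) \<alpha>)) i) (FM h \<alpha>) (FM (component \<phi> (Cod (Src x) \<alpha>)) \<beta>)"
  by (simp_all add: reindex_def)

lemma component_in [simp]:
  assumes [simp]: "u \<in> Ob (Src x)"
  shows "\<iota> \<in> Ar (fib x u) \<Longrightarrow> FM (component \<phi> u) \<iota> \<in> Ar (fib y (FO h u))"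
    "\<iota> \<in> Ar (fib x u) \<Longrightarrow> Dom (fib y (FO h u)) (FM (component \<phi> u) \<iota>) = FO (component \<phi> u) (Dom (fib x u) \<iota>)"
    "\<iota> \<in> Ar (fib x u) \<Longrightarrow> Cod (fib y (FO h u)) (FM (component \<phi> u) \<iota>) = FO (component \<phi> u) (Cod (fib x u) \<iota>)"
  by simp_all

lemma is_functor_reindex [simp]: "is_functor (reindex h x y \<phi>)"
proof -
  let ?o = "\<lambda>z. case z of tob u i \<Rightarrow> tob (FO h u) (FO (component \<phi> u) i)"
  let ?m = "\<lambda>m. case m of tar i \<alpha> \<beta> \<Rightarrow>
        tar (FO (component \<phi> (Dom (Src x) \<alpha>)) i) (FM h \<alpha>) (FM (component \<phi> (Cod (Src x) \<alpha>)) \<beta>)"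
  have "is_functor (mk_fct (tot x) (tot y) ?o ?m)"
  proof (rule is_functor_mk_fct)
    fix g f assume "f \<in> Ar (tot x)" "g \<in> Ar (tot x)" "Dom (tot x) g = Cod (tot x) f"
    then show "?m (Cmp (tot x) g f) = Cmp (tot y) (?m g) (?m f)"
      by (elim Ar_totE) (simp add: component_nat FM_Cmp)
  qed (auto elim!: Ob_totE Ar_totE simp: component_nat FM_Idn)
  then show ?thesis by (simp add: reindex_def)
qed

lemma split_pullback_reindex: "split_pullback (reindex h x y \<phi>) h (proj x) (proj y) (lifts x) (lifts y)"
proof (rule split_pullbackI)
  fix u e' assume u: "u \<in> Ob (Tgt (proj x))" and "e' \<in> Ob (Src (proj y))" "FO (proj y) e' = FO h u"
  then obtain j where j: "e' = tob (FO h u) j" "j \<in> Ob (fib y (FO h u))" by (auto elim!: Ob_totE)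
  have b: "bij_betw (FO (component \<phi> u)) (Ob (fib x u)) (Ob (fib y (FO h u)))" using u by (simp add: bij_component)
  obtain i where i: "i \<in> Ob (fib x u)" "FO (component \<phi> u) i = j"
    using j(2) unfolding bij_betw_imp_surj_on[OF b, symmetric] by (elim imageE) metis
  show "\<exists>!e. e \<in> Ob (Src (proj x)) \<and> FO (proj x) e = u \<and> FO (reindex h x y \<phi>) e = e'"
    by (rule ex1I[of _ "tob u i"])
      (use u i j bij_betw_imp_inj_on[OF b] in \<open>auto elim!: Ob_totE dest: inj_onD\<close>)
next
  fix \<alpha> m' assume \<alpha>: "\<alpha> \<in> Ar (Tgt (proj x))" and "m' \<in> Ar (Src (proj y))" "FM (proj y) m' = FM h \<alpha>"
  then obtain j \<kappa> where j: "m' = tar j (FM h \<alpha>) \<kappa>" "m' \<in> Ar (tot y)" by (auto elim!: Ar_totE)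
  let ?u = "Dom (Src x) \<alpha>" and ?v = "Cod (Src x) \<alpha>"
  have j': "j \<in> Ob (fib y (FO h ?u))" "\<kappa> \<in> Ar (fib y (FO h ?v))"
    "Dom (fib y (FO h ?v)) \<kappa> = FO (tra y (FM h \<alpha>)) j" using j \<alpha> by simp_all
  have b: "bij_betw (FO (component \<phi> ?u)) (Ob (fib x ?u)) (Ob (fib y (FO h ?u)))"
    and c: "bij_betw (FM (component \<phi> ?v)) (Ar (fib x ?v)) (Ar (fib y (FO h ?v)))"
    and d: "bij_betw (FO (component \<phi> ?v)) (Ob (fib x ?v)) (Ob (fib y (FO h ?v)))"
    using \<alpha> by (simp_all add: bij_component)
  obtain i where i: "i \<in> Ob (fib x ?u)" "FO (component \<phi> ?u) i = j"
    using j'(1) unfolding bij_betw_imp_surj_on[OF b, symmetric] by (elim imageE) metis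
  obtain \<beta> where \<beta>: "\<beta> \<in> Ar (fib x ?v)" "FM (component \<phi> ?v) \<beta> = \<kappa>"
    using j'(2) unfolding bij_betw_imp_surj_on[OF c, symmetric] by (elim imageE) metis
  have "FO (component \<phi> ?v) (Dom (fib x ?v) \<beta>) = FO (component \<phi> ?v) (FO (tra x \<alpha>) i)"
    using j'(3) \<alpha> i \<beta> by (auto simp: component_nat)
  then have D: "Dom (fib x ?v) \<beta> = FO (tra x \<alpha>) i"
    by (rule inj_onD[OF bij_betw_imp_inj_on[OF d]]) (use i \<beta> \<alpha> in simp_all)
  show "\<exists>!m. m \<in> Ar (Src (proj x)) \<and> FM (proj x) m = \<alpha> \<and> FM (reindex h x y \<phi>) m = m'"
    by (rule ex1I[of _ "tar i \<alpha> \<beta>"])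
      (use \<alpha> i j \<beta> D bij_betw_imp_inj_on[OF b] bij_betw_imp_inj_on[OF c] in \<open>auto elim!: Ar_totE dest: inj_onD\<close>)
next
  fix \<alpha> e assume "\<alpha> \<in> Ar (Tgt (proj x))" "e \<in> Ob (Src (proj x))" "FO (proj x) e = Dom (Tgt (proj x)) \<alpha>"
  then show "FM (reindex h x y \<phi>) (lifts x \<alpha> e) = lifts y (FM h \<alpha>) (FO (reindex h x y \<phi>) e)"
    by (auto elim!: Ob_totE simp: lift_def component_nat FM_Idn)
qed (auto elim!: Ob_totE Ar_totE simp: component_nat)

end

lemma nat_iso_CatI:
  fixes x z :: "('s, 'u) mfct"
  assumes [simp]: "diag x" "diag z" "Src z = Src x"
    and G [simp]: "\<And>u. u \<in> Ob (Src x) \<Longrightarrow> is_functor (G u)" "\<And>u. u \<in> Ob (Src x) \<Longrightarrow> Src (G u) = fib x u"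
      "\<And>u. u \<in> Ob (Src x) \<Longrightarrow> Tgt (G u) = fib z u"
    and b: "\<And>u. u \<in> Ob (Src x) \<Longrightarrow> bij_betw (FO (G u)) (Ob (fib x u)) (Ob (fib z u))"
      "\<And>u. u \<in> Ob (Src x) \<Longrightarrow> bij_betw (FM (G u)) (Ar (fib x u)) (Ar (fib z u))"
    and n: "\<And>\<alpha> i. \<alpha> \<in> Ar (Src x) \<Longrightarrow> i \<in> Ob (fib x (Dom (Src x) \<alpha>)) \<Longrightarrow>
        FO (G (Cod (Src x) \<alpha>)) (FO (tra x \<alpha>) i) = FO (tra z \<alpha>) (FO (G (Dom (Src x) \<alpha>)) i)"
      "\<And>\<alpha> i. \<alpha> \<in> Ar (Src x) \<Longrightarrow> i \<in> Ar (fib x (Dom (Src x) \<alpha>)) \<Longrightarrow>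
        FM (G (Cod (Src x) \<alpha>)) (FM (tra x \<alpha>) i) = FM (tra z \<alpha>) (FM (G (Dom (Src x) \<alpha>)) i)"
  shows "nat_iso x z (\<lambda>u. MFct (G u))"
proof (rule nat_isoI)
  have z: "u \<in> Ob (Src x) \<Longrightarrow> category (fib z u)" "u \<in> Ob (Src x) \<Longrightarrow> fib z u \<in> SmallCats" for u
    using fib_category[of z] fib_small[of z] by simp_all
  fix u assume "u \<in> Ob (Src z)"
  then have u [simp]: "u \<in> Ob (Src x)" by simp
  show "iso_arrow (Tgt z) (MFct (G u))"
    using iso_arrow_CatI[of "G u"] b[of u] by (simp add: fib_small z)
  show "Dom (Tgt z) (MFct (G u)) = FO x u" "Cod (Tgt z) (MFct (G u)) = FO z u"
    using FO_diag[of x u] FO_diag[of z u] by (simp_all add: Cat_sel(3,4) fib_small z)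
next
  have z: "u \<in> Ob (Src x) \<Longrightarrow> category (fib z u)" "u \<in> Ob (Src x) \<Longrightarrow> fib z u \<in> SmallCats" for u
    using fib_category[of z] fib_small[of z] by simp_all
  fix \<alpha> assume "\<alpha> \<in> Ar (Src z)"
  then have \<alpha> [simp]: "\<alpha> \<in> Ar (Src x)" by simp
  have t: "is_functor (tra z \<alpha>)" "Src (tra z \<alpha>) = fib z (Dom (Src x) \<alpha>)" "Tgt (tra z \<alpha>) = fib z (Cod (Src x) \<alpha>)"
    using tra_functor[of z \<alpha>] tra_Src[of z \<alpha>] tra_Tgt[of z \<alpha>] by simp_all
  have "G (Cod (Src x) \<alpha>) \<circ>\<^sub>F tra x \<alpha> = tra z \<alpha> \<circ>\<^sub>F G (Dom (Src x) \<alpha>)"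
    by (rule fct_eqI) (simp_all add: t n)
  then have e: "Cmp (Cat :: ('s, 'u) mcat) (MFct (G (Cod (Src x) \<alpha>))) (MFct (tra x \<alpha>)) =
      Cmp Cat (MFct (tra z \<alpha>)) (MFct (G (Dom (Src x) \<alpha>)))"
    by (simp add: Cat_sel(6) fib_small z t)
  have "FM x \<alpha> = MFct (tra x \<alpha>)" "FM z \<alpha> = MFct (tra z \<alpha>)" by (rule FM_diag; simp)+
  with e have "Cmp Cat (MFct (G (Cod (Src x) \<alpha>))) (FM x \<alpha>) = Cmp Cat (FM z \<alpha>) (MFct (G (Dom (Src x) \<alpha>)))"
    by metis
  then show "Cmp (Tgt z) (MFct (G (Cod (Src z) \<alpha>))) (FM x \<alpha>) =
      Cmp (Tgt z) (FM z \<alpha>) (MFct (G (Dom (Src z) \<alpha>)))" by simp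
qed simp_all

text \<open>The restrictions of \<open>K\<close> to fibres are isomorphisms since the square is a pullback. They are strictly
  natural since \<open>K\<close> preserves the chosen lifts: the target of \<open>lift x \<alpha> i\<close> is \<open>x(\<alpha>)(i)\<close>. Finally \<open>K\<close> is
  determined by its restrictions because vertical arrows and lifts generate the total category.\<close>

lemma split_pullback_proj_reindex:
  assumes sq: "split_pullback K h (proj x) (proj y) (lifts x) (lifts y)" and x [simp]: "diag x" and y [simp]: "diag y"
  obtains \<phi> where "nat_iso x (y \<circ>\<^sub>F h) \<phi>" "K = reindex h x y \<phi>"
proof -
  note D = split_pullbackD[OF sq]
  have [simp]: "is_functor K" "is_functor h" "Src K = tot x" "Tgt K = tot y" "Src h = Src x" "Tgt h = Src y"
    using D(1,2,5-8) by simp_all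
  define g where "g u i = (case FO K (tob u i) of tob _ j \<Rightarrow> j)" for u i
  define gm where "gm u \<iota> = (case FM K (vert x u \<iota>) of tar _ _ \<kappa> \<Rightarrow> \<kappa>)" for u \<iota>
  have KO: "FO K (tob u i) = tob (FO h u) (g u i)" and g [simp]: "g u i \<in> Ob (fib y (FO h u))"
    if [simp]: "u \<in> Ob (Src x)" "i \<in> Ob (fib x u)" for u i
  proof -
    have "FO K (tob u i) \<in> Ob (tot y)" by simp
    then obtain w j where wj: "FO K (tob u i) = tob w j" "w \<in> Ob (Src y)" "j \<in> Ob (fib y w)" by (rule Ob_totE)
    moreover have "w = FO h u" using D(9)[of "tob u i"] wj by simp
    ultimately show "FO K (tob u i) = tob (FO h u) (g u i)" "g u i \<in> Ob (fib y (FO h u))"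
      by (simp_all add: g_def)
  qed
  have KM: "FM K (vert x u \<iota>) = vert y (FO h u) (gm u \<iota>)" and gm [simp]: "gm u \<iota> \<in> Ar (fib y (FO h u))"
    if [simp]: "u \<in> Ob (Src x)" "\<iota> \<in> Ar (fib x u)" for u \<iota>
  proof -
    have K: "FM K (vert x u \<iota>) \<in> Ar (tot y)" by simp
    then obtain j \<gamma> \<kappa> where j: "FM K (vert x u \<iota>) = tar j \<gamma> \<kappa>" by (rule Ar_totE)
    then have k: "FM K (vert x u \<iota>) = tar j \<gamma> \<kappa>" "tar j \<gamma> \<kappa> \<in> Ar (tot y)" using K by metis+
    moreover have "\<gamma> = Idn (Src y) (FO h u)" using D(10)[of "vert x u \<iota>"] k by (simp add: FM_Idn)
    ultimately show "FM K (vert x u \<iota>) = vert y (FO h u) (gm u \<iota>)" "gm u \<iota> \<in> Ar (fib y (FO h u))"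
      by (simp_all add: gm_def) (simp_all add: vert_def)
  qed
  have gDom: "Dom (fib y (FO h u)) (gm u \<iota>) = g u (Dom (fib x u) \<iota>)"
    and gCod: "Cod (fib y (FO h u)) (gm u \<iota>) = g u (Cod (fib x u) \<iota>)"
    if [simp]: "u \<in> Ob (Src x)" "\<iota> \<in> Ar (fib x u)" for u \<iota>
    using Dom_FM[of K "vert x u \<iota>" "tot y"] Cod_FM[of K "vert x u \<iota>" "tot y"] by (simp_all add: KO KM)
  have vert_inj: "vert y w \<kappa> = vert y w \<kappa>' \<Longrightarrow> \<kappa> = \<kappa>'" for w \<kappa> \<kappa>' by (simp add: vert_def)
  define G where "G u = mk_fct (fib x u) (fib y (FO h u)) (g u) (gm u)" for u
  have G: "is_functor (G u)" if [simp]: "u \<in> Ob (Src x)" for u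
    unfolding G_def
  proof (rule is_functor_mk_fct)
    show "gm u (Idn (fib x u) i) = Idn (fib y (FO h u)) (g u i)" if "i \<in> Ob (fib x u)" for i
    proof (rule vert_inj[of "FO h u"])
      have "FM K (Idn (tot x) (tob u i)) = Idn (tot y) (FO K (tob u i))"
        by (subst FM_Idn) (use that in simp_all)
      then show "vert y (FO h u) (gm u (Idn (fib x u) i)) = vert y (FO h u) (Idn (fib y (FO h u)) (g u i))"
        using that by (simp add: KM[symmetric] vert_Idn KO del: tot_sel)
    qed
    show "gm u (Cmp (fib x u) \<kappa> \<iota>) = Cmp (fib y (FO h u)) (gm u \<kappa>) (gm u \<iota>)"
      if "\<iota> \<in> Ar (fib x u)" "\<kappa> \<in> Ar (fib x u)" "Dom (fib x u) \<kappa> = Cod (fib x u) \<iota>" for \<iota> \<kappa>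
    proof (rule vert_inj[of "FO h u"])
      have "FM K (Cmp (tot x) (vert x u \<kappa>) (vert x u \<iota>)) = Cmp (tot y) (FM K (vert x u \<kappa>)) (FM K (vert x u \<iota>))"
        by (subst FM_Cmp) (use that in simp_all)
      then show "vert y (FO h u) (gm u (Cmp (fib x u) \<kappa> \<iota>)) =
          vert y (FO h u) (Cmp (fib y (FO h u)) (gm u \<kappa>) (gm u \<iota>))"
        using that by (simp add: KM[symmetric] vert_Cmp gDom gCod)
    qed
  qed (simp_all add: gDom gCod)
  have lft: "FM K (lift x \<alpha> i) = lift y (FM h \<alpha>) (g (Dom (Src x) \<alpha>) i)"
    if "\<alpha> \<in> Ar (Src x)" "i \<in> Ob (fib x (Dom (Src x) \<alpha>))" for \<alpha> i
    using D(13)[of \<alpha> "tob (Dom (Src x) \<alpha>) i"] that by (simp add: KO)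
  have natO: "g (Cod (Src x) \<alpha>) (FO (tra x \<alpha>) i) = FO (tra y (FM h \<alpha>)) (g (Dom (Src x) \<alpha>) i)"
    if [simp]: "\<alpha> \<in> Ar (Src x)" "i \<in> Ob (fib x (Dom (Src x) \<alpha>))" for \<alpha> i
    using Cod_FM[of K "lift x \<alpha> i" "tot y"] by (simp add: lft KO)
  \<comment> \<open>An arrow of the total category is a chosen lift followed by a vertical arrow.\<close>
  have Ktar: "FM K (tar i \<alpha> \<beta>) = tar (g (Dom (Src x) \<alpha>) i) (FM h \<alpha>) (gm (Cod (Src x) \<alpha>) \<beta>)"
    if t: "tar i \<alpha> \<beta> \<in> Ar (tot x)" for i \<alpha> \<beta>
  proof -
    have "FM K (Cmp (tot x) (vert x (Cod (Src x) \<alpha>) \<beta>) (lift x \<alpha> i)) =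
        Cmp (tot y) (FM K (vert x (Cod (Src x) \<alpha>) \<beta>)) (FM K (lift x \<alpha> i))"
      by (subst FM_Cmp) (use t in simp_all)
    then have "FM K (tar i \<alpha> \<beta>) = Cmp (tot y) (vert y (FO h (Cod (Src x) \<alpha>)) (gm (Cod (Src x) \<alpha>) \<beta>))
        (lift y (FM h \<alpha>) (g (Dom (Src x) \<alpha>) i))"
      using t by (simp add: vert_lift KM lft)
    also have "\<dots> = tar (g (Dom (Src x) \<alpha>) i) (FM h \<alpha>) (gm (Cod (Src x) \<alpha>) \<beta>)"
      by (subst vert_lift) (use t in \<open>simp_all add: gDom natO\<close>)
    finally show ?thesis .
  qed
  have natM: "gm (Cod (Src x) \<alpha>) (FM (tra x \<alpha>) \<iota>) = FM (tra y (FM h \<alpha>)) (gm (Dom (Src x) \<alpha>) \<iota>)"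
    if [simp]: "\<alpha> \<in> Ar (Src x)" "\<iota> \<in> Ar (fib x (Dom (Src x) \<alpha>))" for \<alpha> \<iota>
  proof -
    let ?u = "Dom (Src x) \<alpha>"
    have "FM K (Cmp (tot x) (lift x \<alpha> (Cod (fib x ?u) \<iota>)) (vert x ?u \<iota>)) =
        Cmp (tot y) (FM K (lift x \<alpha> (Cod (fib x ?u) \<iota>))) (FM K (vert x ?u \<iota>))"
      by (subst FM_Cmp) simp_all
    then show ?thesis using lift_vert[of y "FM h \<alpha>" "gm ?u \<iota>"] by (simp add: lift_vert lft KM Ktar gCod)
  qed
  have n: "nat_iso x (y \<circ>\<^sub>F h) (\<lambda>u. MFct (G u))"
  proof (rule nat_iso_CatI)
    show "diag (y \<circ>\<^sub>F h)" by simp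
    fix u assume u [simp]: "u \<in> Ob (Src x)"
    have "bij_betw (g u) (Ob (fib x u)) (Ob (fib y (FO h u)))"
    proof (rule bij_betwI')
      show "g u i = g u j \<longleftrightarrow> i = j" if "i \<in> Ob (fib x u)" "j \<in> Ob (fib x u)" for i j
        using split_pullback_inj(1)[OF sq, of "tob u i" "tob u j"] that by (auto simp: KO)
      fix j assume j: "j \<in> Ob (fib y (FO h u))"
      then obtain e where "e \<in> Ob (tot x)" "FO (proj x) e = u" "FO K e = tob (FO h u) j"
        using D(11)[of u "tob (FO h u) j"] by auto
      then show "\<exists>i\<in>Ob (fib x u). j = g u i" by (auto elim!: Ob_totE simp: KO)
    qed simp
    then show "bij_betw (FO (G u)) (Ob (fib x u)) (Ob (fib (y \<circ>\<^sub>F h) u))"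
      by (subst bij_betw_cong[of _ _ "g u"]) (simp_all add: G_def)
    have "bij_betw (gm u) (Ar (fib x u)) (Ar (fib y (FO h u)))"
    proof (rule bij_betwI')
      show "gm u i = gm u j \<longleftrightarrow> i = j" if "i \<in> Ar (fib x u)" "j \<in> Ar (fib x u)" for i j
      proof
        assume "gm u i = gm u j"
        then have "FM K (vert x u i) = FM K (vert x u j)" using that by (simp add: KM)
        then have "vert x u i = vert x u j" using split_pullback_inj(2)[OF sq, of "vert x u i" "vert x u j"] that by simp
        then show "i = j" by (simp add: vert_def)
      qed simp
      fix \<kappa> assume \<kappa>: "\<kappa> \<in> Ar (fib y (FO h u))"
      then obtain m where "m \<in> Ar (tot x)" "FM (proj x) m = Idn (Src x) u" "FM K m = vert y (FO h u) \<kappa>"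
        using D(12)[of "Idn (Src x) u" "vert y (FO h u) \<kappa>"] by (auto simp: FM_Idn)
      then show "\<exists>i\<in>Ar (fib x u). \<kappa> = gm u i" by (auto elim!: Ar_totE simp: Ktar vert_def)
    qed simp
    then show "bij_betw (FM (G u)) (Ar (fib x u)) (Ar (fib (y \<circ>\<^sub>F h) u))"
      by (subst bij_betw_cong[of _ _ "gm u"]) (simp_all add: G_def)
  qed (simp_all add: G, simp_all add: G_def natO natM)
  interpret reindexing h x y "\<lambda>u. MFct (G u)" by unfold_locales (simp_all add: n)
  have "K = reindex h x y (\<lambda>u. MFct (G u))"
    by (rule fct_eqI) (auto elim!: Ob_totE Ar_totE simp: KO Ktar, simp_all add: G_def)
  then show ?thesis using n that by blast
qed

section \<open>Flattening\<close>

context pair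
begin

lemma f_lift_Idn [simp]:
  assumes "u \<in> Ob (Src x)" "i \<in> Ob (fib x u)"
  shows "k \<in> Ob (fib f (tob u i)) \<Longrightarrow> FO (tra f (lift x (Idn (Src x) u) i)) k = k"
  using f_Idn assms by (simp add: lift_Idn del: tot_sel)

lemma flat_sel [simp]:
  "Src (flat_fct x f) = tot f" "Tgt (flat_fct x f) = tot (sum_fct x f)"
  "tob (tob u i) k \<in> Ob (tot f) \<Longrightarrow> FO (flat_fct x f) (tob (tob u i) k) = tob u (SPair i k)"
  "tar k (tar i \<alpha> \<beta>) \<delta> \<in> Ar (tot f) \<Longrightarrow> FM (flat_fct x f) (tar k (tar i \<alpha> \<beta>) \<delta>) =
    tar (SPair i k) \<alpha> (SPair (FO (tra f (lift x \<alpha> i)) k) (SPair \<beta> \<delta>))"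
  by (simp add: flat_fct_def, simp add: flat_fct_def, simp add: flat_fct_def)
    (auto simp: flat_fct_def)

lemma Ob_tot_fE:
  assumes "z \<in> Ob (tot f)"
  obtains u i k where "z = tob (tob u i) k" "u \<in> Ob (Src x)" "i \<in> Ob (fib x u)" "k \<in> Ob (fib f (tob u i))"
  using assms by (auto elim!: Ob_totE)

lemma Ar_tot_fE:
  assumes "m \<in> Ar (tot f)"
  obtains i \<alpha> \<beta> k \<delta> where "m = tar k (tar i \<alpha> \<beta>) \<delta>" "\<alpha> \<in> Ar (Src x)" "i \<in> Ob (fib x (Dom (Src x) \<alpha>))"
    "\<beta> \<in> Ar (fib x (Cod (Src x) \<alpha>))" "Dom (fib x (Cod (Src x) \<alpha>)) \<beta> = FO (tra x \<alpha>) i"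
    "k \<in> Ob (fib f (tob (Dom (Src x) \<alpha>) i))"
    "\<delta> \<in> Ar (fib f (tob (Cod (Src x) \<alpha>) (Cod (fib x (Cod (Src x) \<alpha>)) \<beta>)))"
    "Dom (fib f (tob (Cod (Src x) \<alpha>) (Cod (fib x (Cod (Src x) \<alpha>)) \<beta>))) \<delta> = FO (tra f (tar i \<alpha> \<beta>)) k"
  using assms by (auto elim!: Ar_totE)

context
  assumes S [simp]: "diag (sum_fct x f)"
begin

lemma is_functor_flat [simp]: "is_functor (flat_fct x f)"
proof -
  let ?S = "sum_fct x f"
  let ?o = "\<lambda>z. case z of tob (tob u i) k \<Rightarrow> tob u (SPair i k)"
  let ?m = "\<lambda>m. case m of tar k (tar i \<alpha> \<beta>) \<delta> \<Rightarrow>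
        tar (SPair i k) \<alpha> (SPair (FO (tra f (lift x \<alpha> i)) k) (SPair \<beta> \<delta>))"
  have "is_functor (mk_fct (tot f) (tot ?S) ?o ?m)"
  proof (rule is_functor_mk_fct)
    fix m assume "m \<in> Ar (tot f)"
    then show "?m m \<in> Ar (tot ?S) \<and> Dom (tot ?S) (?m m) = ?o (Dom (tot f) m) \<and>
        Cod (tot ?S) (?m m) = ?o (Cod (tot f) m)"
      by (elim Ar_tot_fE) (simp add: f_comb vert_lift)
  next
    fix m n assume "m \<in> Ar (tot f)" "n \<in> Ar (tot f)" "Dom (tot f) n = Cod (tot f) m"
    then show "?m (Cmp (tot f) n m) = Cmp (tot ?S) (?m n) (?m m)"
      by (elim Ar_tot_fE) (simp add: f_comb vert_lift lift_Cmp[symmetric] lift_tar tra_Cmp_FO)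
  qed (auto elim!: Ob_tot_fE)
  then show ?thesis by (simp add: flat_fct_def)
qed

text \<open>An arrow of \<open>tot f\<close> and its image list the same data, except that the image also records the object
  \<open>f(\<alpha>, id)(k)\<close>, which the other data determine. Hence the flattening functor is bijective.\<close>

lemma split_pullback_flat:
  "split_pullback (flat_fct x f) (id_fct (Src x)) (proj x \<circ>\<^sub>F proj f) (proj (sum_fct x f))
     (lifts2 x f) (lifts (sum_fct x f))"
proof -
  let ?S = "sum_fct x f"
  have "split_pullback (flat_fct x f) (id_fct (Tgt (proj x \<circ>\<^sub>F proj f))) (proj x \<circ>\<^sub>F proj f) (proj ?S)
     (lifts2 x f) (lifts ?S)"
  proof (rule split_pullback_idI)
    show "bij_betw (FO (flat_fct x f)) (Ob (Src (proj x \<circ>\<^sub>F proj f))) (Ob (Src (proj ?S)))"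
      by (rule bij_betw_byWitness[where f' = "\<lambda>z. case z of tob u (SPair i k) \<Rightarrow> tob (tob u i) k"])
        (auto elim!: Ob_tot_fE Ob_totE[of _ ?S] Ob_fsumE)
    show "bij_betw (FM (flat_fct x f)) (Ar (Src (proj x \<circ>\<^sub>F proj f))) (Ar (Src (proj ?S)))"
      by (rule bij_betw_byWitness[where f' = "\<lambda>m. case m of tar (SPair i k) \<alpha> (SPair k' (SPair \<beta> \<delta>)) \<Rightarrow>
            tar k (tar i \<alpha> \<beta>) \<delta>"])
        (auto elim!: Ar_tot_fE Ar_totE[of _ ?S] Ob_fsumE Ar_fsumE simp: f_comb vert_lift)
  next
    fix \<alpha> e assume "\<alpha> \<in> Ar (Tgt (proj x \<circ>\<^sub>F proj f))" "e \<in> Ob (Src (proj x \<circ>\<^sub>F proj f))"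
      "FO (proj x \<circ>\<^sub>F proj f) e = Dom (Tgt (proj x \<circ>\<^sub>F proj f)) \<alpha>"
    then show "FM (flat_fct x f) (lifts2 x f \<alpha> e) = lifts ?S \<alpha> (FO (flat_fct x f) e)"
      by (auto elim!: Ob_tot_fE simp: comp_lift_def lift_def)
  qed (auto elim!: Ob_tot_fE Ar_tot_fE simp: f_comb vert_lift)
  then show ?thesis by simp
qed

end

end

section \<open>Diagrams representing split opfibrations\<close>

text \<open>The split opfibration \<open>(P, L)\<close> is isomorphic, through \<open>F\<close>, to the one that belongs to the diagram \<open>s\<close>.\<close>

definition represents ::
  "('s, 'u) mfct \<Rightarrow> (('s, 'u) moderate \<Rightarrow> ('s, 'u) moderate \<Rightarrow> ('s, 'u) moderate) \<Rightarrow>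
    ('s, 'u) mfct \<Rightarrow> ('s, 'u) mfct \<Rightarrow> bool" where
  "represents P L s F \<longleftrightarrow> diag s \<and> splitting P L \<and> split_pullback F (id_fct (Tgt P)) P (proj s) L (lifts s)"

lemma representsD:
  assumes "represents P L s F"
  shows "diag s" "splitting P L" "split_pullback F (id_fct (Tgt P)) P (proj s) L (lifts s)"
    "is_functor F" "is_functor P" "Src F = Src P" "Tgt F = tot s" "Src s = Tgt P" "proj s \<circ>\<^sub>F F = P"
proof -
  show A: "diag s" "splitting P L" "split_pullback F (id_fct (Tgt P)) P (proj s) L (lifts s)"
    using assms by (simp_all add: represents_def)
  note D = split_pullbackD[OF A(3)]
  show B: "is_functor F" "is_functor P" "Src F = Src P" "Tgt F = tot s" "Src s = Tgt P"
    using D(1,3,5,6,8) by simp_all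
  show "proj s \<circ>\<^sub>F F = P" by (rule fct_eqI) (simp_all add: A B D(9,10))
qed

lemma represents_cong:
  assumes "represents P L s F"
    and "\<And>\<alpha> e. \<alpha> \<in> Ar (Tgt P) \<Longrightarrow> e \<in> Ob (Src P) \<Longrightarrow> FO P e = Dom (Tgt P) \<alpha> \<Longrightarrow> N \<alpha> e = L \<alpha> e"
  shows "represents P N s F"
  using assms split_pullback_cong[OF representsD(3)[OF assms(1)], of N "lifts s"]
  by (auto simp: represents_def splitting_def)

lemma represents_proj: "diag s \<Longrightarrow> represents (proj s) (lifts s) s (id_fct (tot s))"
  using split_pullback_id[of "proj s" "lifts s"] by (simp add: represents_def)

lemma represents_pre:
  assumes "represents P' L' s F" and sq: "split_pullback K (id_fct (Tgt P)) P P' L L'" and L: "splitting P L"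
  shows "represents P L s (F \<circ>\<^sub>F K)"
proof -
  have "Tgt P' = Tgt P" "is_functor P" using split_pullbackD(8,3)[OF sq] by simp_all
  then show ?thesis
    using split_pullback_horiz[OF sq representsD(3)[OF assms(1)] L] representsD(1)[OF assms(1)] L
    by (simp add: represents_def)
qed

text \<open>Conjugating \<open>K\<close> with the two representations gives a pullback square between projections, and these
  are reindexings.\<close>

lemma represents_compare:
  assumes 1: "represents P L s F" and 2: "represents P' L' s' F'" and sq: "split_pullback K h P P' L L'"
  obtains \<phi> where "nat_iso s (s' \<circ>\<^sub>F h) \<phi>" "reindex h s s' \<phi> \<circ>\<^sub>F F = F' \<circ>\<^sub>F K"
proof -
  note D = representsD[OF 1] and E = representsD[OF 2] and S = split_pullbackD[OF sq]
  note [simp] = D(1,4-8) E(1,4-8) S(1-8)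
  obtain G where G: "split_pullback G (id_fct (Tgt P)) (proj s) P (lifts s) L" "G \<circ>\<^sub>F F = id_fct (Src P)"
    by (rule split_pullback_inverse[OF D(3) D(2)]) simp_all
  have [simp]: "is_functor G" "Tgt G = Src P" "Src G = tot s" using split_pullbackD(1,5,6)[OF G(1)] by simp_all
  have "split_pullback (F' \<circ>\<^sub>F K) h P (proj s') L (lifts s')"
    using split_pullback_horiz[OF sq E(3) D(2)] by simp
  from split_pullback_horiz[OF G(1) this] have "split_pullback (F' \<circ>\<^sub>F K \<circ>\<^sub>F G) h (proj s) (proj s') (lifts s) (lifts s')" by simp
  from split_pullback_proj_reindex[OF this] obtain \<phi>
    where \<phi>: "nat_iso s (s' \<circ>\<^sub>F h) \<phi>" "F' \<circ>\<^sub>F K \<circ>\<^sub>F G = reindex h s s' \<phi>" by auto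
  have "reindex h s s' \<phi> \<circ>\<^sub>F F = F' \<circ>\<^sub>F K \<circ>\<^sub>F (G \<circ>\<^sub>F F)"
    unfolding \<phi>(2)[symmetric] by (simp add: cmp_fct_assoc)
  then show ?thesis using \<phi>(1) G(2) that by simp
qed

lemma represents_unique:
  assumes 1: "represents P L s F" and 2: "represents P L s' F'"
  obtains \<phi> where "nat_iso s s' \<phi>" "relabel s s' \<phi> \<circ>\<^sub>F F = F'"
proof -
  note D = representsD[OF 1] and E = representsD[OF 2]
  obtain \<phi> where "nat_iso s (s' \<circ>\<^sub>F id_fct (Tgt P)) \<phi>"
    "reindex (id_fct (Tgt P)) s s' \<phi> \<circ>\<^sub>F F = F' \<circ>\<^sub>F id_fct (Src P)"
    by (rule represents_compare[OF 1 2 split_pullback_id[OF D(2)]])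
  then show ?thesis using that D E by simp
qed

lemma represents_relabel:
  assumes 1: "represents P L s F" and \<nu>: "nat_iso s s' \<nu>"
  shows "represents P L s' (relabel s s' \<nu> \<circ>\<^sub>F F)"
proof -
  note D = representsD[OF 1] and N = nat_isoD(1-4)[OF \<nu>]
  have s': "diag s'" unfolding diag_def using N diagD[OF D(1)] by simp
  then interpret reindexing "id_fct (Src s)" s s' \<nu>
    using N \<nu> by unfold_locales simp_all
  have "split_pullback (relabel s s' \<nu>) (id_fct (Tgt P)) (proj s) (proj s') (lifts s) (lifts s')"
    using split_pullback_reindex D by simp
  from split_pullback_horiz[OF D(3) this D(2)] show ?thesis using D s' by (simp add: represents_def)
qed

text \<open>Summation of diagrams is composition of split opfibrations.\<close>

lemma represents_sum:
  assumes r: "represents Q N f F" and x [simp]: "diag x" and T: "Tgt Q = tot x" and S: "diag (sum_fct x f)"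
  shows "represents (proj x \<circ>\<^sub>F Q) (comp_lift (lifts x) Q N) (sum_fct x f) (flat_fct x f \<circ>\<^sub>F F)"
proof -
  note D = representsD[OF r]
  interpret pair x f using D T by unfold_locales simp_all
  have A: "split_pullback F (id_fct (Src x)) (proj x \<circ>\<^sub>F Q) (proj x \<circ>\<^sub>F proj f)
      (comp_lift (lifts x) Q N) (lifts2 x f)"
    using split_pullback_vert[OF split_pullback_id[of "proj x" "lifts x"] D(3)[unfolded T proj_sel(1)[symmetric]]] by simp
  have L: "splitting (proj x \<circ>\<^sub>F Q) (comp_lift (lifts x) Q N)"
    using D T by (intro splitting_comp) simp_all
  show ?thesis using split_pullback_horiz[OF A split_pullback_flat[OF S] L] L S T D by (simp add: represents_def)
qed

section \<open>Change of the base functor up to isomorphism\<close>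

lemma lift_iso:
  assumes y [simp]: "diag y" and \<zeta>: "iso_arrow (Src y) \<zeta>" and j [simp]: "j \<in> Ob (fib y (Dom (Src y) \<zeta>))"
  shows "iso_arrow (tot y) (lift y \<zeta> j)"
proof -
  note i = inverse_arrow[OF \<zeta>]
  let ?i = "inverse_arrow (Src y) \<zeta>"
  have [simp]: "\<zeta> \<in> Ar (Src y)" using \<zeta> by (rule iso_arrow_Ar)
  note [simp] = i(1-3)
  have 1: "FO (tra y ?i) (FO (tra y \<zeta>) j) = j"
    by (subst tra_Cmp_FO[symmetric]) (simp_all add: i(4))
  show ?thesis
  proof (rule iso_arrowI[of _ _ "lift y ?i (FO (tra y \<zeta>) j)"])
    show "Cmp (tot y) (lift y ?i (FO (tra y \<zeta>) j)) (lift y \<zeta> j) = Idn (tot y) (Dom (tot y) (lift y \<zeta> j))"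
      by (simp add: lift_Cmp[symmetric] i(4) lift_Idn del: tot_sel)
    have "Cmp (tot y) (lift y \<zeta> (FO (tra y ?i) (FO (tra y \<zeta>) j))) (lift y ?i (FO (tra y \<zeta>) j)) =
        Idn (tot y) (Cod (tot y) (lift y \<zeta> j))"
      by (subst lift_Cmp[symmetric]) (simp_all add: i(5) lift_Idn del: tot_sel)
    then show "Cmp (tot y) (lift y \<zeta> j) (lift y ?i (FO (tra y \<zeta>) j)) =
        Idn (tot y) (Cod (tot y) (lift y \<zeta> j))" by (simp add: 1)
  qed (simp_all add: 1)
qed

text \<open>The isomorphism between the two reindexing functors has as components the lifts of the components of
  \<open>\<zeta>\<close>; they are natural because \<open>\<psi>\<close> absorbs the transport along \<open>\<zeta>\<close>.\<close>

lemma reindex_change: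
  assumes y [simp]: "diag y" and \<phi>: "nat_iso x (y \<circ>\<^sub>F h) \<phi>" and \<zeta>: "nat_iso h h' \<zeta>" and T: "Tgt h = Src y"
  defines "\<psi> \<equiv> \<lambda>u. Cmp Cat (FM y (\<zeta> u)) (\<phi> u)"
  shows "nat_iso x (y \<circ>\<^sub>F h') \<psi>" "reindex h x y \<phi> \<cong>\<^sub>F reindex h' x y \<psi>"
proof -
  note Z = nat_isoD[OF \<zeta>]
  note [simp] = Z(1-4)
  have T' [simp]: "Tgt h' = Src y" using T Z by simp
  interpret A: reindexing h x y \<phi> using \<phi> T by unfold_locales simp_all
  show \<psi>: "nat_iso x (y \<circ>\<^sub>F h') \<psi>"
    using nat_iso_trans[OF \<phi> nat_iso_whisker_left[OF \<zeta>, of y]] by (simp add: \<psi>_def)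
  interpret B: reindexing h' x y \<psi> using \<psi> by unfold_locales simp_all
  have [simp]: "Src h' = Src x" using B.x by simp
  have z: "\<zeta> u \<in> Ar (Src y)" "iso_arrow (Src y) (\<zeta> u)" "Dom (Src y) (\<zeta> u) = FO h u" "Cod (Src y) (\<zeta> u) = FO h' u"
    if "u \<in> Ob (Src x)" for u using Z(5-8) that by simp_all
  note [simp] = z(1,3,4)
  have c: "component \<psi> u = tra y (\<zeta> u) \<circ>\<^sub>F component \<phi> u" if [simp]: "u \<in> Ob (Src x)" for u
  proof -
    have "FM y (\<zeta> u) = MFct (tra y (\<zeta> u))" "\<phi> u = MFct (component \<phi> u)" 
      using FM_diag[of y "\<zeta> u"] A.component_eq[of u] by simp_all
    then have "\<psi> u = Cmp Cat (MFct (tra y (\<zeta> u))) (MFct (component \<phi> u))" unfolding \<psi>_def by metis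
    also have "\<dots> = MFct (tra y (\<zeta> u) \<circ>\<^sub>F component \<phi> u)"
      by (rule Cat_sel(6)) (simp_all add: fib_small)
    finally show ?thesis by simp
  qed
  define \<eta> where "\<eta> z = (case z of tob u i \<Rightarrow> lift y (\<zeta> u) (FO (component \<phi> u) i))" for z
  have "nat_iso (reindex h x y \<phi>) (reindex h' x y \<psi>) \<eta>"
  proof (rule nat_isoI)
    fix z assume "z \<in> Ob (Src (reindex h' x y \<psi>))"
    then obtain u i where [simp]: "z = tob u i" "u \<in> Ob (Src x)" "i \<in> Ob (fib x u)" by (auto elim!: Ob_totE)
    show "iso_arrow (Tgt (reindex h' x y \<psi>)) (\<eta> z)" using z(2)[of u] by (simp add: \<eta>_def lift_iso)
    show "Dom (Tgt (reindex h' x y \<psi>)) (\<eta> z) = FO (reindex h x y \<phi>) z"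
      "Cod (Tgt (reindex h' x y \<psi>)) (\<eta> z) = FO (reindex h' x y \<psi>) z" by (simp_all add: \<eta>_def c)
  next
    fix m assume "m \<in> Ar (Src (reindex h' x y \<psi>))"
    then obtain i \<alpha> \<beta> where m: "m = tar i \<alpha> \<beta>" "\<alpha> \<in> Ar (Src x)" "i \<in> Ob (fib x (Dom (Src x) \<alpha>))"
      "\<beta> \<in> Ar (fib x (Cod (Src x) \<alpha>))" "Dom (fib x (Cod (Src x) \<alpha>)) \<beta> = FO (tra x \<alpha>) i"
      by (auto elim!: Ar_totE)
    note [simp] = m
    have n: "Cmp (Src y) (\<zeta> (Cod (Src x) \<alpha>)) (FM h \<alpha>) = Cmp (Src y) (FM h' \<alpha>) (\<zeta> (Dom (Src x) \<alpha>))"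
      using Z(9)[of \<alpha>] by simp
    show "Cmp (Tgt (reindex h' x y \<psi>)) (\<eta> (Cod (Src (reindex h' x y \<psi>)) m)) (FM (reindex h x y \<phi>) m) =
        Cmp (Tgt (reindex h' x y \<psi>)) (FM (reindex h' x y \<psi>) m) (\<eta> (Dom (Src (reindex h' x y \<psi>)) m))"
      using tra_Cmp_FO[OF y, of "FM h \<alpha>" "\<zeta> (Cod (Src x) \<alpha>)" "FO (component \<phi> (Dom (Src x) \<alpha>)) i"]
        tra_Cmp_FO[OF y, of "\<zeta> (Dom (Src x) \<alpha>)" "FM h' \<alpha>" "FO (component \<phi> (Dom (Src x) \<alpha>)) i"]
      by (simp add: \<eta>_def c A.component_nat lift_def n tra_FM_Idn)
  qed simp_all
  then show "reindex h x y \<phi> \<cong>\<^sub>F reindex h' x y \<psi>" by (auto simp: iso_fct_def)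
qed

section \<open>The universal opfibration and the switch\<close>

lemma diag_id_Cat [simp]: "diag (id_fct Cat)"
  by (simp add: diag_def del: diagD)

lemma Fcat_category [simp]: "category Fcat"
  by (simp add: Fcat_def)

lemma p_fct_sel [simp]: "is_functor p_fct" "Src p_fct = Fcat" "Tgt p_fct = Cat"
  by (simp_all add: p_fct_def Fcat_def)

lemma the_fct_Idn_Cat:
  fixes x :: "('s, 'u) mfct"
  shows "diag x \<Longrightarrow> u \<in> Ob (Src x) \<Longrightarrow> the_fct (Idn Cat (FO x u)) = id_fct (fib x u)"
  using tra_Idn[of x u] FM_Idn[of x u "Src x"] by simp

lemma nat_iso_x_id: "diag x \<Longrightarrow> nat_iso x (id_fct Cat \<circ>\<^sub>F x) (\<lambda>u. Idn Cat (FO x u))"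
  using nat_iso_refl[of x] by simp

text \<open>The projection to the universal opfibration is itself a reindexing, so that the facts about
  reindexings apply to it.\<close>

lemma proj_F_eq:
  fixes x :: "('s, 'u) mfct"
  assumes x [simp]: "diag x"
  shows "proj_F x = reindex x x (id_fct Cat) (\<lambda>u. Idn Cat (FO x u))"
proof -
  let ?m = "\<lambda>m. case m of tar i \<alpha> \<beta> \<Rightarrow> tar i (FM x \<alpha>) \<beta>"
  let ?m' = "\<lambda>m. case m of tar i \<alpha> \<beta> \<Rightarrow>
        tar (FO (the_fct (Idn Cat (FO x (Dom (Src x) \<alpha>)))) i) (FM x \<alpha>)
            (FM (the_fct (Idn Cat (FO x (Cod (Src x) \<alpha>)))) \<beta>)"
  have "restrict (\<lambda>z. case z of tob u i \<Rightarrow> tob (FO x u) i) (Ob (tot x)) =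
      restrict (\<lambda>z. case z of tob u i \<Rightarrow> tob (FO x u) (FO (the_fct (Idn Cat (FO x u))) i)) (Ob (tot x))"
    by (rule restrict_ext) (auto elim!: Ob_totE simp: the_fct_Idn_Cat)
  moreover have "restrict ?m (Ar (tot x)) = restrict ?m' (Ar (tot x))"
    by (rule restrict_ext) (auto elim!: Ar_totE simp: the_fct_Idn_Cat)
  ultimately show ?thesis by (simp add: proj_F_def reindex_def mk_fct_def Fcat_def)
qed

lemma proj_F_sel [simp]:
  fixes x :: "('s, 'u) mfct"
  shows "Src (proj_F x) = tot x" "Tgt (proj_F x) = Fcat"
  "tob u i \<in> Ob (tot x) \<Longrightarrow> FO (proj_F x) (tob u i) = tob (FO x u) i"
  "tar i \<alpha> \<beta> \<in> Ar (tot x) \<Longrightarrow> FM (proj_F x) (tar i \<alpha> \<beta>) = tar i (FM x \<alpha>) \<beta>"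
  by (simp_all add: proj_F_def)

lemma split_pullback_proj_F:
  assumes x [simp]: "diag x"
  shows "split_pullback (proj_F x) x (proj x) p_fct (lifts x) (lifts (id_fct Cat))"
proof -
  interpret reindexing x x "id_fct Cat" "\<lambda>u. Idn Cat (FO x u)"
    using nat_iso_refl[of x] by unfold_locales simp_all
  show ?thesis using split_pullback_reindex by (simp add: proj_F_eq p_fct_def)
qed

lemma is_functor_proj_F [simp]: "diag x \<Longrightarrow> is_functor (proj_F x)"
  using split_pullbackD(1)[OF split_pullback_proj_F] .

text \<open>The components are the arrows \<open>(\<phi>\<^sub>u, id)\<close> of the universal opfibration, so this is a case of
  \<open>reindex_change\<close>, with \<open>\<phi>\<close> as the isomorphism between the base functors.\<close>

lemma proj_F_reindex:
  fixes x :: "('s, 'u) mfct"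
  assumes y [simp]: "diag y" and h [simp]: "is_functor h" "Tgt h = Src y" and \<phi>: "nat_iso x (y \<circ>\<^sub>F h) \<phi>"
  shows "proj_F x \<cong>\<^sub>F proj_F y \<circ>\<^sub>F reindex h x y \<phi>"
proof -
  interpret A: reindexing h x y \<phi> using \<phi> by unfold_locales simp_all
  let ?\<psi> = "\<lambda>u. Cmp Cat (FM (id_fct Cat) (\<phi> u)) (Idn Cat (FO x u))"
  note c = reindex_change[OF diag_id_Cat nat_iso_x_id \<phi>, OF A.x(1), simplified]
  interpret B: reindexing "y \<circ>\<^sub>F h" x "id_fct Cat" ?\<psi>
    using c(1) by unfold_locales simp_all
  have \<psi>: "?\<psi> u = \<phi> u" if "u \<in> Ob (Src x)" for u
    using nat_isoD(5,7)[OF \<phi>, of u] that by simp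
  have "reindex (y \<circ>\<^sub>F h) x (id_fct Cat) ?\<psi> = proj_F y \<circ>\<^sub>F reindex h x y \<phi>"
  proof (rule fct_eqI)
    fix z assume "z \<in> Ob (Src (proj_F y \<circ>\<^sub>F reindex h x y \<phi>))"
    then obtain u i where "z = tob u i" "u \<in> Ob (Src x)" "i \<in> Ob (fib x u)" by (auto elim!: Ob_totE)
    then show "FO (reindex (y \<circ>\<^sub>F h) x (id_fct Cat) ?\<psi>) z = FO (proj_F y \<circ>\<^sub>F reindex h x y \<phi>) z"
      using B.reindex_sel(3)[of u i] \<psi>[of u] by simp
  next
    fix m assume "m \<in> Ar (Src (proj_F y \<circ>\<^sub>F reindex h x y \<phi>))"
    then obtain i \<alpha> \<beta> where "m = tar i \<alpha> \<beta>" "\<alpha> \<in> Ar (Src x)" "i \<in> Ob (fib x (Dom (Src x) \<alpha>))"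
      "\<beta> \<in> Ar (fib x (Cod (Src x) \<alpha>))" "Dom (fib x (Cod (Src x) \<alpha>)) \<beta> = FO (tra x \<alpha>) i"
      by (auto elim!: Ar_totE)
    then show "FM (reindex (y \<circ>\<^sub>F h) x (id_fct Cat) ?\<psi>) m = FM (proj_F y \<circ>\<^sub>F reindex h x y \<phi>) m"
      using B.reindex_sel(4)[of i \<alpha> \<beta>] \<psi>[of "Dom (Src x) \<alpha>"] \<psi>[of "Cod (Src x) \<alpha>"]
      by (simp add: A.component_nat)
  next
    show "is_functor (reindex (y \<circ>\<^sub>F h) x (id_fct Cat) ?\<psi>)" by (rule B.is_functor_reindex)
    show "is_functor (proj_F y \<circ>\<^sub>F reindex h x y \<phi>)" by simp
    show "Src (reindex (y \<circ>\<^sub>F h) x (id_fct Cat) ?\<psi>) = Src (proj_F y \<circ>\<^sub>F reindex h x y \<phi>)"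
      unfolding B.reindex_sel(1) by simp
    show "Tgt (reindex (y \<circ>\<^sub>F h) x (id_fct Cat) ?\<psi>) = Tgt (proj_F y \<circ>\<^sub>F reindex h x y \<phi>)"
      unfolding B.reindex_sel(2) by (simp add: Fcat_def)
  qed
  then show ?thesis using c(2) by (simp add: proj_F_eq)
qed

text \<open>Both sides are the pullback of the opfibrations of \<open>x\<close> and \<open>y\<close>, listed in different orders.\<close>

lemma split_pullback_switch:
  assumes x [simp]: "diag x" and y [simp]: "diag y" and S [simp]: "Src y = Src x"
  shows "split_pullback (switch_fct x y) (id_fct (Src x)) (proj x \<circ>\<^sub>F proj (y \<circ>\<^sub>F proj x)) (proj y \<circ>\<^sub>F proj (x \<circ>\<^sub>F proj y))
     (comp_lift (lifts x) (proj (y \<circ>\<^sub>F proj x)) (lifts (y \<circ>\<^sub>F proj x)))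
     (comp_lift (lifts y) (proj (x \<circ>\<^sub>F proj y)) (lifts (x \<circ>\<^sub>F proj y)))"
proof -
  let ?c = "y \<circ>\<^sub>F proj x" and ?d = "x \<circ>\<^sub>F proj y"
  interpret c: pair x ?c by unfold_locales simp_all
  interpret d: pair y ?d by unfold_locales simp_all
  have ycat [simp]: "u \<in> Ob (Src x) \<Longrightarrow> category (fib y u)" for u using fib_category[of y u] by simp
  note tray [simp] = tra_FO[OF y, unfolded S] tra_FM[OF y, unfolded S] tra_Dom[OF y, unfolded S] tra_Cod[OF y, unfolded S]
  let ?o = "\<lambda>z. case z of tob (tob u i) j \<Rightarrow> tob (tob u j) i"
  let ?m = "\<lambda>m. case m of tar j (tar i \<alpha> \<beta>) \<delta> \<Rightarrow> tar i (tar j \<alpha> \<delta>) \<beta>"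
  have sel [simp]: "Src (switch_fct x y) = tot ?c" "Tgt (switch_fct x y) = tot ?d"
    "z \<in> Ob (tot ?c) \<Longrightarrow> FO (switch_fct x y) z = ?o z" "m \<in> Ar (tot ?c) \<Longrightarrow> FM (switch_fct x y) m = ?m m" for z m
    by (simp_all add: switch_fct_def)
  have [simp]: "is_functor (switch_fct x y)"
    unfolding switch_fct_def
  proof (rule is_functor_mk_fct)
    fix m n assume "m \<in> Ar (tot ?c)" "n \<in> Ar (tot ?c)" "Dom (tot ?c) n = Cod (tot ?c) m"
    then show "?m (Cmp (tot ?c) n m) = Cmp (tot ?d) (?m n) (?m m)"
      by (elim c.Ar_tot_fE) simp
  qed (auto elim!: c.Ob_tot_fE c.Ar_tot_fE)
  have "split_pullback (switch_fct x y) (id_fct (Tgt (proj x \<circ>\<^sub>F proj ?c))) (proj x \<circ>\<^sub>F proj ?c) (proj y \<circ>\<^sub>F proj ?d)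
     (lifts2 x ?c) (lifts2 y ?d)"
  proof (rule split_pullback_idI)
    show "bij_betw (FO (switch_fct x y)) (Ob (Src (proj x \<circ>\<^sub>F proj ?c))) (Ob (Src (proj y \<circ>\<^sub>F proj ?d)))"
      by (rule bij_betw_byWitness[where f' = ?o]) (auto elim!: c.Ob_tot_fE d.Ob_tot_fE)
    show "bij_betw (FM (switch_fct x y)) (Ar (Src (proj x \<circ>\<^sub>F proj ?c))) (Ar (Src (proj y \<circ>\<^sub>F proj ?d)))"
      by (rule bij_betw_byWitness[where f' = ?m]) (auto elim!: c.Ar_tot_fE d.Ar_tot_fE)
  next
    fix \<alpha> e assume "\<alpha> \<in> Ar (Tgt (proj x \<circ>\<^sub>F proj ?c))" "e \<in> Ob (Src (proj x \<circ>\<^sub>F proj ?c))"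
      "FO (proj x \<circ>\<^sub>F proj ?c) e = Dom (Tgt (proj x \<circ>\<^sub>F proj ?c)) \<alpha>"
    then show "FM (switch_fct x y) (lifts2 x ?c \<alpha> e) =
        lifts2 y ?d \<alpha> (FO (switch_fct x y) e)"
      by (auto elim!: c.Ob_tot_fE simp: comp_lift_def lift_def)
  qed (auto elim!: c.Ob_tot_fE c.Ar_tot_fE)
  then show ?thesis by simp
qed

lemma proj_switch:
  assumes x [simp]: "diag x" and y [simp]: "diag y" and S [simp]: "Src y = Src x"
  shows "is_functor (switch_fct x y)" "Src (switch_fct x y) = tot (y \<circ>\<^sub>F proj x)"
    "Tgt (switch_fct x y) = tot (x \<circ>\<^sub>F proj y)"
  using split_pullbackD(1,5,6)[OF split_pullback_switch[OF assms]] by simp_all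

section \<open>The category hCAT\<close>

locale hcat =
  fixes Sk :: "('s, 'u) mfct set"
    and \<nu> :: "('s, 'u) mfct \<Rightarrow> ('s, 'u) moderate \<Rightarrow> ('s, 'u) moderate"
  assumes kappa0: "strongly_inaccessible |UNIV :: 's set|"
    and kappa1: "strongly_inaccessible |UNIV :: 'u set|"
    and kappa_less: "|UNIV :: 's set| <o |UNIV :: 'u set|"
    and skeleton: "functor_skeleton Sk"
    and comparison: "\<And>G. G \<in> ModFcts \<Longrightarrow> nat_iso G (Ho Sk G) (\<nu> G)"
begin

lemma small_less: "|UNIV :: 's small set| <o |UNIV :: 'u set|"
  using card_small_le[OF inacc_infinite[OF kappa0]] kappa_less by (rule ordLeq_ordLess_trans)

lemma Cat_moderate [simp]: "(Cat :: ('s, 'u) mcat) \<in> ModCats"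
proof -
  have "|UNIV :: 's scat set| <o |UNIV :: 'u set|" "|UNIV :: 's sfct set| <o |UNIV :: 'u set|"
    using inacc_cat[OF refl kappa1 small_less] inacc_fct[OF refl kappa1 small_less] by simp_all
  then have "|Ob (Cat :: ('s, 'u) mcat)| <o |UNIV :: 'u set|" "|Ar (Cat :: ('s, 'u) mcat)| <o |UNIV :: 'u set|"
    unfolding Cat_sel by (auto intro: card_image_less card_subset_less)
  then show ?thesis using category_Cat unfolding ModCats_def smaller_than_def by blast
qed

lemma tot_moderate [simp]:
  fixes x :: "('s, 'u) mfct"
  assumes x: "diag x" and U: "Src x \<in> ModCats"
  shows "tot x \<in> ModCats"
proof -
  let ?r = "|UNIV :: 'u set|"
  have U': "|Ob (Src x)| <o ?r" "|Ar (Src x)| <o ?r"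
    using U unfolding ModCats_def smaller_than_def by blast+
  have c: "|Ob (Src x) \<times> (UNIV :: 's small set)| <o ?r" "|Ar (Src x) \<times> (UNIV :: 's small set)| <o ?r"
    by (rule inacc_Sigma[OF kappa1]; rule U' small_less)+
  have "|(UNIV :: 's small set) \<times> (Ar (Src x) \<times> (UNIV :: 's small set))| <o ?r"
    by (rule inacc_Sigma[OF kappa1 small_less c(2)])
  note 1 = card_image_less[OF c(1), of "\<lambda>(u, i). tob u i"] and
    2 = card_image_less[OF this, of "\<lambda>(i, \<alpha>, \<beta>). tar i \<alpha> \<beta>"]
  have "|Ob (tot x)| <o ?r" by (rule card_subset_less[OF 1]) (auto simp: Ob_tot)
  moreover have "|Ar (tot x)| <o ?r" by (rule card_subset_less[OF 2]) (auto simp: Ar_tot image_iff)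
  ultimately show ?thesis using category_tot[OF x] unfolding ModCats_def smaller_than_def by blast
qed

lemma one_moderate [simp]: "(one_mcat :: ('s, 'u) mcat) \<in> ModCats"
proof -
  have "category (one_mcat :: ('s, 'u) mcat)"
    unfolding one_mcat_def one_cat_def by (rule category_mk_cat) simp_all
  moreover have "|{a}| <o |UNIV :: 'u set|" for a :: "('s, 'u) moderate"
    using inacc_infinite[OF kappa1]
    by (metis card_of_ordLeq_finite finite.emptyI finite.insertI not_ordLeq_iff_ordLess card_of_Well_order)
  ultimately show ?thesis by (simp add: ModCats_def smaller_than_def one_mcat_def one_cat_def)
qed

lemma ModCats_category: "C \<in> ModCats \<Longrightarrow> category C"
  unfolding ModCats_def by blast

text \<open>Equations in hCAT are proved by exhibiting, for both sides, isomorphic functors that give them;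
  the functors may be composed strictly.\<close>

definition given_by :: "('s, 'u) mfct \<Rightarrow> ('s, 'u) mfct \<Rightarrow> bool" where
  "given_by g G \<longleftrightarrow> g \<in> Sk \<and> g \<cong>\<^sub>F G"

lemma Sk_facts [simp]:
  assumes "g \<in> Sk"
  shows "is_functor g" "Src g \<in> ModCats" "Tgt g \<in> ModCats" "g \<in> ModFcts"
  using assms skeleton unfolding functor_skeleton_def ModFcts_def by blast+

lemma ModFctsI: "is_functor G \<Longrightarrow> Src G \<in> ModCats \<Longrightarrow> Tgt G \<in> ModCats \<Longrightarrow> G \<in> ModFcts"
  by (simp add: ModFcts_def)

lemma given_by_Ho: assumes "G \<in> ModFcts" shows "given_by (Ho Sk G) G"
proof -
  have "\<exists>!H. H \<in> Sk \<and> G \<cong>\<^sub>F H" using assms skeleton unfolding functor_skeleton_def by blast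
  from theI'[OF this] show ?thesis unfolding Ho_def given_by_def using iso_fct_sym by blast
qed

lemma given_by_HoI: "is_functor G \<Longrightarrow> Src G \<in> ModCats \<Longrightarrow> Tgt G \<in> ModCats \<Longrightarrow> given_by (Ho Sk G) G"
  by (simp add: ModFctsI given_by_Ho)

lemma given_by_self: "g \<in> Sk \<Longrightarrow> given_by g g"
  by (simp add: given_by_def iso_fct_refl)

lemma given_by_unique:
  assumes "given_by g G" "given_by g' G'" "G \<cong>\<^sub>F G'"
  shows "g = g'"
proof -
  have "g \<cong>\<^sub>F g'" using assms iso_fct_trans iso_fct_sym unfolding given_by_def by blast
  moreover have "g \<cong>\<^sub>F g" using assms(1) given_by_self unfolding given_by_def by blast
  moreover have "\<exists>!H. H \<in> Sk \<and> g \<cong>\<^sub>F H"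
    using assms(1) skeleton Sk_facts(4) unfolding functor_skeleton_def given_by_def by blast
  ultimately show ?thesis using assms unfolding given_by_def by blast
qed

lemma given_byD:
  assumes "given_by g G"
  shows "g \<in> Sk" "g \<cong>\<^sub>F G" "G \<cong>\<^sub>F g" "is_functor G" "Src g = Src G" "Tgt g = Tgt G" "Src G \<in> ModCats" "Tgt G \<in> ModCats"
proof -
  show 1: "g \<in> Sk" "g \<cong>\<^sub>F G" using assms by (simp_all add: given_by_def)
  then show 2: "G \<cong>\<^sub>F g" "is_functor G" "Src g = Src G" "Tgt g = Tgt G"
    using iso_fctD iso_fct_sym by blast+
  show "Src G \<in> ModCats" "Tgt G \<in> ModCats" using Sk_facts(2,3)[OF 1(1)] 2 by simp_all
qed

lemma given_by_eq: "given_by g G \<Longrightarrow> given_by g' G \<Longrightarrow> g = g'"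
  using given_by_unique given_byD(4) iso_fct_refl by blast

lemma given_by_iso: "given_by g G \<Longrightarrow> G \<cong>\<^sub>F G' \<Longrightarrow> given_by g G'"
  unfolding given_by_def using iso_fct_trans by blast

abbreviation "I \<equiv> hCAT Sk"

abbreviation (input) "pr x \<equiv> Ho Sk (proj x)"

lemma hCAT_sel [simp]:
  "Ob I = ModCats" "Ar I = Sk" "g \<in> Sk \<Longrightarrow> Dom I g = Src g" "g \<in> Sk \<Longrightarrow> Cod I g = Tgt g"
  "C \<in> ModCats \<Longrightarrow> Idn I C = Ho Sk (id_fct C)"
  by (simp_all add: hCAT_def)

lemma hom_hCAT [simp]: "g \<in> hom I a b \<longleftrightarrow> g \<in> Sk \<and> Src g = a \<and> Tgt g = b"
  by (auto simp: hom_def)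

lemma Cmp_hCAT: "g \<in> Sk \<Longrightarrow> f \<in> Sk \<Longrightarrow> Src g = Tgt f \<Longrightarrow> Cmp I g f = Ho Sk (g \<circ>\<^sub>F f)"
  by (simp add: hCAT_def)

lemma given_by_Cmp:
  assumes g: "given_by g G" and f: "given_by f F" and S: "Src G = Tgt F"
  shows "given_by (Cmp I g f) (G \<circ>\<^sub>F F)"
proof -
  note A = given_byD[OF g] and B = given_byD[OF f]
  have "given_by (Ho Sk (g \<circ>\<^sub>F f)) (g \<circ>\<^sub>F f)"
    using A B S by (intro given_by_HoI) simp_all
  moreover have "g \<circ>\<^sub>F f \<cong>\<^sub>F G \<circ>\<^sub>F F" using A B S by (intro iso_fct_cmp) simp_all
  ultimately show ?thesis using A B S by (simp add: Cmp_hCAT given_by_iso)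
qed

lemma given_by_Idn: "C \<in> ModCats \<Longrightarrow> given_by (Idn I C) (id_fct C)"
  by (simp add: given_by_HoI ModCats_category)

lemma category_hCAT: "category I"
  unfolding hCAT_def
proof (rule category_mk_cat)
  fix C :: "('s, 'u) mcat" assume C: "C \<in> ModCats"
  show "Ho Sk (id_fct C) \<in> Sk \<and> Src (Ho Sk (id_fct C)) = C \<and> Tgt (Ho Sk (id_fct C)) = C"
    using given_byD[OF given_by_Idn[OF C]] C by simp
next
  fix f g assume a: "f \<in> Sk" "g \<in> Sk" "Src g = Tgt f"
  show "Ho Sk (g \<circ>\<^sub>F f) \<in> Sk \<and> Src (Ho Sk (g \<circ>\<^sub>F f)) = Src f \<and> Tgt (Ho Sk (g \<circ>\<^sub>F f)) = Tgt g"
    using given_byD[OF given_by_Cmp[OF given_by_self[OF a(2)] given_by_self[OF a(1)] a(3)]] a by (simp add: Cmp_hCAT)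
next
  fix f assume f: "f \<in> Sk"
  have s: "Src f \<in> ModCats" "Tgt f \<in> ModCats" using f by simp_all
  note i = given_byD[OF given_by_Idn[OF s(1)]] given_byD[OF given_by_Idn[OF s(2)]]
  have "given_by (Cmp I f (Idn I (Src f))) (f \<circ>\<^sub>F id_fct (Src f))" "given_by (Cmp I (Idn I (Tgt f)) f) (id_fct (Tgt f) \<circ>\<^sub>F f)"
    using given_by_Cmp[OF given_by_self[OF f] given_by_Idn[OF s(1)]] given_by_Cmp[OF given_by_Idn[OF s(2)] given_by_self[OF f]] by simp_all
  then have "given_by (Cmp I f (Idn I (Src f))) f" "given_by (Cmp I (Idn I (Tgt f)) f) f" using f by simp_all
  then have "Cmp I f (Idn I (Src f)) = f" "Cmp I (Idn I (Tgt f)) f = f" using given_by_eq given_by_self[OF f] by blast+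
  then show "Ho Sk (f \<circ>\<^sub>F Ho Sk (id_fct (Src f))) = f \<and> Ho Sk (Ho Sk (id_fct (Tgt f)) \<circ>\<^sub>F f) = f"
    using f i s by (simp add: Cmp_hCAT)
next
  fix f g h assume a: "f \<in> Sk" "g \<in> Sk" "h \<in> Sk" "Src g = Tgt f" "Src h = Tgt g"
  have 1: "given_by (Cmp I g f) (g \<circ>\<^sub>F f)" "given_by (Cmp I h g) (h \<circ>\<^sub>F g)"
    using a by (intro given_by_Cmp given_by_self; simp)+
  have "given_by (Cmp I h (Cmp I g f)) (h \<circ>\<^sub>F (g \<circ>\<^sub>F f))" "given_by (Cmp I (Cmp I h g) f) (h \<circ>\<^sub>F g \<circ>\<^sub>F f)"
    by (rule given_by_Cmp; simp add: a given_by_self 1)+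
  then have "Cmp I h (Cmp I g f) = Cmp I (Cmp I h g) f"
    using a by (simp add: cmp_fct_assoc) (rule given_by_eq)
  then show "Ho Sk (h \<circ>\<^sub>F Ho Sk (g \<circ>\<^sub>F f)) = Ho Sk (Ho Sk (h \<circ>\<^sub>F g) \<circ>\<^sub>F f)"
    using a given_byD[OF 1(1)] given_byD[OF 1(2)] by (simp add: Cmp_hCAT)
qed simp_all

lemma hom_Cat:
  assumes "x \<in> hom I U Cat"
  shows "x \<in> Sk" "diag x" "Src x = U" "U \<in> ModCats"
  using assms Sk_facts[of x] by (auto simp: diag_def simp del: diagD)

lemma given_by_proj: "diag x \<Longrightarrow> Src x \<in> ModCats \<Longrightarrow> given_by (pr x) (proj x)"
  by (intro given_by_HoI) simp_all

lemma Fcat_moderate [simp]: "(Fcat :: ('s, 'u) mcat) \<in> ModCats"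
  unfolding Fcat_def by (rule tot_moderate) simp_all

lemma given_by_proj_F: "diag x \<Longrightarrow> Src x \<in> ModCats \<Longrightarrow> given_by (Ho Sk (proj_F x)) (proj_F x)"
  by (intro given_by_HoI) simp_all

lemma given_by_p: "given_by (Ho Sk p_fct) p_fct"
  by (intro given_by_HoI) simp_all

lemma p_proj_F: "diag x \<Longrightarrow> p_fct \<circ>\<^sub>F proj_F x = x \<circ>\<^sub>F proj x"
  using split_pullbackD(9,10)[OF split_pullback_proj_F[of x]] by (intro fct_eqI) simp_all

lemma diag_p [simp]: "diag p_fct"
  by (simp add: diag_def del: diagD)

text \<open>The mediating functor depends on the isomorphism that fills the given square. Its existence, but not
  the isomorphism itself, can be seen in hCAT, and therefore the pullback is only weak.\<close>

lemma weak_pullback_tot: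
  assumes x: "x \<in> hom I U Cat"
  shows "weak_pullback I x (Ho Sk p_fct) (tot x) (pr x) (Ho Sk (proj_F x))"
proof -
  note X [simp] = hom_Cat[OF x]
  note P = given_by_proj[OF X(2), unfolded X(3), OF X(4)] and PF = given_by_proj_F[OF X(2), unfolded X(3), OF X(4)]
  note D = given_byD[OF P] given_byD[OF PF] given_byD[OF given_by_p]
  have "given_by (Cmp I x (pr x)) (x \<circ>\<^sub>F proj x)" by (rule given_by_Cmp[OF given_by_self P]) simp_all
  moreover have "given_by (Cmp I (Ho Sk p_fct) (Ho Sk (proj_F x))) (p_fct \<circ>\<^sub>F proj_F x)"
    by (rule given_by_Cmp[OF given_by_p PF]) simp_all
  ultimately have "Cmp I x (pr x) = Cmp I (Ho Sk p_fct) (Ho Sk (proj_F x))"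
    unfolding p_proj_F[OF X(2)] by (rule given_by_eq)
  then have "cone_over I x (Ho Sk p_fct) (tot x) (pr x) (Ho Sk (proj_F x))"
    using D by (simp add: cone_over_def)
  moreover have "\<exists>w. w \<in> hom I T (tot x) \<and> Cmp I (pr x) w = c \<and> Cmp I (Ho Sk (proj_F x)) w = d"
    if "cone_over I x (Ho Sk p_fct) T c d" for T c d
  proof -
    have [simp]: "T \<in> ModCats" "c \<in> Sk" "Src c = T" "Tgt c = U" "d \<in> Sk" "Src d = T" "Tgt d = Fcat"
      and e: "Cmp I x c = Cmp I (Ho Sk p_fct) d"
      using that D by (simp_all add: cone_over_def)
    have a: "given_by (Cmp I x c) (x \<circ>\<^sub>F c)" "given_by (Cmp I (Ho Sk p_fct) d) (p_fct \<circ>\<^sub>F d)"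
      by (rule given_by_Cmp; simp add: given_by_self given_by_p)+
    have "p_fct \<circ>\<^sub>F d \<cong>\<^sub>F x \<circ>\<^sub>F c" by (rule iso_fct_trans[OF given_byD(3)[OF a(2)] given_byD(2)[OF a(1)[unfolded e]]])
    then obtain \<theta> where \<theta>: "nat_iso (p_fct \<circ>\<^sub>F d) (x \<circ>\<^sub>F c) \<theta>" by (auto simp: iso_fct_def)
    let ?e = "p_fct \<circ>\<^sub>F d"
    have de [simp]: "diag ?e" by (rule diag_cmp) simp_all
    interpret R: reindexing c ?e x \<theta> using \<theta> by unfold_locales simp_all
    let ?R = "reindex c ?e x \<theta>"
    \<comment> \<open>The second component of \<open>d\<close> is a section of the total category of \<open>p \<circ> d\<close>.\<close>
    obtain s where s [simp]: "is_functor s" "Src s = T" "Tgt s = tot ?e"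
      "proj ?e \<circ>\<^sub>F s = id_fct T" "proj_F ?e \<circ>\<^sub>F s = d"
      by (rule split_pullback_universal[OF split_pullback_proj_F[OF de], of d "id_fct T"]) (simp_all add: ModCats_category)
    have pR: "proj x \<circ>\<^sub>F ?R = c \<circ>\<^sub>F proj ?e"
      using split_pullbackD(9,10)[OF R.split_pullback_reindex] by (intro fct_eqI) simp_all
    have "proj x \<circ>\<^sub>F (?R \<circ>\<^sub>F s) = c \<circ>\<^sub>F (proj ?e \<circ>\<^sub>F s)"
      by (simp add: cmp_fct_assoc pR del: s(4))
    then have 1: "proj x \<circ>\<^sub>F (?R \<circ>\<^sub>F s) = c" by simp
    have "proj_F ?e \<cong>\<^sub>F proj_F x \<circ>\<^sub>F ?R" using \<theta> by (intro proj_F_reindex) simp_all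
    then have "proj_F ?e \<circ>\<^sub>F s \<cong>\<^sub>F proj_F x \<circ>\<^sub>F ?R \<circ>\<^sub>F s" by (rule iso_fct_cmp) (simp_all add: iso_fct_refl)
    then have 2: "d \<cong>\<^sub>F proj_F x \<circ>\<^sub>F (?R \<circ>\<^sub>F s)" by (simp add: cmp_fct_assoc)
    have w: "given_by (Ho Sk (?R \<circ>\<^sub>F s)) (?R \<circ>\<^sub>F s)" by (rule given_by_HoI) simp_all
    have "given_by (Cmp I (pr x) (Ho Sk (?R \<circ>\<^sub>F s))) (proj x \<circ>\<^sub>F (?R \<circ>\<^sub>F s))"
      "given_by (Cmp I (Ho Sk (proj_F x)) (Ho Sk (?R \<circ>\<^sub>F s))) (proj_F x \<circ>\<^sub>F (?R \<circ>\<^sub>F s))"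
      by (rule given_by_Cmp[OF P w] given_by_Cmp[OF PF w]; simp)+
    then have "Cmp I (pr x) (Ho Sk (?R \<circ>\<^sub>F s)) = c" "Cmp I (Ho Sk (proj_F x)) (Ho Sk (?R \<circ>\<^sub>F s)) = d"
      unfolding 1 using given_by_eq[OF _ given_by_self[of c]] given_by_unique[OF given_by_self[of d] _ 2, symmetric] by simp_all
    then show ?thesis using given_byD[OF w] by auto
  qed
  ultimately show ?thesis unfolding weak_pullback_def by blast
qed

end

section \<open>Base change and sums in hCAT\<close>

context hcat
begin

lemma h_base_changeE:
  assumes w: "w \<in> h_base_change Sk h y" and h: "h \<in> hom I U U'" and y: "y \<in> hom I U' Cat"
  obtains \<phi> where "nat_iso (Cmp I y h) (y \<circ>\<^sub>F h) \<phi>" "given_by w (reindex h (Cmp I y h) y \<phi>)"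
    "reindexing h (Cmp I y h) y \<phi>"
proof -
  note Y = hom_Cat[OF y]
  have h': "h \<in> Sk" "Src h = U" "Tgt h = U'" using h by simp_all
  have e: "Cmp I y h = Ho Sk (y \<circ>\<^sub>F h)" using Y h' by (simp add: Cmp_hCAT)
  obtain \<phi> where \<phi>: "nat_iso (Cmp I y h) (y \<circ>\<^sub>F h) \<phi>" "w = Ho Sk (reindex h (Cmp I y h) y \<phi>)"
    using w unfolding h_base_change_def Let_def e by blast
  interpret R: reindexing h "Cmp I y h" y \<phi> using \<phi> Y h' by unfold_locales simp_all
  have "given_by w (reindex h (Cmp I y h) y \<phi>)"
    unfolding \<phi>(2) using Y h' R.x Sk_facts(2)[OF h'(1)] by (intro given_by_HoI) simp_all
  then show ?thesis using that \<phi>(1) R.reindexing_axioms by blast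
qed

lemma h_base_changeI:
  assumes h: "h \<in> hom I U U'" and y: "y \<in> hom I U' Cat" and \<phi>: "nat_iso (Cmp I y h) (y \<circ>\<^sub>F h) \<phi>"
  obtains w where "w \<in> h_base_change Sk h y" "given_by w (reindex h (Cmp I y h) y \<phi>)"
proof -
  note Y = hom_Cat[OF y]
  have h': "h \<in> Sk" "Src h = U" "Tgt h = U'" using h by simp_all
  have e: "Cmp I y h = Ho Sk (y \<circ>\<^sub>F h)" using Y h' by (simp add: Cmp_hCAT)
  interpret R: reindexing h "Cmp I y h" y \<phi> using \<phi> Y h' by unfold_locales simp_all
  have "given_by (Ho Sk (reindex h (Cmp I y h) y \<phi>)) (reindex h (Cmp I y h) y \<phi>)"
    using Y h' R.x Sk_facts(2)[OF h'(1)] by (intro given_by_HoI) simp_all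
  moreover have "Ho Sk (reindex h (Cmp I y h) y \<phi>) \<in> h_base_change Sk h y"
    unfolding h_base_change_def Let_def e[symmetric] using \<phi> by blast
  ultimately show ?thesis using that by blast
qed

lemma given_by_nat_iso:
  assumes "given_by g G" obtains \<phi> where "nat_iso g G \<phi>"
  using given_byD(2)[OF assms] unfolding iso_fct_def by blast

lemma Cmp_Cat:
  assumes h: "h \<in> hom I U U'" and y: "y \<in> hom I U' Cat"
  shows "Cmp I y h \<in> hom I U Cat" "given_by (Cmp I y h) (y \<circ>\<^sub>F h)"
proof -
  note Y = hom_Cat[OF y]
  have h': "h \<in> Sk" "Src h = U" "Tgt h = U'" using h by simp_all
  show r: "given_by (Cmp I y h) (y \<circ>\<^sub>F h)" using Y h' by (intro given_by_Cmp given_by_self) simp_all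
  show "Cmp I y h \<in> hom I U Cat" using given_byD[OF r] Y h' by simp
qed

lemma base_change_hCAT:
  assumes h: "h \<in> hom I U U'" and y: "y \<in> hom I U' Cat" and w: "w \<in> h_base_change Sk h y"
  shows "w \<in> hom I (tot (Cmp I y h)) (tot y)"
    "Cmp I (pr y) w = Cmp I h (pr (Cmp I y h))"
    "Cmp I (Ho Sk (proj_F y)) w = Ho Sk (proj_F (Cmp I y h))"
proof -
  obtain \<phi> where \<phi>: "nat_iso (Cmp I y h) (y \<circ>\<^sub>F h) \<phi>" and w': "given_by w (reindex h (Cmp I y h) y \<phi>)"
    and "reindexing h (Cmp I y h) y \<phi>" by (rule h_base_changeE[OF w h y])
  then interpret R: reindexing h "Cmp I y h" y \<phi> by simp
  let ?x = "Cmp I y h"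
  note Y = hom_Cat[OF y] and X = hom_Cat[OF Cmp_Cat(1)[OF h y]]
  have h': "h \<in> Sk" "Src h = U" "Tgt h = U'" using h by simp_all
  have P: "given_by (pr y) (proj y)" "given_by (Ho Sk (proj_F y)) (proj_F y)" "given_by (pr ?x) (proj ?x)"
    "given_by (Ho Sk (proj_F ?x)) (proj_F ?x)"
    by (rule given_by_proj given_by_proj_F; simp add: X Y)+
  show "w \<in> hom I (tot ?x) (tot y)" using given_byD[OF w'] by simp
  have "given_by (Cmp I (pr y) w) (proj y \<circ>\<^sub>F reindex h ?x y \<phi>)" by (rule given_by_Cmp[OF P(1) w']) simp
  moreover have "given_by (Cmp I h (pr ?x)) (h \<circ>\<^sub>F proj ?x)"
    by (rule given_by_Cmp[OF given_by_self P(3)]) (simp_all add: h')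
  moreover have "proj y \<circ>\<^sub>F reindex h ?x y \<phi> = h \<circ>\<^sub>F proj ?x"
    using split_pullbackD(9,10)[OF R.split_pullback_reindex] by (intro fct_eqI) simp_all
  ultimately show "Cmp I (pr y) w = Cmp I h (pr ?x)" using given_by_eq by metis
  have "given_by (Cmp I (Ho Sk (proj_F y)) w) (proj_F y \<circ>\<^sub>F reindex h ?x y \<phi>)" by (rule given_by_Cmp[OF P(2) w']) simp
  then show "Cmp I (Ho Sk (proj_F y)) w = Ho Sk (proj_F ?x)"
    using proj_F_reindex[OF R.y R.h \<phi>] given_by_unique[OF P(4)] by metis
qed

text \<open>The functor whose representative is \<open>h_flat Sk \<nu> x f\<close>. It satisfies strictly the equations
  that the representative satisfies up to isomorphism.\<close>

definition strict_flat :: "('s, 'u) mfct \<Rightarrow> ('s, 'u) mfct \<Rightarrow> ('s, 'u) mfct" where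
  "strict_flat x f = relabel (sum_fct x f) (h_sum Sk x f) (\<nu> (sum_fct x f)) \<circ>\<^sub>F flat_fct x f"

lemma sum_moderate:
  fixes x f :: "('s, 'u) mfct"
  assumes X: "diag x" "Src x \<in> ModCats" and F: "diag f" "Src f = tot x"
  shows "diag (sum_fct x f)" "Src (sum_fct x f) = Src x" "sum_fct x f \<in> ModFcts"
proof -
  interpret pair x f using X F by unfold_locales simp_all
  show "diag (sum_fct x f)" by (rule diag_sum[OF kappa0])
  then show "Src (sum_fct x f) = Src x" "sum_fct x f \<in> ModFcts" using X by (simp_all add: ModFctsI)
qed

lemma h_sum:
  assumes x: "x \<in> hom I U Cat" and f: "f \<in> hom I (tot x) Cat"
  shows "h_sum Sk x f \<in> hom I U Cat" "given_by (h_sum Sk x f) (sum_fct x f)"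
    and "nat_iso (sum_fct x f) (h_sum Sk x f) (\<nu> (sum_fct x f))"
proof -
  note X = hom_Cat[OF x] and F = hom_Cat[OF f]
  have S: "diag (sum_fct x f)" "Src (sum_fct x f) = Src x" "sum_fct x f \<in> ModFcts"
    using sum_moderate[of x f] X F by simp_all
  show r: "given_by (h_sum Sk x f) (sum_fct x f)" unfolding h_sum_def by (rule given_by_Ho[OF S(3)])
  show "h_sum Sk x f \<in> hom I U Cat" using given_byD[OF r] S X by simp
  show "nat_iso (sum_fct x f) (h_sum Sk x f) (\<nu> (sum_fct x f))"
    unfolding h_sum_def by (rule comparison[OF S(3)])
qed

text \<open>The representative of a sum represents the same split opfibration as the sum, through the relabelled
  flattening.\<close>

lemma h_sum_represents:
  assumes x: "x \<in> hom I U Cat" and f: "f \<in> hom I (tot x) Cat"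
    and r: "represents Q N f F" and T: "Tgt Q = tot x"
  shows "represents (proj x \<circ>\<^sub>F Q) (comp_lift (lifts x) Q N) (h_sum Sk x f) (strict_flat x f \<circ>\<^sub>F F)"
proof -
  note X = hom_Cat[OF x] and F = hom_Cat[OF f]
  have S: "diag (sum_fct x f)" using sum_moderate(1)[of x f] X F by simp
  note H = h_sum(3)[OF x f]
  interpret p: pair x f using X F by unfold_locales simp_all
  interpret R: reindexing "id_fct (Src x)" "sum_fct x f" "h_sum Sk x f" "\<nu> (sum_fct x f)"
    using H hom_Cat[OF h_sum(1)[OF x f]] X by unfold_locales (simp_all add: ModCats_category)
  have "is_functor (flat_fct x f)" using p.is_functor_flat[OF S] .
  then show ?thesis
    using represents_relabel[OF represents_sum[OF r X(2) T S] H] representsD[OF r]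
    by (simp add: strict_flat_def cmp_fct_assoc)
qed

lemma h_sum_represents1:
  assumes x: "x \<in> hom I U Cat" and f: "f \<in> hom I (tot x) Cat"
  shows "represents (proj x \<circ>\<^sub>F proj f) (lifts2 x f) (h_sum Sk x f) (strict_flat x f)"
proof -
  note X = hom_Cat[OF x] and F = hom_Cat[OF f]
  have S: "diag (sum_fct x f)" using sum_moderate(1)[of x f] X F by simp
  interpret p: pair x f using X F by unfold_locales simp_all
  interpret R: reindexing "id_fct U" "sum_fct x f" "h_sum Sk x f" "\<nu> (sum_fct x f)"
    using h_sum(3)[OF x f] hom_Cat[OF h_sum(1)[OF x f]] X
    by unfold_locales (simp_all add: ModCats_category)
  have "is_functor (flat_fct x f)" using p.is_functor_flat[OF S] .
  then have "strict_flat x f \<circ>\<^sub>F id_fct (tot f) = strict_flat x f" using X F by (simp add: strict_flat_def)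
  then show ?thesis
    using h_sum_represents[OF x f represents_proj[OF F(2)]] F by simp
qed

lemma h_sum_represents2:
  assumes x: "x \<in> hom I U Cat" and f: "f \<in> hom I (tot x) Cat" and e: "e \<in> hom I (tot f) Cat"
  shows "represents (proj x \<circ>\<^sub>F proj f \<circ>\<^sub>F proj e)
      (comp_lift (lifts2 x f) (proj e) (lifts e))
      (h_sum Sk x (h_sum Sk f e)) (strict_flat x (h_sum Sk f e) \<circ>\<^sub>F strict_flat f e)"
proof -
  note X = hom_Cat[OF x] and F = hom_Cat[OF f] and E = hom_Cat[OF e]
  have "represents (proj x \<circ>\<^sub>F (proj f \<circ>\<^sub>F proj e))
      (comp_lift (lifts x) (proj f \<circ>\<^sub>F proj e) (lifts2 f e))
      (h_sum Sk x (h_sum Sk f e)) (strict_flat x (h_sum Sk f e) \<circ>\<^sub>F strict_flat f e)"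
    by (rule h_sum_represents[OF x h_sum(1)[OF f e] h_sum_represents1[OF f e]]) (simp add: F)
  then have "represents (proj x \<circ>\<^sub>F proj f \<circ>\<^sub>F proj e)
      (comp_lift (lifts x) (proj f \<circ>\<^sub>F proj e) (lifts2 f e))
      (h_sum Sk x (h_sum Sk f e)) (strict_flat x (h_sum Sk f e) \<circ>\<^sub>F strict_flat f e)"
    using X F E by (simp add: cmp_fct_assoc)
  then show ?thesis by (rule represents_cong) (simp add: comp_lift_def E F X)
qed

lemma strict_flat_sel:
  assumes x: "x \<in> hom I U Cat" and f: "f \<in> hom I (tot x) Cat"
  shows "is_functor (strict_flat x f)" "Src (strict_flat x f) = tot f" "Tgt (strict_flat x f) = tot (h_sum Sk x f)"
    "proj (h_sum Sk x f) \<circ>\<^sub>F strict_flat x f = proj x \<circ>\<^sub>F proj f" "given_by (h_flat Sk \<nu> x f) (strict_flat x f)"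
proof -
  note D = representsD[OF h_sum_represents1[OF x f]] and F = hom_Cat[OF f] and S = hom_Cat[OF h_sum(1)[OF x f]]
  show 1: "is_functor (strict_flat x f)" "Src (strict_flat x f) = tot f" "Tgt (strict_flat x f) = tot (h_sum Sk x f)"
    "proj (h_sum Sk x f) \<circ>\<^sub>F strict_flat x f = proj x \<circ>\<^sub>F proj f"
    using D by simp_all
  have "given_by (Ho Sk (strict_flat x f)) (strict_flat x f)" using 1 F S hom_Cat[OF x] by (intro given_by_HoI) simp_all
  then show "given_by (h_flat Sk \<nu> x f) (strict_flat x f)" by (simp add: h_flat_def strict_flat_def)
qed

text \<open>The square of \<open>g\<close> over \<open>w\<close> is pasted on top of the square of \<open>y\<close> over \<open>h\<close>; the diagrams of the two
  composite opfibrations are the two sides.\<close>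

lemma dsum_natural_hCAT:
  assumes h: "h \<in> hom I U U'" and y: "y \<in> hom I U' Cat" and w: "w \<in> h_base_change Sk h y"
    and g: "g \<in> hom I (tot y) Cat"
  shows "h_sum Sk (Cmp I y h) (Cmp I g w) = Cmp I (h_sum Sk y g) h"
proof -
  let ?x = "Cmp I y h" and ?e = "Cmp I g w"
  obtain \<phi> where \<phi>: "nat_iso ?x (y \<circ>\<^sub>F h) \<phi>" and w': "given_by w (reindex h ?x y \<phi>)"
    and "reindexing h ?x y \<phi>" by (rule h_base_changeE[OF w h y])
  then interpret R: reindexing h ?x y \<phi> by simp
  let ?R = "reindex h ?x y \<phi>"
  note Y = hom_Cat[OF y] and X = hom_Cat[OF Cmp_Cat(1)[OF h y]] and G = hom_Cat[OF g]
  note x = Cmp_Cat(1)[OF h y]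
  have e: "?e \<in> hom I (tot ?x) Cat" by (rule Cmp_Cat(1)[OF base_change_hCAT(1)[OF h y w] g])
  note E = hom_Cat[OF e]
  have "given_by ?e (g \<circ>\<^sub>F ?R)" by (rule given_by_Cmp[OF given_by_self w']) (simp_all add: G)
  then obtain \<epsilon> where \<epsilon>: "nat_iso ?e (g \<circ>\<^sub>F ?R) \<epsilon>" by (rule given_by_nat_iso)
  interpret R2: reindexing ?R ?e g \<epsilon> using \<epsilon> G by unfold_locales simp_all
  have sq: "split_pullback (reindex ?R ?e g \<epsilon>) h (proj ?x \<circ>\<^sub>F proj ?e) (proj y \<circ>\<^sub>F proj g)
      (lifts2 ?x ?e) (lifts2 y g)"
    by (rule split_pullback_vert[OF R.split_pullback_reindex R2.split_pullback_reindex]) simp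
  obtain \<psi> where \<psi>: "nat_iso (h_sum Sk ?x ?e) (h_sum Sk y g \<circ>\<^sub>F h) \<psi>"
    by (rule represents_compare[OF h_sum_represents1[OF x e] h_sum_represents1[OF y g] sq])
  have "given_by (Cmp I (h_sum Sk y g) h) (h_sum Sk y g \<circ>\<^sub>F h)"
    by (rule Cmp_Cat(2)[OF h h_sum(1)[OF y g]])
  moreover have "given_by (h_sum Sk ?x ?e) (h_sum Sk ?x ?e)" using h_sum(1)[OF x e] by (simp add: given_by_self)
  ultimately show ?thesis using \<psi> given_by_unique unfolding iso_fct_def by metis
qed

end

section \<open>Units\<close>

text \<open>An opfibration with terminal fibres is an isomorphism, hence a pullback of the identity, whose chosen
  lifts are the arrows themselves.\<close>

lemma split_pullback_proj_trivial:
  assumes c [simp]: "diag c"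
    and O: "\<And>z. z \<in> Ob (Src c) \<Longrightarrow> \<exists>!i. i \<in> Ob (fib c z)"
    and M: "\<And>z. z \<in> Ob (Src c) \<Longrightarrow> \<exists>!\<iota>. \<iota> \<in> Ar (fib c z)"
  shows "split_pullback (proj c) (id_fct (Src c)) (proj c) (id_fct (Src c)) (lifts c) (\<lambda>\<alpha> e. \<alpha>)"
proof -
  have "split_pullback (proj c) (id_fct (Tgt (proj c))) (proj c) (id_fct (Src c)) (lifts c) (\<lambda>\<alpha> e. \<alpha>)"
  proof (rule split_pullback_idI)
    show "bij_betw (FO (proj c)) (Ob (Src (proj c))) (Ob (Src (id_fct (Src c))))"
    proof (rule bij_betwI')
      fix d e assume de: "d \<in> Ob (Src (proj c))" "e \<in> Ob (Src (proj c))"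
      then obtain u i v j where "d = tob u i" "u \<in> Ob (Src c)" "i \<in> Ob (fib c u)"
        "e = tob v j" "v \<in> Ob (Src c)" "j \<in> Ob (fib c v)" by (metis Ob_totE proj_sel(1))
      then show "FO (proj c) d = FO (proj c) e \<longleftrightarrow> d = e" using O[of u] by auto
    next
      fix u assume u: "u \<in> Ob (Src (id_fct (Src c)))"
      then obtain i where "i \<in> Ob (fib c u)" using O[of u] by auto
      then show "\<exists>e\<in>Ob (Src (proj c)). u = FO (proj c) e" using u by (intro bexI[of _ "tob u i"]) simp_all
    qed simp
    show "bij_betw (FM (proj c)) (Ar (Src (proj c))) (Ar (Src (id_fct (Src c))))"
    proof (rule bij_betwI')
      fix m n assume mn: "m \<in> Ar (Src (proj c))" "n \<in> Ar (Src (proj c))"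
      obtain i \<alpha> \<beta> where m: "m = tar i \<alpha> \<beta>" "\<alpha> \<in> Ar (Src c)" "i \<in> Ob (fib c (Dom (Src c) \<alpha>))"
        "\<beta> \<in> Ar (fib c (Cod (Src c) \<alpha>))" "Dom (fib c (Cod (Src c) \<alpha>)) \<beta> = FO (tra c \<alpha>) i"
        using mn(1) by (auto elim!: Ar_totE)
      obtain j \<gamma> \<delta> where n: "n = tar j \<gamma> \<delta>" "\<gamma> \<in> Ar (Src c)" "j \<in> Ob (fib c (Dom (Src c) \<gamma>))"
        "\<delta> \<in> Ar (fib c (Cod (Src c) \<gamma>))" "Dom (fib c (Cod (Src c) \<gamma>)) \<delta> = FO (tra c \<gamma>) j"
        using mn(2) by (auto elim!: Ar_totE)
      show "FM (proj c) m = FM (proj c) n \<longleftrightarrow> m = n"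
      proof
        assume "FM (proj c) m = FM (proj c) n"
        then have e: "\<alpha> = \<gamma>" using m n by simp
        moreover have "i = j" using O[of "Dom (Src c) \<alpha>"] m n e by auto
        moreover have "\<beta> = \<delta>" using M[of "Cod (Src c) \<alpha>"] m n e by auto
        ultimately show "m = n" using m n by simp
      qed simp
    next
      fix \<alpha> assume "\<alpha> \<in> Ar (Src (id_fct (Src c)))"
      then have \<alpha> [simp]: "\<alpha> \<in> Ar (Src c)" by simp
      obtain i where i: "i \<in> Ob (fib c (Dom (Src c) \<alpha>))" using O[of "Dom (Src c) \<alpha>"] by auto
      then show "\<exists>m\<in>Ar (Src (proj c)). \<alpha> = FM (proj c) m"
        by (intro bexI[of _ "lift c \<alpha> i"]) simp_all
    qed simp
  qed (auto elim!: Ob_totE)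
  then show ?thesis by simp
qed

context hcat
begin

lemma one_mcat_sel [simp]:
  "Ob (one_mcat :: ('s, 'u) mcat) = {MAtom undefined}" "Ar (one_mcat :: ('s, 'u) mcat) = {MAtom undefined}"
  "Dom (one_mcat :: ('s, 'u) mcat) (MAtom undefined) = MAtom undefined"
  "Cod (one_mcat :: ('s, 'u) mcat) (MAtom undefined) = MAtom undefined"
  "Idn (one_mcat :: ('s, 'u) mcat) (MAtom undefined) = MAtom undefined"
  "Cmp (one_mcat :: ('s, 'u) mcat) (MAtom undefined) (MAtom undefined) = MAtom undefined"
  by (simp_all add: one_mcat_def one_cat_def)

lemma terminal_hCAT: "terminal I (one_mcat :: ('s, 'u) mcat)"
  unfolding terminal_def
proof (intro conjI ballI)
  show "one_mcat \<in> Ob I" by simp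
  fix X :: "('s, 'u) mcat" assume "X \<in> Ob I"
  then have X: "X \<in> ModCats" "category X" by (simp_all add: ModCats_category)
  let ?k = "mk_fct X one_mcat (\<lambda>_. MAtom undefined) (\<lambda>_. MAtom undefined) :: ('s, 'u) mfct"
  have "is_functor ?k" by (rule is_functor_mk_fct) (simp_all add: X ModCats_category)
  then have k: "given_by (Ho Sk ?k) ?k" using X by (intro given_by_HoI) simp_all
  show "\<exists>!f. f \<in> hom I X one_mcat"
  proof (rule ex1I[of _ "Ho Sk ?k"])
    show "Ho Sk ?k \<in> hom I X one_mcat" using given_byD[OF k] by simp
    fix f assume "f \<in> hom I X one_mcat"
    then have f: "f \<in> Sk" "Src f = X" "Tgt f = one_mcat" by simp_all
    have O: "FO f a = MAtom undefined" if "a \<in> Ob X" for a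
      using FO_in[of f a one_mcat] f that by simp
    have M: "FM f a = MAtom undefined" if "a \<in> Ar X" for a
      using FM_in[of f a one_mcat] f that by simp
    have "f = ?k" by (rule fct_eqI) (use f \<open>is_functor ?k\<close> O M in simp_all)
    then show "f = Ho Sk ?k" using given_by_eq[OF given_by_self k] f by simp
  qed
qed

lemma one_scat_sel [simp]:
  "Ob (one_scat :: 's scat) = {SAtom undefined}" "Ar (one_scat :: 's scat) = {SAtom undefined}"
  by (simp_all add: one_scat_def one_cat_def)

lemma one_scat_small [simp]: "(one_scat :: 's scat) \<in> SmallCats"
proof -
  have "category (one_scat :: 's scat)"
    unfolding one_scat_def one_cat_def by (rule category_mk_cat) simp_all
  moreover have "|{a}| <o |UNIV :: 's set|" for a :: "'s small"
    using inacc_infinite[OF kappa0]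
    by (metis card_of_ordLeq_finite finite.emptyI finite.insertI not_ordLeq_iff_ordLess card_of_Well_order)
  ultimately show ?thesis by (simp add: SmallCats_def smaller_than_def del: SmallCats_category)
qed

lemma oneF_facts: "is_functor (oneF_fct :: ('s, 'u) mfct)" "Src (oneF_fct :: ('s, 'u) mfct) = one_mcat"
    "Tgt (oneF_fct :: ('s, 'u) mfct) = Fcat"
    "FO (oneF_fct :: ('s, 'u) mfct) (MAtom undefined) = tob (MCat one_scat) (SAtom undefined)"
proof -
  let ?a = "tob (MCat one_scat) (SAtom undefined) :: ('s, 'u) moderate"
  have a: "?a \<in> Ob Fcat" by (simp add: Fcat_def)
  have eq: "oneF_fct = mk_fct one_mcat Fcat (\<lambda>_. ?a) (\<lambda>_. Idn Fcat ?a)" by (simp add: oneF_fct_def Let_def)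
  show "is_functor (oneF_fct :: ('s, 'u) mfct)"
    unfolding eq by (rule is_functor_mk_fct) (use a in \<open>simp_all add: ModCats_category\<close>)
  show "Src (oneF_fct :: ('s, 'u) mfct) = one_mcat" "Tgt (oneF_fct :: ('s, 'u) mfct) = Fcat"
    "FO (oneF_fct :: ('s, 'u) mfct) (MAtom undefined) = ?a" unfolding eq by simp_all
qed

lemma given_by_oneF: "given_by (Ho Sk oneF_fct) oneF_fct"
  by (rule given_by_HoI) (simp_all add: oneF_facts)

abbreviation "const1 X \<equiv> const_mor I one_mcat (Cmp I (Ho Sk p_fct) (Ho Sk oneF_fct)) X"

text \<open>The representative of a constant functor need not be constant, but its fibres are isomorphic to the
  terminal category, hence terminal in the strict sense below.\<close>

lemma const1:
  assumes X: "X \<in> ModCats"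
  shows "const1 X \<in> hom I X Cat"
    and "z \<in> Ob X \<Longrightarrow> \<exists>!i. i \<in> Ob (fib (const1 X) z)" "z \<in> Ob X \<Longrightarrow> \<exists>!i. i \<in> Ar (fib (const1 X) z)"
proof -
  let ?c = "const1 X"
  have "\<exists>!t. t \<in> hom I X one_mcat" using terminal_hCAT X by (simp add: terminal_def)
  from theI'[OF this] obtain t where t: "t = (THE t. t \<in> hom I X one_mcat)" "t \<in> hom I X one_mcat" by blast
  have t' [simp]: "t \<in> Sk" "Src t = X" "Tgt t = one_mcat" using t(2) by simp_all
  note [simp] = oneF_facts
  let ?k = "p_fct \<circ>\<^sub>F oneF_fct \<circ>\<^sub>F t"
  have "given_by (Cmp I (Cmp I (Ho Sk p_fct) (Ho Sk oneF_fct)) t) ?k"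
    by (intro given_by_Cmp given_by_p given_by_oneF given_by_self) simp_all
  then have r: "given_by ?c ?k" unfolding const_mor_def t(1) .
  then show c: "?c \<in> hom I X Cat" using given_byD[OF r] by simp
  note C = hom_Cat[OF c]
  have k: "diag ?k" by (intro diag_cmp) simp_all
  obtain \<phi> where \<phi>: "nat_iso ?c ?k \<phi>" by (rule given_by_nat_iso[OF r])
  interpret R: reindexing "id_fct X" ?c ?k \<phi>
    using \<phi> k X by unfold_locales (simp_all add: ModCats_category)
  assume z: "z \<in> Ob X"
  have tz: "FO t z = MAtom undefined" using FO_in[of t z one_mcat] z by simp
  have "FO (p_fct :: ('s, 'u) mfct) (tob (MCat one_scat) (SAtom undefined)) = MCat one_scat"
    by (simp add: p_fct_def)
  then have "FO ?k z = MCat one_scat" using z by (simp add: tz)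
  then have f: "fib ?k z = one_scat" by simp
  have b: "bij_betw (FO (component \<phi> z)) (Ob (fib ?c z)) {SAtom undefined}"
    "bij_betw (FM (component \<phi> z)) (Ar (fib ?c z)) {SAtom undefined}"
    using R.bij_component[of z] z C f by simp_all
  have u: "\<exists>!i. i \<in> A" if "bij_betw h A {a}" for h :: "'s small \<Rightarrow> 's small" and A a
    using that unfolding bij_betw_def inj_on_def by (metis image_iff singletonD singletonI)
  show "\<exists>!i. i \<in> Ob (fib ?c z)" "\<exists>!i. i \<in> Ar (fib ?c z)" by (rule u[OF b(1)], rule u[OF b(2)])
qed

text \<open>Composed with an opfibration with terminal fibres, \<open>proj x\<close> is still represented by \<open>x\<close>. This is the
  right unit law.\<close>

lemma const1_represents:
  assumes x: "x \<in> hom I U Cat"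
  defines "c \<equiv> const1 (tot x)"
  shows "represents (proj x \<circ>\<^sub>F proj c) (lifts2 x c) x (proj c)"
    and "split_pullback (proj c) (id_fct (tot x)) (proj c) (id_fct (tot x)) (lifts c) (\<lambda>\<alpha> e. \<alpha>)"
    and "c \<in> hom I (tot x) Cat"
proof -
  note X = hom_Cat[OF x]
  have T: "tot x \<in> ModCats" using X by simp
  show c: "c \<in> hom I (tot x) Cat" unfolding c_def by (rule const1(1)[OF T])
  note C = hom_Cat[OF c]
  show sq: "split_pullback (proj c) (id_fct (tot x)) (proj c) (id_fct (tot x)) (lifts c) (\<lambda>\<alpha> e. \<alpha>)"
    using split_pullback_proj_trivial[OF C(2)] const1(2,3)[OF T] C unfolding c_def by simp
  have "split_pullback (proj c) (id_fct U) (proj x \<circ>\<^sub>F proj c) (proj x \<circ>\<^sub>F id_fct (tot x))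
      (lifts2 x c) (comp_lift (lifts x) (id_fct (tot x)) (\<lambda>\<alpha> e. \<alpha>))"
    using split_pullback_vert[OF split_pullback_id[of "proj x" "lifts x"], of "proj c" "proj c" "id_fct (tot x)"] sq X by simp
  then have sq': "split_pullback (proj c) (id_fct U) (proj x \<circ>\<^sub>F proj c) (proj x)
      (lifts2 x c) (comp_lift (lifts x) (id_fct (tot x)) (\<lambda>\<alpha> e. \<alpha>))"
    using X by simp
  have "split_pullback (proj c) (id_fct U) (proj x \<circ>\<^sub>F proj c) (proj x) (lifts2 x c) (lifts x)"
    by (rule split_pullback_cong[OF sq']) (simp_all add: comp_lift_def)
  moreover have "splitting (proj x \<circ>\<^sub>F proj c) (lifts2 x c)"
    using X C by (intro splitting_comp) simp_all
  ultimately have "represents (proj x \<circ>\<^sub>F proj c) (lifts2 x c) x (id_fct (tot x) \<circ>\<^sub>F proj c)"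
    using represents_pre[OF represents_proj[OF X(2)], of "proj c" "proj x \<circ>\<^sub>F proj c"] X by simp
  then show "represents (proj x \<circ>\<^sub>F proj c) (lifts2 x c) x (proj c)"
    using C by simp
qed

lemma represents_eq:
  assumes "represents P L s F" "represents P L s' F'" "s \<in> Sk" "s' \<in> Sk"
  shows "s = s'"
proof -
  obtain \<phi> where "nat_iso s s' \<phi>" by (rule represents_unique[OF assms(1,2)])
  then show ?thesis using given_by_unique[OF given_by_self given_by_self] assms(3,4) unfolding iso_fct_def by blast
qed

lemma right_unit_hCAT:
  assumes x: "x \<in> hom I U Cat"
  shows "h_sum Sk x (const1 (tot x)) = x"
  using represents_eq[OF h_sum_represents1[OF x const1_represents(3)[OF x]] const1_represents(1)[OF x]]
    h_sum(1)[OF x const1_represents(3)[OF x]] x by simp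

text \<open>Two functors that represent the same split opfibration differ by a comparison
  \<open>\<theta> : \<lbrakk>x\<rbrakk> \<rightarrow> \<lbrakk>x\<rbrakk>\<close> along the identity of the base.\<close>

lemma represents_comparison:
  assumes x: "x \<in> hom I U Cat" and 1: "represents P L x F" and 2: "represents P L x F'"
  obtains \<theta> T where "\<theta> \<in> h_base_change Sk (Idn I U) x" "given_by \<theta> T" "Src T = tot x" "T \<circ>\<^sub>F F \<cong>\<^sub>F F'"
proof -
  note X = hom_Cat[OF x] and D = representsD[OF 1] and D' = representsD[OF 2]
  let ?i = "Idn I U"
  have ri: "given_by ?i (id_fct U)" by (rule given_by_Idn[OF X(4)])
  note RI = given_byD[OF ri]
  have i: "?i \<in> hom I U U" using RI by simp
  obtain \<phi> where \<phi>: "nat_iso x x \<phi>" "relabel x x \<phi> \<circ>\<^sub>F F = F'" by (rule represents_unique[OF 1 2])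
  obtain \<zeta> where \<zeta>: "nat_iso (id_fct U) ?i \<zeta>" using RI(3) unfolding iso_fct_def by blast
  have \<phi>': "nat_iso x (x \<circ>\<^sub>F id_fct U) \<phi>" using \<phi>(1) X by simp
  let ?\<psi> = "\<lambda>u. Cmp Cat (FM x (\<zeta> u)) (\<phi> u)"
  have T: "Tgt (id_fct U) = Src x" using X by simp
  note ch = reindex_change[OF X(2) \<phi>' \<zeta> T]
  have "given_by (Cmp I x ?i) (x \<circ>\<^sub>F id_fct U)" by (rule given_by_Cmp[OF given_by_self ri]) (simp_all add: X)
  then have xi: "Cmp I x ?i = x" using X given_by_eq[OF _ given_by_self] by simp
  obtain w where w: "w \<in> h_base_change Sk ?i x" "given_by w (reindex ?i x x ?\<psi>)"
    using h_base_changeI[OF i x, of ?\<psi>] ch(1) unfolding xi by blast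
  have "given_by w (reindex (id_fct U) x x \<phi>)" using w(2) iso_fct_sym[OF ch(2)] by (rule given_by_iso)
  moreover have S: "Src (reindex (id_fct U) x x \<phi>) = tot x" by (simp add: reindex_def)
  moreover have "reindex (id_fct U) x x \<phi> \<circ>\<^sub>F F \<cong>\<^sub>F F'"
    using \<phi>(2) iso_fct_refl[OF D'(4)] X by simp
  ultimately show ?thesis using that w(1) by blast
qed

text \<open>For \<open>\<theta>\<close> comparing the two representations of the composite \<open>\<lbrakk>c\<rbrakk> \<rightarrow> \<lbrakk>x\<rbrakk> \<rightarrow> U\<close> by \<open>x\<close>, the composite of
  \<open>\<theta>\<close> with the flattening map is the projection \<open>\<lbrakk>c\<rbrakk> \<rightarrow> \<lbrakk>x\<rbrakk>\<close>, so that \<open>f\<close> is pulled back along an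
  isomorphism and summed over its terminal fibres.\<close>

lemma left_unit_hCAT:
  assumes x: "x \<in> hom I U Cat"
  shows "\<exists>\<theta>\<in>h_base_change Sk (Idn I U) x. \<forall>f\<in>hom I (tot x) Cat.
     h_sum Sk (const1 (tot x)) (Cmp I f (Cmp I \<theta> (h_flat Sk \<nu> x (const1 (tot x))))) = f"
proof -
  let ?c = "const1 (tot x)"
  note X = hom_Cat[OF x] and c = const1_represents(3)[OF x]
  note C = hom_Cat[OF c]
  have r1: "represents (proj x \<circ>\<^sub>F proj ?c) (lifts2 x ?c) x (strict_flat x ?c)"
    using h_sum_represents1[OF x c] right_unit_hCAT[OF x] by simp
  obtain \<theta> T where \<theta>: "\<theta> \<in> h_base_change Sk (Idn I U) x" "given_by \<theta> T" "Src T = tot x" "T \<circ>\<^sub>F strict_flat x ?c \<cong>\<^sub>F proj ?c"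
    by (rule represents_comparison[OF x r1 const1_represents(1)[OF x]])
  note hfl = strict_flat_sel[OF x c, unfolded right_unit_hCAT[OF x]]
  have "given_by (Cmp I \<theta> (h_flat Sk \<nu> x ?c)) (T \<circ>\<^sub>F strict_flat x ?c)"
    by (rule given_by_Cmp[OF \<theta>(2) hfl(5)]) (simp add: \<theta>(3) hfl(3))
  then have t: "given_by (Cmp I \<theta> (h_flat Sk \<nu> x ?c)) (proj ?c)" using \<theta>(4) by (rule given_by_iso)
  have "h_sum Sk ?c (Cmp I f (Cmp I \<theta> (h_flat Sk \<nu> x ?c))) = f" if f: "f \<in> hom I (tot x) Cat" for f
  proof -
    note F = hom_Cat[OF f]
    let ?e = "Cmp I f (Cmp I \<theta> (h_flat Sk \<nu> x ?c))"
    have re: "given_by ?e (f \<circ>\<^sub>F proj ?c)" by (rule given_by_Cmp[OF given_by_self t]) (simp_all add: F C)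
    have e: "?e \<in> hom I (tot ?c) Cat" using given_byD[OF re] F by simp
    note E = hom_Cat[OF e]
    obtain \<epsilon> where \<epsilon>: "nat_iso ?e (f \<circ>\<^sub>F proj ?c) \<epsilon>" by (rule given_by_nat_iso[OF re])
    interpret R: reindexing "proj ?c" ?e f \<epsilon> using \<epsilon> F C by unfold_locales simp_all
    have "split_pullback (reindex (proj ?c) ?e f \<epsilon>) (id_fct (tot x)) (proj ?c \<circ>\<^sub>F proj ?e) (id_fct (tot x) \<circ>\<^sub>F proj f)
        (lifts2 ?c ?e) (comp_lift (\<lambda>\<alpha> e. \<alpha>) (proj f) (lifts f))"
      by (rule split_pullback_vert[OF const1_represents(2)[OF x] R.split_pullback_reindex]) (use C in simp)
    moreover have "comp_lift (\<lambda>\<alpha> e. \<alpha>) (proj f) (lifts f) = lifts f" by (simp add: comp_lift_def fun_eq_iff)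
    ultimately have sq: "split_pullback (reindex (proj ?c) ?e f \<epsilon>) (id_fct (tot x)) (proj ?c \<circ>\<^sub>F proj ?e) (proj f)
        (lifts2 ?c ?e) (lifts f)" using F by simp
    have "splitting (proj ?c \<circ>\<^sub>F proj ?e) (lifts2 ?c ?e)"
      using C E by (intro splitting_comp) simp_all
    then have "represents (proj ?c \<circ>\<^sub>F proj ?e) (lifts2 ?c ?e) f
        (id_fct (tot f) \<circ>\<^sub>F reindex (proj ?c) ?e f \<epsilon>)"
      using represents_pre[OF represents_proj[OF F(2)], of "reindex (proj ?c) ?e f \<epsilon>" "proj ?c \<circ>\<^sub>F proj ?e"]
        sq C by simp
    then show ?thesis
      using represents_eq[OF h_sum_represents1[OF c e]] h_sum(1)[OF c e] F by simp
  qed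
  then show ?thesis using \<theta>(1) by blast
qed

section \<open>Associativity\<close>

text \<open>Both bracketings of an iterated sum represent the composite opfibration
  \<open>\<lbrakk>e\<rbrakk> \<rightarrow> \<lbrakk>f\<rbrakk> \<rightarrow> \<lbrakk>x\<rbrakk> \<rightarrow> U\<close>, where \<open>e\<close> is \<open>g\<close> pulled back along the flattening map.\<close>

lemma bracketing_represents:
  assumes x: "x \<in> hom I U Cat" and f: "f \<in> hom I (tot x) Cat" and g: "g \<in> hom I (tot (h_sum Sk x f)) Cat"
    and e: "e \<in> hom I (tot f) Cat" and \<phi>: "nat_iso e (g \<circ>\<^sub>F strict_flat x f) \<phi>"
  shows "represents (proj x \<circ>\<^sub>F proj f \<circ>\<^sub>F proj e)
      (comp_lift (lifts2 x f) (proj e) (lifts e))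
      (h_sum Sk (h_sum Sk x f) g) (strict_flat (h_sum Sk x f) g \<circ>\<^sub>F reindex (strict_flat x f) e g \<phi>)"
proof -
  note X = hom_Cat[OF x] and F = hom_Cat[OF f] and G = hom_Cat[OF g] and E = hom_Cat[OF e]
    and s = h_sum(1)[OF x f] and H = strict_flat_sel[OF x f] and r = representsD[OF h_sum_represents1[OF x f]]
  interpret R: reindexing "strict_flat x f" e g \<phi> using \<phi> G H by unfold_locales simp_all
  have sq: "split_pullback (reindex (strict_flat x f) e g \<phi>) (id_fct U) (proj x \<circ>\<^sub>F proj f \<circ>\<^sub>F proj e) (proj (h_sum Sk x f) \<circ>\<^sub>F proj g)
      (comp_lift (lifts2 x f) (proj e) (lifts e))
      (comp_lift (lifts (h_sum Sk x f)) (proj g) (lifts g))"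
    using split_pullback_vert[OF r(3) R.split_pullback_reindex r(2)] X by simp
  show ?thesis
    by (rule represents_pre[OF h_sum_represents1[OF s g]])
      (use sq X F E r(2) in \<open>simp_all add: splitting_comp\<close>)
qed

lemma sum_assoc_hCAT:
  assumes x: "x \<in> hom I U Cat" and f: "f \<in> hom I (tot x) Cat" and g: "g \<in> hom I (tot (h_sum Sk x f)) Cat"
  shows "h_sum Sk (h_sum Sk x f) g = h_sum Sk x (h_sum Sk f (Cmp I g (h_flat Sk \<nu> x f)))"
    and "Cmp I g (h_flat Sk \<nu> x f) \<in> hom I (tot f) Cat"
proof -
  let ?e = "Cmp I g (h_flat Sk \<nu> x f)"
  note H = strict_flat_sel[OF x f] and s = h_sum(1)[OF x f] and G = hom_Cat[OF g] and F = hom_Cat[OF f]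
  have re: "given_by ?e (g \<circ>\<^sub>F strict_flat x f)" by (rule given_by_Cmp[OF given_by_self H(5)]) (simp_all add: G H)
  show e: "?e \<in> hom I (tot f) Cat" using given_byD[OF re] G H by simp
  obtain \<phi> where \<phi>: "nat_iso ?e (g \<circ>\<^sub>F strict_flat x f) \<phi>" by (rule given_by_nat_iso[OF re])
  show "h_sum Sk (h_sum Sk x f) g = h_sum Sk x (h_sum Sk f ?e)"
    using represents_eq[OF bracketing_represents[OF x f g e \<phi>] h_sum_represents2[OF x f e]]
      h_sum(1)[OF s g] h_sum(1)[OF x h_sum(1)[OF f e]] by simp
qed

lemma flatten_assoc_hCAT:
  assumes x: "x \<in> hom I U Cat" and f: "f \<in> hom I (tot x) Cat" and g: "g \<in> hom I (tot (h_sum Sk x f)) Cat"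
    and w: "w \<in> h_base_change Sk (h_flat Sk \<nu> x f) g"
  shows "\<exists>\<theta>\<in>h_base_change Sk (Idn I U) (h_sum Sk (h_sum Sk x f) g).
     Cmp I \<theta> (Cmp I (h_flat Sk \<nu> (h_sum Sk x f) g) w) =
     Cmp I (h_flat Sk \<nu> x (h_sum Sk f (Cmp I g (h_flat Sk \<nu> x f)))) (h_flat Sk \<nu> f (Cmp I g (h_flat Sk \<nu> x f)))"
proof -
  let ?a = "h_flat Sk \<nu> x f"
  let ?e = "Cmp I g ?a"
  let ?s = "h_sum Sk x f"
  let ?T = "h_sum Sk ?s g"
  let ?t = "h_sum Sk f ?e"
  note e = sum_assoc_hCAT(2)[OF x f g] and s = h_sum(1)[OF x f]
  note H = strict_flat_sel[OF x f] and Hs = strict_flat_sel[OF s g] and G = hom_Cat[OF g] and F = hom_Cat[OF f] and E = hom_Cat[OF e]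
  note t = h_sum(1)[OF f e]
  note Hf = strict_flat_sel[OF f e] and Ht = strict_flat_sel[OF x t]
  note A = given_byD[OF H(5)]
  have a: "?a \<in> hom I (tot f) (tot ?s)" using A H by simp
  obtain \<phi> where \<phi>: "nat_iso ?e (g \<circ>\<^sub>F ?a) \<phi>" "given_by w (reindex ?a ?e g \<phi>)"
    by (rule h_base_changeE[OF w a g])
  obtain \<zeta> where \<zeta>: "nat_iso ?a (strict_flat x f) \<zeta>" by (rule given_by_nat_iso[OF H(5)])
  \<comment> \<open>\<open>w\<close> lies over the representative of the flattening map; it is moved over the functor itself.\<close>
  let ?\<psi> = "\<lambda>u. Cmp Cat (FM g (\<zeta> u)) (\<phi> u)"
  have Ta: "Tgt ?a = Src g" using a G by simp
  note ch = reindex_change[OF G(2) \<phi>(1) \<zeta> Ta]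
  let ?R = "reindex (strict_flat x f) ?e g ?\<psi>"
  have w': "given_by w ?R" using \<phi>(2) ch(2) by (rule given_by_iso)
  have r1: "represents (proj x \<circ>\<^sub>F proj f \<circ>\<^sub>F proj ?e)
      (comp_lift (lifts2 x f) (proj ?e) (lifts ?e)) ?T (strict_flat ?s g \<circ>\<^sub>F ?R)"
    by (rule bracketing_represents[OF x f g e ch(1)])
  have r2: "represents (proj x \<circ>\<^sub>F proj f \<circ>\<^sub>F proj ?e)
      (comp_lift (lifts2 x f) (proj ?e) (lifts ?e)) ?T (strict_flat x ?t \<circ>\<^sub>F strict_flat f ?e)"
    using h_sum_represents2[OF x f e] unfolding sum_assoc_hCAT(1)[OF x f g] .
  obtain \<theta> T where \<theta>: "\<theta> \<in> h_base_change Sk (Idn I U) ?T" "given_by \<theta> T" "Src T = tot ?T"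
    "T \<circ>\<^sub>F (strict_flat ?s g \<circ>\<^sub>F ?R) \<cong>\<^sub>F strict_flat x ?t \<circ>\<^sub>F strict_flat f ?e"
    by (rule represents_comparison[OF h_sum(1)[OF s g] r1 r2])
  have TR: "Tgt ?R = tot g" by (simp add: reindex_def)
  have 1: "given_by (Cmp I (h_flat Sk \<nu> ?s g) w) (strict_flat ?s g \<circ>\<^sub>F ?R)"
    by (rule given_by_Cmp[OF Hs(5) w']) (simp add: Hs TR)
  have "given_by (Cmp I \<theta> (Cmp I (h_flat Sk \<nu> ?s g) w)) (T \<circ>\<^sub>F (strict_flat ?s g \<circ>\<^sub>F ?R))"
    by (rule given_by_Cmp[OF \<theta>(2) 1]) (simp add: \<theta>(3) Hs)
  moreover have "given_by (Cmp I (h_flat Sk \<nu> x ?t) (h_flat Sk \<nu> f ?e)) (strict_flat x ?t \<circ>\<^sub>F strict_flat f ?e)"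
    by (rule given_by_Cmp[OF Ht(5) Hf(5)]) (simp add: Ht Hf)
  ultimately show ?thesis using \<theta>(1,4) given_by_unique by blast
qed

end

section \<open>Commutativity\<close>

text \<open>The inverse of a comparison is again one: invert the pullback square and read off the
  natural isomorphism.\<close>

lemma relabel_inverse:
  assumes x [simp]: "diag x" and z [simp]: "diag z" and \<phi>: "nat_iso x z \<phi>"
  obtains \<psi> where "nat_iso z x \<psi>" "relabel z x \<psi> \<circ>\<^sub>F relabel x z \<phi> = id_fct (tot x)"
proof -
  note [simp] = nat_isoD(3)[OF \<phi>]
  interpret R: reindexing "id_fct (Src z)" x z \<phi> using \<phi> by unfold_locales simp_all
  obtain K where K: "split_pullback K (id_fct (Src z)) (proj z) (proj x) (lifts z) (lifts x)"
    "K \<circ>\<^sub>F relabel x z \<phi> = id_fct (tot x)"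
    by (rule split_pullback_inverse[of "relabel x z \<phi>" "proj x" "proj z" "lifts x" "lifts z"])
      (use R.split_pullback_reindex in simp_all)
  then show ?thesis using split_pullback_proj_reindex[OF K(1)] that by auto
qed

lemma switch_switch:
  assumes x [simp]: "diag x" and y [simp]: "diag y" and S [simp]: "Src y = Src x"
  shows "switch_fct y x \<circ>\<^sub>F switch_fct x y = id_fct (tot (y \<circ>\<^sub>F proj x))"
proof -
  interpret c: pair x "y \<circ>\<^sub>F proj x" by unfold_locales simp_all
  note sw = proj_switch[OF x y S] proj_switch[OF y x S[symmetric]]
  show ?thesis
  proof (rule fct_eqI)
    fix z assume z: "z \<in> Ob (Src (id_fct (tot (y \<circ>\<^sub>F proj x))))"
    have "FO (switch_fct x y) z \<in> Ob (tot (x \<circ>\<^sub>F proj y))" using z sw by simp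
    then show "FO (switch_fct y x \<circ>\<^sub>F switch_fct x y) z = FO (id_fct (tot (y \<circ>\<^sub>F proj x))) z"
      using z sw by (auto simp: switch_fct_def elim!: c.Ob_tot_fE)
  next
    fix m assume m: "m \<in> Ar (Src (id_fct (tot (y \<circ>\<^sub>F proj x))))"
    have "FM (switch_fct x y) m \<in> Ar (tot (x \<circ>\<^sub>F proj y))" using m sw by simp
    then show "FM (switch_fct y x \<circ>\<^sub>F switch_fct x y) m = FM (id_fct (tot (y \<circ>\<^sub>F proj x))) m"
      using m sw by (auto simp: switch_fct_def elim!: c.Ar_tot_fE)
  qed (use sw in simp_all)
qed

lemma proj_switch_relabel:
  assumes x [simp]: "diag x" and y [simp]: "diag y" and S [simp]: "Src y = Src x"
    and c [simp]: "diag c" and \<phi>: "nat_iso c (y \<circ>\<^sub>F proj x) \<phi>"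
  shows "proj (x \<circ>\<^sub>F proj y) \<circ>\<^sub>F (switch_fct x y \<circ>\<^sub>F relabel c (y \<circ>\<^sub>F proj x) \<phi>) = reindex (proj x) c y \<phi>"
proof -
  let ?c = "y \<circ>\<^sub>F proj x" and ?d = "x \<circ>\<^sub>F proj y"
  note sw = proj_switch[OF x y S]
  have [simp]: "Src c = tot x" using nat_isoD(3)[OF \<phi>] by simp
  interpret R: reindexing "id_fct (tot x)" c ?c \<phi> using \<phi> by unfold_locales simp_all
  interpret Q: reindexing "proj x" c y \<phi> using \<phi> by unfold_locales simp_all
  interpret p: pair x c by unfold_locales simp_all
  let ?R = "relabel c ?c \<phi>"
  show ?thesis
  proof (rule fct_eqI)
    fix z assume "z \<in> Ob (Src (reindex (proj x) c y \<phi>))"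
    then have z: "z \<in> Ob (tot c)" by simp
    then have "FO ?R z \<in> Ob (tot ?c)" "FO (switch_fct x y) (FO ?R z) \<in> Ob (tot ?d)" using sw by simp_all
    then show "FO (proj ?d \<circ>\<^sub>F (switch_fct x y \<circ>\<^sub>F ?R)) z = FO (reindex (proj x) c y \<phi>) z"
      using z by (auto simp: switch_fct_def elim!: p.Ob_tot_fE)
  next
    fix m assume "m \<in> Ar (Src (reindex (proj x) c y \<phi>))"
    then have m: "m \<in> Ar (tot c)" by simp
    then have "FM ?R m \<in> Ar (tot ?c)" "FM (switch_fct x y) (FM ?R m) \<in> Ar (tot ?d)" using sw by simp_all
    then show "FM (proj ?d \<circ>\<^sub>F (switch_fct x y \<circ>\<^sub>F ?R)) m = FM (reindex (proj x) c y \<phi>) m"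
      using m by (auto simp: switch_fct_def elim!: p.Ar_tot_fE)
  qed (use sw in simp_all)
qed

context hcat
begin

lemma h_switchE:
  assumes x: "x \<in> hom I U Cat" and y: "y \<in> hom I U Cat" and s: "s \<in> h_switch Sk x y"
  defines "c \<equiv> Cmp I y (pr x)" and "d \<equiv> Cmp I x (pr y)"
  obtains \<phi> \<psi> where "nat_iso c (y \<circ>\<^sub>F proj x) \<phi>" "nat_iso (x \<circ>\<^sub>F proj y) d \<psi>"
    "s = Ho Sk (relabel (x \<circ>\<^sub>F proj y) d \<psi> \<circ>\<^sub>F switch_fct x y \<circ>\<^sub>F relabel c (y \<circ>\<^sub>F proj x) \<phi>)"
proof -
  note X = hom_Cat[OF x] and Y = hom_Cat[OF y]
  note P = given_byD[OF given_by_proj[OF X(2)]] and Q = given_byD[OF given_by_proj[OF Y(2)]]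
  have "c = Ho Sk (y \<circ>\<^sub>F pr x)" "d = Ho Sk (x \<circ>\<^sub>F pr y)"
    unfolding c_def d_def using X Y P Q by (simp_all add: Cmp_hCAT)
  then show ?thesis using s that unfolding h_switch_def Let_def by blast
qed

lemma pr_hom:
  assumes x: "x \<in> hom I U Cat"
  shows "pr x \<in> hom I (tot x) U" "given_by (pr x) (proj x)"
proof -
  note X = hom_Cat[OF x]
  show r: "given_by (pr x) (proj x)" using X by (intro given_by_proj) simp_all
  show "pr x \<in> hom I (tot x) U" using given_byD[OF r] X by simp
qed

lemma Cmp_pr:
  assumes x: "x \<in> hom I U Cat" and y: "y \<in> hom I U Cat"
  shows "Cmp I y (pr x) \<in> hom I (tot x) Cat" "given_by (Cmp I y (pr x)) (y \<circ>\<^sub>F proj x)"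
proof -
  show "Cmp I y (pr x) \<in> hom I (tot x) Cat" by (rule Cmp_Cat(1)[OF pr_hom(1)[OF x] y])
  show "given_by (Cmp I y (pr x)) (y \<circ>\<^sub>F proj x)"
    by (rule given_by_Cmp[OF given_by_self pr_hom(2)[OF x]]) (use hom_Cat[OF x] hom_Cat[OF y] in simp_all)
qed

lemma h_switch_nonempty:
  assumes x: "x \<in> hom I U Cat" and y: "y \<in> hom I U Cat"
  shows "h_switch Sk x y \<noteq> {}"
proof -
  note X = hom_Cat[OF x] and Y = hom_Cat[OF y]
  note P = given_byD[OF given_by_proj[OF X(2)]] and Q = given_byD[OF given_by_proj[OF Y(2)]]
  have e: "Cmp I y (pr x) = Ho Sk (y \<circ>\<^sub>F pr x)"
    "Cmp I x (pr y) = Ho Sk (x \<circ>\<^sub>F pr y)"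
    using X Y P Q by (simp_all add: Cmp_hCAT)
  have "Cmp I y (pr x) \<cong>\<^sub>F y \<circ>\<^sub>F proj x" "x \<circ>\<^sub>F proj y \<cong>\<^sub>F Cmp I x (pr y)"
    using given_byD(2)[OF Cmp_pr(2)[OF x y]] given_byD(3)[OF Cmp_pr(2)[OF y x]] .
  then show ?thesis unfolding h_switch_def Let_def e iso_fct_def by blast
qed

text \<open>The strict composites \<open>y \<circ> proj x\<close> and \<open>x \<circ> proj y\<close> are interchanged by \<open>switch_fct\<close>. For their
  representatives \<open>c\<close> and \<open>d\<close> the fibres are relabelled before and after, and both conditions on the
  switch can be read off from the strict case because relabelling preserves the projections.\<close>

lemma switch_facts:
  assumes x: "x \<in> hom I U Cat" and y: "y \<in> hom I U Cat"
    and c: "c \<in> hom I (tot x) Cat" and d: "d \<in> hom I (tot y) Cat"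
    and \<phi>: "nat_iso c (y \<circ>\<^sub>F proj x) \<phi>" and \<psi>: "nat_iso (x \<circ>\<^sub>F proj y) d \<psi>"
  defines "S \<equiv> relabel (x \<circ>\<^sub>F proj y) d \<psi> \<circ>\<^sub>F switch_fct x y \<circ>\<^sub>F relabel c (y \<circ>\<^sub>F proj x) \<phi>"
  shows "split_pullback S (id_fct U) (proj x \<circ>\<^sub>F proj c) (proj y \<circ>\<^sub>F proj d)
      (lifts2 x c) (lifts2 y d)"
    and "proj d \<circ>\<^sub>F S = reindex (proj x) c y \<phi>"
    and "\<exists>\<psi>'. nat_iso d (x \<circ>\<^sub>F proj y) \<psi>' \<and> reindex (proj y) d x \<psi>' \<circ>\<^sub>F S = proj c"
proof -
  note X = hom_Cat[OF x] and Y = hom_Cat[OF y] and C = hom_Cat[OF c] and D = hom_Cat[OF d]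
  let ?c = "y \<circ>\<^sub>F proj x" and ?d = "x \<circ>\<^sub>F proj y"
  note [simp] = X(2,3) Y(2,3) C(2,3) D(2,3) ModCats_category[OF X(4)]
  have [simp]: "diag ?c" "diag ?d" by (rule diag_cmp; simp)+
  interpret R1: reindexing "id_fct (tot x)" c ?c \<phi> using \<phi> by unfold_locales simp_all
  interpret R2: reindexing "id_fct (tot y)" ?d d \<psi> using \<psi> by unfold_locales simp_all
  interpret R3: reindexing "proj x" c y \<phi> using \<phi> by unfold_locales simp_all
  interpret p: pair x c by unfold_locales simp_all
  have ySrc: "Src y = Src x" by simp
  have sp: "splitting (proj x \<circ>\<^sub>F proj c) (lifts2 x c)"
    "splitting (proj x \<circ>\<^sub>F proj ?c) (lifts2 x ?c)" by (rule splitting_comp; simp)+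
  have "split_pullback (relabel c ?c \<phi>) (id_fct U) (proj x \<circ>\<^sub>F proj c) (proj x \<circ>\<^sub>F proj ?c)
      (lifts2 x c) (lifts2 x ?c)"
    using split_pullback_vert[OF split_pullback_id[of "proj x" "lifts x"], of "relabel c ?c \<phi>" "proj c" "proj ?c"] R1.split_pullback_reindex by simp
  from split_pullback_horiz[OF this split_pullback_switch[OF X(2) Y(2) ySrc, simplified] sp(1)]
  have s1: "split_pullback (switch_fct x y \<circ>\<^sub>F relabel c ?c \<phi>) (id_fct U) (proj x \<circ>\<^sub>F proj c) (proj y \<circ>\<^sub>F proj ?d)
      (lifts2 x c) (lifts2 y ?d)" using X(4) by (simp add: ModCats_category)
  have "split_pullback (relabel ?d d \<psi>) (id_fct U) (proj y \<circ>\<^sub>F proj ?d) (proj y \<circ>\<^sub>F proj d)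
      (lifts2 y ?d) (lifts2 y d)"
    using split_pullback_vert[OF split_pullback_id[of "proj y" "lifts y"], of "relabel ?d d \<psi>" "proj ?d" "proj d"] R2.split_pullback_reindex by simp
  from split_pullback_horiz[OF s1 this sp(1)]
  have "split_pullback (relabel ?d d \<psi> \<circ>\<^sub>F (switch_fct x y \<circ>\<^sub>F relabel c ?c \<phi>)) (id_fct U)
      (proj x \<circ>\<^sub>F proj c) (proj y \<circ>\<^sub>F proj d)
      (lifts2 x c) (lifts2 y d)" using X(4) by (simp add: ModCats_category)
  then show split_pullback: "split_pullback S (id_fct U) (proj x \<circ>\<^sub>F proj c) (proj y \<circ>\<^sub>F proj d)
      (lifts2 x c) (lifts2 y d)"
    unfolding S_def using proj_switch[OF X(2) Y(2) ySrc] by (simp add: cmp_fct_assoc)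
  have S: "is_functor S" "Src S = tot c" "Tgt S = tot d" using split_pullbackD(1,5,6)[OF split_pullback] by simp_all
  note sw = proj_switch[OF X(2) Y(2) ySrc] proj_switch[OF Y(2) X(2) ySrc[symmetric]]
  have pd: "proj d \<circ>\<^sub>F relabel ?d d \<psi> = proj ?d" and pc: "proj ?c \<circ>\<^sub>F relabel c ?c \<phi> = proj c"
    using split_pullbackD(9,10)[OF R2.split_pullback_reindex] split_pullbackD(9,10)[OF R1.split_pullback_reindex]
    by (intro fct_eqI; simp)+
  have "proj d \<circ>\<^sub>F S = proj d \<circ>\<^sub>F relabel ?d d \<psi> \<circ>\<^sub>F (switch_fct x y \<circ>\<^sub>F relabel c ?c \<phi>)"
    unfolding S_def using sw by (simp add: cmp_fct_assoc)
  then show "proj d \<circ>\<^sub>F S = reindex (proj x) c y \<phi>"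
    unfolding pd proj_switch_relabel[OF X(2) Y(2) ySrc C(2) \<phi>] .
  obtain \<psi>' where \<psi>': "nat_iso d ?d \<psi>'" "relabel d ?d \<psi>' \<circ>\<^sub>F relabel ?d d \<psi> = id_fct (tot ?d)"
    by (rule relabel_inverse[OF _ _ \<psi>]) simp_all
  interpret R4: reindexing "id_fct (tot y)" d ?d \<psi>' using \<psi>' by unfold_locales simp_all
  have "reindex (proj y) d x \<psi>' \<circ>\<^sub>F S = proj ?c \<circ>\<^sub>F (switch_fct y x \<circ>\<^sub>F relabel d ?d \<psi>') \<circ>\<^sub>F S"
    unfolding proj_switch_relabel[OF Y(2) X(2) ySrc[symmetric] D(2) \<psi>'(1)] ..
  also have "\<dots> = proj ?c \<circ>\<^sub>F (switch_fct y x \<circ>\<^sub>F (relabel d ?d \<psi>' \<circ>\<^sub>F relabel ?d d \<psi>) \<circ>\<^sub>F switch_fct x y) \<circ>\<^sub>F relabel c ?c \<phi>"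
    unfolding S_def using sw by (simp add: cmp_fct_assoc)
  also have "\<dots> = proj c"
    unfolding \<psi>'(2) using sw by (simp add: switch_switch pc[simplified])
  finally show "\<exists>\<psi>'. nat_iso d ?d \<psi>' \<and> reindex (proj y) d x \<psi>' \<circ>\<^sub>F S = proj c" using \<psi>'(1) by blast
qed

lemma switch_hCAT:
  assumes x: "x \<in> hom I U Cat" and y: "y \<in> hom I U Cat" and s: "s \<in> h_switch Sk x y"
  defines "c \<equiv> Cmp I y (pr x)" and "d \<equiv> Cmp I x (pr y)"
  shows "s \<in> hom I (tot c) (tot d)"
    and "\<exists>w\<in>h_base_change Sk (pr x) y. Cmp I (pr d) s = w"
    and "\<exists>w\<in>h_base_change Sk (pr y) x. Cmp I w s = pr c"
    and "f \<in> hom I (tot d) Cat \<Longrightarrow> h_sum Sk y (h_sum Sk d f) = h_sum Sk x (h_sum Sk c (Cmp I f s))"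
proof -
  note X = hom_Cat[OF x] and Y = hom_Cat[OF y]
  have c: "c \<in> hom I (tot x) Cat" and d: "d \<in> hom I (tot y) Cat"
    unfolding c_def d_def by (rule Cmp_pr(1)[OF x y], rule Cmp_pr(1)[OF y x])
  note C = hom_Cat[OF c] and D = hom_Cat[OF d]
  obtain \<phi> \<psi> where \<phi>: "nat_iso c (y \<circ>\<^sub>F proj x) \<phi>" and \<psi>: "nat_iso (x \<circ>\<^sub>F proj y) d \<psi>"
    and s_eq: "s = Ho Sk (relabel (x \<circ>\<^sub>F proj y) d \<psi> \<circ>\<^sub>F switch_fct x y \<circ>\<^sub>F relabel c (y \<circ>\<^sub>F proj x) \<phi>)"
    using h_switchE[OF x y s] unfolding c_def[symmetric] d_def[symmetric] by metis
  define S where "S = relabel (x \<circ>\<^sub>F proj y) d \<psi> \<circ>\<^sub>F switch_fct x y \<circ>\<^sub>F relabel c (y \<circ>\<^sub>F proj x) \<phi>"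
  note F = switch_facts[OF x y c d \<phi> \<psi>, folded S_def]
  have S: "is_functor S" "Src S = tot c" "Tgt S = tot d" using split_pullbackD(1,5,6)[OF F(1)] by simp_all
  have rs: "given_by s S" unfolding s_eq S_def[symmetric] using S C D by (intro given_by_HoI) simp_all
  show "s \<in> hom I (tot c) (tot d)" using given_byD[OF rs] S by simp
  have "given_by (Cmp I (pr d) s) (proj d \<circ>\<^sub>F S)" by (rule given_by_Cmp[OF pr_hom(2)[OF d] rs]) (simp add: S)
  then have r1: "given_by (Cmp I (pr d) s) (reindex (proj x) c y \<phi>)" unfolding F(2) .
  \<comment> \<open>Replacing the projection by its representative changes the isomorphism that fills the
    triangle, but not the morphism of hCAT.\<close>
  have "proj x \<cong>\<^sub>F pr x" using given_byD(3)[OF pr_hom(2)[OF x]] .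
  then obtain \<zeta> where \<zeta>: "nat_iso (proj x) (pr x) \<zeta>" unfolding iso_fct_def by blast
  have Tx: "Tgt (proj x) = Src y" using X Y by simp
  note ch = reindex_change[OF Y(2) \<phi> \<zeta> Tx]
  obtain w where "w \<in> h_base_change Sk (pr x) y" "given_by w (reindex (pr x) c y (\<lambda>u. Cmp Cat (FM y (\<zeta> u)) (\<phi> u)))"
    using h_base_changeI[OF pr_hom(1)[OF x] y, folded c_def, OF ch(1)] by blast
  then show "\<exists>w\<in>h_base_change Sk (pr x) y. Cmp I (pr d) s = w"
    using given_by_unique[OF r1 _ ch(2)] by blast
  obtain \<psi>' where \<psi>': "nat_iso d (x \<circ>\<^sub>F proj y) \<psi>'" "reindex (proj y) d x \<psi>' \<circ>\<^sub>F S = proj c" using F(3) by blast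
  have "proj y \<cong>\<^sub>F pr y" using given_byD(3)[OF pr_hom(2)[OF y]] .
  then obtain \<xi> where \<xi>: "nat_iso (proj y) (pr y) \<xi>" unfolding iso_fct_def by blast
  have Ty: "Tgt (proj y) = Src x" using X Y by simp
  note ch' = reindex_change[OF X(2) \<psi>'(1) \<xi> Ty]
  obtain v where v: "v \<in> h_base_change Sk (pr y) x" "given_by v (reindex (pr y) d x (\<lambda>u. Cmp Cat (FM x (\<xi> u)) (\<psi>' u)))"
    using h_base_changeI[OF pr_hom(1)[OF y] x, folded d_def, OF ch'(1)] by blast
  have "given_by v (reindex (proj y) d x \<psi>')" using v(2) iso_fct_sym[OF ch'(2)] by (rule given_by_iso)
  then have "given_by (Cmp I v s) (reindex (proj y) d x \<psi>' \<circ>\<^sub>F S)"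
    by (rule given_by_Cmp[OF _ rs]) (simp add: reindex_def S)
  then have "given_by (Cmp I v s) (proj c)" unfolding \<psi>'(2) .
  then have "Cmp I v s = pr c" using given_by_eq pr_hom(2)[OF c] by blast
  then show "\<exists>w\<in>h_base_change Sk (pr y) x. Cmp I w s = pr c" using v(1) by blast
  assume f: "f \<in> hom I (tot d) Cat"
  let ?e = "Cmp I f s"
  note G = hom_Cat[OF f]
  have re: "given_by ?e (f \<circ>\<^sub>F S)" by (rule given_by_Cmp[OF given_by_self rs]) (simp_all add: G S)
  have e: "?e \<in> hom I (tot c) Cat" using given_byD[OF re] G S by simp
  note E = hom_Cat[OF e]
  obtain \<epsilon> where \<epsilon>: "nat_iso ?e (f \<circ>\<^sub>F S) \<epsilon>" by (rule given_by_nat_iso[OF re])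
  interpret R: reindexing S ?e f \<epsilon> using \<epsilon> G S by unfold_locales simp_all
  have sp: "splitting (proj x \<circ>\<^sub>F proj c) (lifts2 x c)"
    using X C by (intro splitting_comp) simp_all
  have sq: "split_pullback (reindex S ?e f \<epsilon>) (id_fct U) (proj x \<circ>\<^sub>F proj c \<circ>\<^sub>F proj ?e) (proj y \<circ>\<^sub>F proj d \<circ>\<^sub>F proj f)
      (comp_lift (lifts2 x c) (proj ?e) (lifts ?e))
      (comp_lift (lifts2 y d) (proj f) (lifts f))"
    by (rule split_pullback_vert[OF F(1) R.split_pullback_reindex sp])
  have "represents (proj x \<circ>\<^sub>F proj c \<circ>\<^sub>F proj ?e) (comp_lift (lifts2 x c) (proj ?e) (lifts ?e))
      (h_sum Sk y (h_sum Sk d f)) (strict_flat y (h_sum Sk d f) \<circ>\<^sub>F strict_flat d f \<circ>\<^sub>F reindex S ?e f \<epsilon>)"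
    by (rule represents_pre[OF h_sum_represents2[OF y d f]])
      (use sq sp X C E in \<open>simp_all add: splitting_comp\<close>)
  then show "h_sum Sk y (h_sum Sk d f) = h_sum Sk x (h_sum Sk c ?e)"
    using represents_eq[OF _ h_sum_represents2[OF x c e]] h_sum(1)[OF y h_sum(1)[OF d f]]
      h_sum(1)[OF x h_sum(1)[OF c e]] by simp
qed

theorem commutative_dependent_adder_Cat:
  "commutative_dependent_adder I Cat Fcat (Ho Sk p_fct) one_mcat (Ho Sk oneF_fct)
     tot (\<lambda>x. Ho Sk (proj x)) (\<lambda>x. Ho Sk (proj_F x)) (h_base_change Sk)
     (h_sum Sk) (h_flat Sk \<nu>) (h_switch Sk)"
proof (intro commutative_dependent_adder.intro dependent_adder.intro commutative_dependent_adder_axioms.intro)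
  fix U and x y f g h w s :: "('s, 'u) mfct" and U' :: "('s, 'u) mcat"
  show "category I" by (rule category_hCAT)
  show "Cat \<in> Ob I" "Fcat \<in> Ob I" by simp_all
  show "Ho Sk p_fct \<in> hom I Fcat Cat" using given_byD[OF given_by_p] by simp
  show "terminal I one_mcat" by (rule terminal_hCAT)
  show "Ho Sk oneF_fct \<in> hom I one_mcat Fcat" using given_byD[OF given_by_oneF] by (simp add: oneF_facts)
  {
    assume h: "h \<in> hom I U U'" and y: "y \<in> hom I U' Cat"
    obtain \<phi> where \<phi>: "nat_iso (Cmp I y h) (y \<circ>\<^sub>F h) \<phi>" by (rule given_by_nat_iso[OF Cmp_Cat(2)[OF h y]])
    show "h_base_change Sk h y \<noteq> {}" by (rule h_base_changeI[OF h y \<phi>]) blast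
    assume w: "w \<in> h_base_change Sk h y"
    show "w \<in> hom I (tot (Cmp I y h)) (tot y) \<and>
        Cmp I (pr y) w = Cmp I h (pr (Cmp I y h)) \<and>
        Cmp I (Ho Sk (proj_F y)) w = Ho Sk (proj_F (Cmp I y h))"
      using base_change_hCAT[OF h y w] by blast
    assume "g \<in> hom I (tot y) Cat"
    then show "h_sum Sk (Cmp I y h) (Cmp I g w) = Cmp I (h_sum Sk y g) h"
      by (rule dsum_natural_hCAT[OF h y w])
  }
  {
    assume x: "x \<in> hom I U Cat"
    show "weak_pullback I x (Ho Sk p_fct) (tot x) (pr x) (Ho Sk (proj_F x))"
      by (rule weak_pullback_tot[OF x])
    show "h_sum Sk x (const1 (tot x)) = x" by (rule right_unit_hCAT[OF x])
    show "\<exists>\<theta>\<in>h_base_change Sk (Idn I U) x. \<forall>f\<in>hom I (tot x) Cat.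
        h_sum Sk (const1 (tot x)) (Cmp I f (Cmp I \<theta> (h_flat Sk \<nu> x (const1 (tot x))))) = f"
      by (rule left_unit_hCAT[OF x])
    assume f: "f \<in> hom I (tot x) Cat"
    note H = strict_flat_sel[OF x f] and S = h_sum(1)[OF x f]
    show "h_sum Sk x f \<in> hom I U Cat" by (rule S)
    have "given_by (Cmp I (pr (h_sum Sk x f)) (h_flat Sk \<nu> x f)) (proj x \<circ>\<^sub>F proj f)"
      using given_by_Cmp[OF pr_hom(2)[OF S] H(5)] H by simp
    moreover have "given_by (Cmp I (pr x) (pr f)) (proj x \<circ>\<^sub>F proj f)"
      by (rule given_by_Cmp[OF pr_hom(2)[OF x] pr_hom(2)[OF f]]) (simp add: hom_Cat[OF f])
    ultimately show "h_flat Sk \<nu> x f \<in> hom I (tot f) (tot (h_sum Sk x f)) \<and>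
        Cmp I (pr (h_sum Sk x f)) (h_flat Sk \<nu> x f) = Cmp I (pr x) (pr f)"
      using given_byD[OF H(5)] H given_by_eq by simp
    assume g: "g \<in> hom I (tot (h_sum Sk x f)) Cat"
    show "h_sum Sk (h_sum Sk x f) g = h_sum Sk x (h_sum Sk f (Cmp I g (h_flat Sk \<nu> x f)))"
      by (rule sum_assoc_hCAT(1)[OF x f g])
    assume "w \<in> h_base_change Sk (h_flat Sk \<nu> x f) g"
    then show "\<exists>\<theta>\<in>h_base_change Sk (Idn I U) (h_sum Sk (h_sum Sk x f) g).
        Cmp I \<theta> (Cmp I (h_flat Sk \<nu> (h_sum Sk x f) g) w) =
        Cmp I (h_flat Sk \<nu> x (h_sum Sk f (Cmp I g (h_flat Sk \<nu> x f)))) (h_flat Sk \<nu> f (Cmp I g (h_flat Sk \<nu> x f)))"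
      by (rule flatten_assoc_hCAT[OF x f g])
  }
  assume x: "x \<in> hom I U Cat" and y: "y \<in> hom I U Cat"
  show "h_switch Sk x y \<noteq> {}" by (rule h_switch_nonempty[OF x y])
  assume s: "s \<in> h_switch Sk x y"
  note sw = switch_hCAT[OF x y s]
  show "s \<in> hom I (tot (Cmp I y (pr x))) (tot (Cmp I x (pr y))) \<and>
      (\<exists>w\<in>h_base_change Sk (pr x) y. Cmp I (pr (Cmp I x (pr y))) s = w) \<and>
      (\<exists>w\<in>h_base_change Sk (pr y) x. Cmp I w s = pr (Cmp I y (pr x)))"
    using sw(1-3) by blast
  assume "f \<in> hom I (tot (Cmp I x (pr y))) Cat"
  then show "h_sum Sk y (h_sum Sk (Cmp I x (pr y)) f) =
      h_sum Sk x (h_sum Sk (Cmp I y (pr x)) (Cmp I f s))" by (rule sw(4))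
qed

end

theorem mainTheorem5:
  fixes Sk :: "('s, 'u) mfct set"
    and \<nu> :: "('s, 'u) mfct \<Rightarrow> ('s, 'u) moderate \<Rightarrow> ('s, 'u) moderate"
  assumes kappa0: "strongly_inaccessible |UNIV :: 's set|"
    and kappa1: "strongly_inaccessible |UNIV :: 'u set|"
    and kappa_less: "|UNIV :: 's set| <o |UNIV :: 'u set|"
    and skeleton: "functor_skeleton Sk"
    and comparison: "\<And>G. G \<in> ModFcts \<Longrightarrow> nat_iso G (Ho Sk G) (\<nu> G)"
  shows "commutative_dependent_adder (hCAT Sk) Cat Fcat (Ho Sk p_fct) one_mcat (Ho Sk oneF_fct)
           tot (\<lambda>x. Ho Sk (proj x)) (\<lambda>x. Ho Sk (proj_F x)) (h_base_change Sk)
           (h_sum Sk) (h_flat Sk \<nu>) (h_switch Sk)"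
proof -
  interpret hcat Sk \<nu> using assms by unfold_locales
  show ?thesis by (rule commutative_dependent_adder_Cat)
qed

end
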